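(* Let $\Omega\subset\mathbb{R}^3$ be a bounded convex domain and let $\varepsilon\in L^\infty(\Omega)^{3\times3}$ be self-adjoint with constants $\underline{\varepsilon},\overline{\varepsilon}>0$ such that $\underline{\varepsilon}\|\phi\|^2_{L^2(\Omega)}\le(\varepsilon\phi,\phi)_{L^2(\Omega)}\le\overline{\varepsilon}\|\phi\|^2_{L^2(\Omega)}$ for all $\phi\in L^2(\Omega)^3$. Then $c_{\mathrm m,\varepsilon}\le\max\{c_{\mathrm f,\varepsilon},\sqrt{\overline{\varepsilon}}\,c_{\mathrm p}\}$.
   Context: $\|\phi\|_\varepsilon^2=(\varepsilon\phi,\phi)_{L^2(\Omega)}$. $D(\Omega)=\{\phi\in L^2(\Omega)^3:\operatorname{div}\phi\in L^2\}$, $R(\Omega)=\{\phi\in L^2(\Omega)^3:\operatorname{rot}\phi\in L^2\}$ (weak operators), $\mathring{R}(\Omega)$ the closure of $C_c^\infty(\Omega)^3$ in the graph norm of $R(\Omega)$, $\varepsilon^{-1}D(\Omega)=\{\phi:\varepsilon\phi\in D(\Omega)\}$. The tangential Maxwell constant $c_{\mathrm m,\varepsilon}$ is the smallest constant with $\|\phi\|_\varepsilon\le c_{\mathrm m,\varepsilon}\sqrt{\|\operatorname{div}\varepsilon\phi\|^2_{L^2}+\|\operatorname{rot}\phi\|^2_{L^2}}$ for all $\phi\in\mathring{R}(\Omega)\cap\varepsilon^{-1}D(\Omega)$. $c_{\mathrm f,\varepsilon}$ is the smallest constant with $\|\varphi\|_{L^2}\le c_{\mathrm f,\varepsilon}\|\nabla\varphi\|_\varepsilon$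 for all $\varphi\in\mathring{H}^1(\Omega)$ (closure of $C_c^\infty(\Omega)$ in $H^1(\Omega)$). $c_{\mathrm p}$ is the smallest constant with $\|\varphi\|_{L^2}\le c_{\mathrm p}\|\nabla\varphi\|_{L^2}$ for all $\varphi\in H^1(\Omega)$ with zero mean. *)

theory Defs
  imports "HOL-Analysis.Analysis"
begin

fun Ck :: "nat \<Rightarrow> ('a::real_normed_vector \<Rightarrow> 'b::real_normed_vector) \<Rightarrow> bool" where
  "Ck 0 f = continuous_on UNIV f"
| "Ck (Suc k) f = (f differentiable_on UNIV \<and> (\<forall>v. Ck k (\<lambda>x. frechet_derivative f (at x) v)))"

definition smooth :: "('a::real_normed_vector \<Rightarrow> 'b::real_normed_vector) \<Rightarrow> bool" where
  "smooth f = (\<forall>k. Ck k f)"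

definition test_fun :: "(real^3) set \<Rightarrow> (real^3 \<Rightarrow> 'b::real_normed_vector) \<Rightarrow> bool" where
  "test_fun \<Omega> f = (smooth f \<and> compact (closure {x. f x \<noteq> 0}) \<and> closure {x. f x \<noteq> 0} \<subseteq> \<Omega>)"

definition pd :: "(real^3 \<Rightarrow> real) \<Rightarrow> 3 \<Rightarrow> real^3 \<Rightarrow> real" where
  "pd f i x = frechet_derivative f (at x) (axis i 1)"

definition grad :: "(real^3 \<Rightarrow> real) \<Rightarrow> real^3 \<Rightarrow> real^3" where
  "grad f x = (\<chi> i. pd f i x)"

definition rot :: "(real^3 \<Rightarrow> real^3) \<Rightarrow> real^3 \<Rightarrow> real^3" where
  "rot f x = vector [pd (\<lambda>y. f y $ 3) 2 x - pd (\<lambda>y. f y $ 2) 3 x,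
                     pd (\<lambda>y. f y $ 1) 3 x - pd (\<lambda>y. f y $ 3) 1 x,
                     pd (\<lambda>y. f y $ 2) 1 x - pd (\<lambda>y. f y $ 1) 2 x]"

definition L2 :: "(real^3) set \<Rightarrow> (real^3 \<Rightarrow> 'b::euclidean_space) \<Rightarrow> bool" where
  "L2 \<Omega> f = (f \<in> borel_measurable (lebesgue_on \<Omega>) \<and>
               integrable (lebesgue_on \<Omega>) (\<lambda>x. (norm (f x))\<^sup>2))"

definition L2norm :: "(real^3) set \<Rightarrow> (real^3 \<Rightarrow> 'b::euclidean_space) \<Rightarrow> real" where
  "L2norm \<Omega> f = sqrt (integral\<^sup>L (lebesgue_on \<Omega>) (\<lambda>x. (norm (f x))\<^sup>2))"

definition eps_norm :: "(real^3) set \<Rightarrow> (real^3 \<Rightarrow> real^3^3) \<Rightarrow> (real^3 \<Rightarrow> real^3) \<Rightarrow> real" where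
  "eps_norm \<Omega> \<epsilon> f = sqrt (integral\<^sup>L (lebesgue_on \<Omega>) (\<lambda>x. (\<epsilon> x *v f x) \<bullet> f x))"

definition weak_div :: "(real^3) set \<Rightarrow> (real^3 \<Rightarrow> real^3) \<Rightarrow> (real^3 \<Rightarrow> real) \<Rightarrow> bool" where
  "weak_div \<Omega> f g = (L2 \<Omega> f \<and> L2 \<Omega> g \<and>
     (\<forall>\<psi>::real^3 \<Rightarrow> real. test_fun \<Omega> \<psi> \<longrightarrow>
        integral\<^sup>L (lebesgue_on \<Omega>) (\<lambda>x. f x \<bullet> grad \<psi> x) = - integral\<^sup>L (lebesgue_on \<Omega>) (\<lambda>x. g x * \<psi> x)))"

definition weak_rot :: "(real^3) set \<Rightarrow> (real^3 \<Rightarrow> real^3) \<Rightarrow> (real^3 \<Rightarrow> real^3) \<Rightarrow> bool" where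
  "weak_rot \<Omega> f r = (L2 \<Omega> f \<and> L2 \<Omega> r \<and>
     (\<forall>\<psi>::real^3 \<Rightarrow> real^3. test_fun \<Omega> \<psi> \<longrightarrow>
        integral\<^sup>L (lebesgue_on \<Omega>) (\<lambda>x. f x \<bullet> rot \<psi> x) = integral\<^sup>L (lebesgue_on \<Omega>) (\<lambda>x. r x \<bullet> \<psi> x)))"

definition weak_grad :: "(real^3) set \<Rightarrow> (real^3 \<Rightarrow> real) \<Rightarrow> (real^3 \<Rightarrow> real^3) \<Rightarrow> bool" where
  "weak_grad \<Omega> u g = (L2 \<Omega> u \<and> L2 \<Omega> g \<and>
     (\<forall>\<psi>::real^3 \<Rightarrow> real^3. test_fun \<Omega> \<psi> \<longrightarrow>
        integral\<^sup>L (lebesgue_on \<Omega>) (\<lambda>x. u x * (\<Sum>i\<in>UNIV. pd (\<lambda>y. \<psi> y $ i) i x))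
        = - integral\<^sup>L (lebesgue_on \<Omega>) (\<lambda>x. g x \<bullet> \<psi> x)))"

definition R0 :: "(real^3) set \<Rightarrow> (real^3 \<Rightarrow> real^3) \<Rightarrow> (real^3 \<Rightarrow> real^3) \<Rightarrow> bool" where
  "R0 \<Omega> f r = (weak_rot \<Omega> f r \<and>
     (\<exists>\<psi>::nat \<Rightarrow> real^3 \<Rightarrow> real^3. (\<forall>n. test_fun \<Omega> (\<psi> n)) \<and>
        (\<lambda>n. (L2norm \<Omega> (\<lambda>x. \<psi> n x - f x))\<^sup>2 + (L2norm \<Omega> (\<lambda>x. rot (\<psi> n) x - r x))\<^sup>2)
          \<longlonglongrightarrow> 0))"

definition H10 :: "(real^3) set \<Rightarrow> (real^3 \<Rightarrow> real) \<Rightarrow> (real^3 \<Rightarrow> real^3) \<Rightarrow> bool" where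
  "H10 \<Omega> u g = (weak_grad \<Omega> u g \<and>
     (\<exists>\<psi>::nat \<Rightarrow> real^3 \<Rightarrow> real. (\<forall>n. test_fun \<Omega> (\<psi> n)) \<and>
        (\<lambda>n. (L2norm \<Omega> (\<lambda>x. \<psi> n x - u x))\<^sup>2 + (L2norm \<Omega> (\<lambda>x. grad (\<psi> n) x - g x))\<^sup>2)
          \<longlonglongrightarrow> 0))"

text \<open>Smallest nonnegative constant satisfying a property (infinity if none exists).\<close>
definition least_const :: "(real \<Rightarrow> bool) \<Rightarrow> ereal" where
  "least_const P = Inf {ereal c | c. 0 \<le> c \<and> P c}"

definition c_m :: "(real^3) set \<Rightarrow> (real^3 \<Rightarrow> real^3^3) \<Rightarrow> ereal" where
  "c_m \<Omega> \<epsilon> = least_const (\<lambda>c. \<forall>\<phi> r g.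
      R0 \<Omega> \<phi> r \<and> weak_div \<Omega> (\<lambda>x. \<epsilon> x *v \<phi> x) g \<longrightarrow>
      eps_norm \<Omega> \<epsilon> \<phi> \<le> c * sqrt ((L2norm \<Omega> g)\<^sup>2 + (L2norm \<Omega> r)\<^sup>2))"

definition c_f :: "(real^3) set \<Rightarrow> (real^3 \<Rightarrow> real^3^3) \<Rightarrow> ereal" where
  "c_f \<Omega> \<epsilon> = least_const (\<lambda>c. \<forall>u g.
      H10 \<Omega> u g \<longrightarrow> L2norm \<Omega> u \<le> c * eps_norm \<Omega> \<epsilon> g)"

definition c_p :: "(real^3) set \<Rightarrow> ereal" where
  "c_p \<Omega> = least_const (\<lambda>c. \<forall>u g.
      weak_grad \<Omega> u g \<and> integral\<^sup>L (lebesgue_on \<Omega>) u = 0 \<longrightarrow> L2norm \<Omega> u \<le> c * L2norm \<Omega> g)"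

end

theory Submission
  imports Defs
begin

text \<open>
  By \<open>\<parallel>\<phi>\<parallel>\<^sub>\<epsilon>\<^sup>2 \<le> \<parallel>\<phi> - \<nabla>u\<parallel>\<^sub>\<epsilon>\<^sup>2 + c\<^sub>f\<^sup>2 \<parallel>div \<epsilon>\<phi>\<parallel>\<^sup>2\<close> for test functions \<open>u\<close>, everything reduces to the
  case \<open>\<epsilon> = 1\<close>: the distance of a test field \<open>\<phi>\<close> to the gradients of test functions is at most
  \<open>c\<^sub>p \<parallel>rot \<phi>\<parallel>\<close>. If \<open>E\<close> is the remainder, which is divergence-free, then on a convex domain
  \<open>E = rot A\<close>, and \<open>\<parallel>E\<parallel>\<^sup>2 = (\<phi>, E) = (rot \<phi>, A) = (rot \<phi>, \<Psi>)\<close> for every \<open>\<Psi> = A - \<nabla>w\<close>. Choosing \<open>\<Psi>\<close>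
  orthogonal to all gradients, that is, divergence-free with vanishing normal trace, convexity gives
  Gaffney's inequality \<open>\<parallel>\<nabla>\<Psi>\<parallel> \<le> \<parallel>rot \<Psi>\<parallel> = \<parallel>E\<parallel>\<close>, and the Poincare inequality bounds \<open>(rot \<phi>, \<Psi>)\<close> by
  \<open>c\<^sub>p \<parallel>rot \<phi>\<parallel> \<parallel>E\<parallel>\<close> because \<open>rot \<phi>\<close> has mean zero.

  Boundary regularity is avoided by working on the whole space with weights \<open>exp (- V)\<close>, where \<open>V\<close> is
  convex, vanishes on the domain and is large outside: convexity of \<open>V\<close> replaces that of the
  boundary. Interior regularity and completeness of \<open>L\<^sup>2\<close> are avoided by mollifying fields that are
  only nearly orthogonal to the gradients.
\<close>

section \<open>Square integrable functions\<close>

text \<open>The sharp constant dictates the form of the argument. The boundary term in Gaffney's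
  inequality becomes the Hessian of \<open>V\<close>, a term of known sign, so the factor in front
  of the rotation stays 1; the scalar Poincare inequality, applied to each Cartesian component, then
  contributes its constant unchanged. In the weighted space, near-orthogonality to gradients says
  that the weighted divergence \<open>div \<Psi> - V' \<bullet> \<Psi>\<close> is nearly zero, which
  replaces both the divergence condition and the condition on the normal trace.

  A near-minimiser has no regularity that is uniform in the accuracy \<open>\<delta>\<close>. Hence
  the mollification radius is fixed first and \<open>\<delta>\<close> is made small against the size
  of the kernels; wherever a mollified field is compared with the original one, the mollifier is
  moved to the fixed partner of the pairing.

  In a domain the kernels are test functions only away from the boundary. The vector potential is
  therefore built on a copy of the domain contracted towards an interior point, which is convex,
  still contains the support of the given field, and has no larger Poincare constant.\<close>

lemma quadratic_nonneg_imp_discriminant: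
  fixes a b c :: real
  assumes "\<And>t. 0 \<le> a + 2 * t * b + t\<^sup>2 * c" "0 \<le> c"
  shows "b\<^sup>2 \<le> a * c"
proof (cases "c = 0")
  case True
  have "b = 0"
  proof (rule ccontr)
    assume "b \<noteq> 0"
    then have "2 * (- (a + 1) / (2 * b)) * b = - (a + 1)"
      by simp
    then show False
      using assms(1)[of "- (a + 1) / (2 * b)"] True by simp
  qed
  then show ?thesis using True by simp
next
  case False
  then show ?thesis
    using assms(1)[of "- b / c"] assms(2)
    by (simp add: field_simps power2_eq_square)
qed

text \<open>For an arbitrary measure, because most of the argument lives on \<open>lborel\<close>
  and the statement on \<open>lebesgue_on \<Omega>\<close>; \<open>L2_eq\<close> and
  \<open>L2norm_eq\<close> identify these notions with those of the statement.\<close>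

definition square_integrable :: "'a measure \<Rightarrow> ('a \<Rightarrow> 'b::euclidean_space) \<Rightarrow> bool" where
  "square_integrable M f \<longleftrightarrow> f \<in> borel_measurable M \<and> integrable M (\<lambda>x. (norm (f x))\<^sup>2)"

definition l2norm :: "'a measure \<Rightarrow> ('a \<Rightarrow> 'b::euclidean_space) \<Rightarrow> real" where
  "l2norm M f = sqrt (integral\<^sup>L M (\<lambda>x. (norm (f x))\<^sup>2))"

lemma l2norm_nonneg [simp]: "0 \<le> l2norm M f"
  by (simp add: l2norm_def)

lemma l2norm_sq: "(l2norm M f)\<^sup>2 = integral\<^sup>L M (\<lambda>x. (norm (f x))\<^sup>2)"
  by (simp add: l2norm_def)

lemma square_integrable_inner:
  assumes f: "square_integrable M f" and g: "square_integrable M g"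
  shows "integrable M (\<lambda>x. f x \<bullet> g x)"
proof (rule Bochner_Integration.integrable_bound)
  show "integrable M (\<lambda>x. (norm (f x))\<^sup>2 + (norm (g x))\<^sup>2)"
    using f g by (auto simp: square_integrable_def)
  show "(\<lambda>x. f x \<bullet> g x) \<in> borel_measurable M"
    using f g by (auto simp: square_integrable_def)
  have "\<bar>f x \<bullet> g x\<bar> \<le> (norm (f x))\<^sup>2 + (norm (g x))\<^sup>2" for x
    using Cauchy_Schwarz_ineq2[of "f x" "g x"] sum_squares_bound[of "norm (f x)" "norm (g x)"]
      mult_nonneg_nonneg[OF norm_ge_zero[of "f x"] norm_ge_zero[of "g x"]] by linarith
  then show "AE x in M. norm (f x \<bullet> g x) \<le> norm ((norm (f x))\<^sup>2 + (norm (g x))\<^sup>2)"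
    by simp
qed

lemma norm_add_sq: "(norm (x + c *\<^sub>R y))\<^sup>2 = (norm x)\<^sup>2 + 2 * c * (x \<bullet> y) + c\<^sup>2 * (norm y)\<^sup>2"
  for x y :: "'b::real_inner"
  by (simp add: power2_norm_eq_inner inner_simps inner_commute[of y x])
    (simp add: power2_eq_square power2_norm_eq_inner[symmetric] algebra_simps)

lemma square_integrable_add_scaleR:
  assumes f: "square_integrable M f" and g: "square_integrable M g"
  shows "square_integrable M (\<lambda>x. f x + c *\<^sub>R g x)"
  using f g square_integrable_inner[OF f g]
  by (auto simp: square_integrable_def norm_add_sq)

lemma square_integrable_diff:
  assumes f: "square_integrable M f" and g: "square_integrable M g"
  shows "square_integrable M (\<lambda>x. f x - g x)"
  using square_integrable_add_scaleR[OF assms, of "-1"] by simp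

lemma l2norm_add_scaleR_sq:
  assumes f: "square_integrable M f" and g: "square_integrable M g"
  shows "(l2norm M (\<lambda>x. f x + c *\<^sub>R g x))\<^sup>2
    = (l2norm M f)\<^sup>2 + 2 * c * integral\<^sup>L M (\<lambda>x. f x \<bullet> g x) + c\<^sup>2 * (l2norm M g)\<^sup>2"
  using f g square_integrable_inner[OF f g]
  by (simp add: l2norm_sq norm_add_sq square_integrable_def)

lemma l2_Cauchy_Schwarz:
  assumes f: "square_integrable M f" and g: "square_integrable M g"
  shows "\<bar>integral\<^sup>L M (\<lambda>x. f x \<bullet> g x)\<bar> \<le> l2norm M f * l2norm M g"
proof -
  have "(integral\<^sup>L M (\<lambda>x. f x \<bullet> g x))\<^sup>2 \<le> (l2norm M f)\<^sup>2 * (l2norm M g)\<^sup>2"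
  proof (rule quadratic_nonneg_imp_discriminant)
    show "0 \<le> (l2norm M f)\<^sup>2 + 2 * t * integral\<^sup>L M (\<lambda>x. f x \<bullet> g x) + t\<^sup>2 * (l2norm M g)\<^sup>2" for t
      by (subst l2norm_add_scaleR_sq[OF assms, symmetric]) simp
  qed simp
  then have "(integral\<^sup>L M (\<lambda>x. f x \<bullet> g x))\<^sup>2 \<le> (l2norm M f * l2norm M g)\<^sup>2"
    by (simp add: power_mult_distrib)
  then show ?thesis
    by (metis abs_le_square_iff abs_of_nonneg l2norm_nonneg mult_nonneg_nonneg)
qed

lemma l2norm_triangle:
  assumes f: "square_integrable M f" and g: "square_integrable M g"
  shows "l2norm M (\<lambda>x. f x + g x) \<le> l2norm M f + l2norm M g"
proof (rule power2_le_imp_le)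
  have "(l2norm M (\<lambda>x. f x + g x))\<^sup>2
      = (l2norm M f)\<^sup>2 + 2 * integral\<^sup>L M (\<lambda>x. f x \<bullet> g x) + (l2norm M g)\<^sup>2"
    using l2norm_add_scaleR_sq[OF assms, of 1] by simp
  also have "\<dots> \<le> (l2norm M f + l2norm M g)\<^sup>2"
    using l2_Cauchy_Schwarz[OF assms] by (simp add: power2_sum)
  finally show "(l2norm M (\<lambda>x. f x + g x))\<^sup>2 \<le> (l2norm M f + l2norm M g)\<^sup>2" .
qed simp

lemma l2norm_uminus: "l2norm M (\<lambda>x. - f x) = l2norm M f"
  by (simp add: l2norm_def)

lemma square_integrable_uminus: "square_integrable M f \<Longrightarrow> square_integrable M (\<lambda>x. - f x)"
  by (simp add: square_integrable_def)

lemma l2norm_triangle_diff: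
  assumes f: "square_integrable M f" and g: "square_integrable M g"
  shows "l2norm M (\<lambda>x. f x - g x) \<le> l2norm M f + l2norm M g"
  using l2norm_triangle[OF f square_integrable_uminus[OF g]] by (simp add: l2norm_uminus)

lemma l2norm_mono:
  assumes "\<And>x. norm (f x) \<le> norm (g x)" "square_integrable M f" "square_integrable M g"
  shows "l2norm M f \<le> l2norm M g"
  using assms unfolding l2norm_def square_integrable_def
  by (intro real_sqrt_le_mono integral_mono) (auto intro: power_mono)

text \<open>A near-minimiser of the distance replaces the orthogonal projection, so that no completeness
  is needed.\<close>

lemma near_orthogonal_remainder:
  fixes f :: "'a \<Rightarrow> 'b::euclidean_space"
  assumes f: "square_integrable M f"
    and G: "\<And>g. g \<in> G \<Longrightarrow> square_integrable M g"
    and zero: "(\<lambda>x. 0) \<in> G"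
    and lin: "\<And>g h c. g \<in> G \<Longrightarrow> h \<in> G \<Longrightarrow> (\<lambda>x. g x + c *\<^sub>R h x) \<in> G"
    and \<delta>: "0 < \<delta>"
  obtains g where "g \<in> G"
    "\<And>h. h \<in> G \<Longrightarrow> \<bar>integral\<^sup>L M (\<lambda>x. (f x - g x) \<bullet> h x)\<bar> \<le> \<delta> * l2norm M h"
    "(l2norm M (\<lambda>x. f x - g x))\<^sup>2 \<le> (l2norm M f)\<^sup>2 + \<delta>\<^sup>2"
proof -
  define N where "N g = (l2norm M (\<lambda>x. f x - g x))\<^sup>2" for g
  define d where "d = Inf (N ` G)"
  have bdd: "bdd_below (N ` G)"
    by (rule bdd_belowI[of _ 0]) (auto simp: N_def)
  have d_le: "d \<le> N g" if "g \<in> G" for g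
    unfolding d_def using bdd that by (intro cInf_lower) auto
  have "d < d + \<delta>\<^sup>2" using \<delta> by simp
  then obtain g where g: "g \<in> G" "N g < d + \<delta>\<^sup>2"
    unfolding d_def using cInf_lessD[of "N ` G"] zero by blast
  show thesis
  proof
    show "g \<in> G" by fact
    have "N g \<le> N (\<lambda>x. 0) + \<delta>\<^sup>2" using d_le[OF zero] g by simp
    then show "(l2norm M (\<lambda>x. f x - g x))\<^sup>2 \<le> (l2norm M f)\<^sup>2 + \<delta>\<^sup>2" by (simp add: N_def)
    fix h assume h: "h \<in> G"
    let ?b = "integral\<^sup>L M (\<lambda>x. (f x - g x) \<bullet> h x)"
    have fg: "square_integrable M (\<lambda>x. f x - g x)"
      using f G[OF g(1)] by (rule square_integrable_diff)
    \<comment> \<open>No step from \<open>g\<close> along \<open>h\<close> gets below the infimum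
      \<open>d\<close>, while \<open>N g\<close> exceeds \<open>d\<close> by less than
      \<open>\<delta>\<^sup>2\<close>. So the increment of \<open>N\<close>, a quadratic in
      \<open>t\<close>, becomes nonnegative once \<open>\<delta>\<^sup>2\<close> is added, and its
      discriminant gives the bound.\<close>
    have "?b\<^sup>2 \<le> \<delta>\<^sup>2 * (l2norm M h)\<^sup>2"
    proof (rule quadratic_nonneg_imp_discriminant)
      fix t
      have "d \<le> N (\<lambda>x. g x + (- t) *\<^sub>R h x)"
        by (rule d_le[OF lin[OF g(1) h]])
      also have "\<dots> = (l2norm M (\<lambda>x. (f x - g x) + t *\<^sub>R h x))\<^sup>2"
        by (simp add: N_def algebra_simps)
      also have "\<dots> = N g + 2 * t * ?b + t\<^sup>2 * (l2norm M h)\<^sup>2"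
        by (subst l2norm_add_scaleR_sq[OF fg G[OF h]]) (simp add: N_def)
      finally show "0 \<le> \<delta>\<^sup>2 + 2 * t * ?b + t\<^sup>2 * (l2norm M h)\<^sup>2"
        using g(2) by simp
    qed simp
    then have "?b\<^sup>2 \<le> (\<delta> * l2norm M h)\<^sup>2" by (simp add: power_mult_distrib)
    then show "\<bar>?b\<bar> \<le> \<delta> * l2norm M h"
      using \<delta> by (metis abs_le_square_iff abs_of_nonneg l2norm_nonneg less_imp_le mult_nonneg_nonneg)
  qed
qed

section \<open>Continuous functions with bounded support\<close>

text \<open>Boundedness of the nonzero set amounts to compact support, but passes to sums and
  products without closures. Membership yields integrability, boundedness and uniform continuity,
  which discharges the side conditions of the integrals over the whole space.\<close>

definition Cc :: "('a::euclidean_space \<Rightarrow> 'b::euclidean_space) \<Rightarrow> bool" where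
  "Cc f \<longleftrightarrow> continuous_on UNIV f \<and> bounded {x. f x \<noteq> 0}"

lemma Cc_subset:
  assumes "Cc f" "continuous_on UNIV g" "\<And>x. f x = 0 \<Longrightarrow> g x = 0"
  shows "Cc g"
  using assms unfolding Cc_def by (auto elim!: bounded_subset)

lemma Cc_continuous: "Cc f \<Longrightarrow> continuous_on A f"
  unfolding Cc_def using continuous_on_subset by blast

lemma Cc_radius:
  assumes "Cc f"
  obtains r where "r > 0" "\<And>x. r < norm x \<Longrightarrow> f x = 0"
proof -
  obtain r where "r > 0" "\<forall>x\<in>{x. f x \<noteq> 0}. norm x \<le> r"
    using assms unfolding Cc_def bounded_pos by blast
  then show thesis by (intro that[of r]) (auto simp: not_le[symmetric])
qed

lemma CcI_radius:
  assumes "continuous_on UNIV f" "\<And>x. r < norm x \<Longrightarrow> f x = 0"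
  shows "Cc f"
  unfolding Cc_def bounded_iff using assms by (metis (mono_tags, lifting) linorder_not_le mem_Collect_eq)

lemma Cc_borel [measurable_dest]: "Cc f \<Longrightarrow> f \<in> borel_measurable borel"
  by (simp add: Cc_def borel_measurable_continuous_onI)

lemma Cc_integrable: 
  assumes "Cc f" shows "integrable lborel f"
proof -
  obtain r where r: "\<And>x. r < norm x \<Longrightarrow> f x = 0" using Cc_radius[OF assms] by metis
  have "integrable lborel (\<lambda>x. indicator (cball 0 r) x *\<^sub>R f x)"
    by (intro borel_integrable_compact Cc_continuous[OF assms]) auto
  moreover have "(\<lambda>x. indicator (cball 0 r) x *\<^sub>R f x) = f"
    using r by (force simp: indicator_def not_le)
  ultimately show ?thesis by simp
qed

lemma Cc_bound:
  assumes "Cc f"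
  obtains B where "B > 0" "\<And>x. norm (f x) \<le> B"
proof -
  obtain r where r: "\<And>x. r < norm x \<Longrightarrow> f x = 0" using Cc_radius[OF assms] by metis
  have "compact (f ` cball 0 r)"
    by (intro compact_continuous_image Cc_continuous[OF assms]) auto
  then obtain B where B: "B > 0" "\<And>x. x \<in> cball 0 r \<Longrightarrow> norm (f x) \<le> B"
    using compact_imp_bounded bounded_pos by (metis imageI)
  show thesis
  proof
    show "norm (f x) \<le> B" for x
      using B r[of x] by (cases "x \<in> cball 0 r") auto
  qed fact
qed

lemma Cc_add:
  assumes "Cc f" "Cc g" shows "Cc (\<lambda>x. f x + g x)"
proof -
  have "bounded ({x. f x \<noteq> 0} \<union> {x. g x \<noteq> 0})"
    using assms unfolding Cc_def by (auto simp only: bounded_Un)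
  then have "bounded {x. f x + g x \<noteq> 0}"
    by (rule bounded_subset) auto
  then show ?thesis
    using assms unfolding Cc_def by (blast intro: continuous_on_add)
qed

lemma Cc_scaleR_left: "Cc f \<Longrightarrow> continuous_on UNIV g \<Longrightarrow> Cc (\<lambda>x. f x *\<^sub>R g x)"
  by (rule Cc_subset[of f]) (auto simp: Cc_def intro!: continuous_intros)

lemma Cc_scaleR_right: "Cc f \<Longrightarrow> continuous_on UNIV g \<Longrightarrow> Cc (\<lambda>x. g x *\<^sub>R f x)"
  by (rule Cc_subset[of f]) (auto simp: Cc_def intro!: continuous_intros)

lemma Cc_mult_left: "Cc f \<Longrightarrow> continuous_on UNIV g \<Longrightarrow> Cc (\<lambda>x. f x * g x :: real)"
  by (rule Cc_subset[of f]) (auto simp: Cc_def intro!: continuous_intros)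

lemma Cc_mult_right: "Cc f \<Longrightarrow> continuous_on UNIV g \<Longrightarrow> Cc (\<lambda>x. g x * f x :: real)"
  by (rule Cc_subset[of f]) (auto simp: Cc_def intro!: continuous_intros)

lemma Cc_inner_left: "Cc f \<Longrightarrow> continuous_on UNIV g \<Longrightarrow> Cc (\<lambda>x. f x \<bullet> g x)"
  by (rule Cc_subset[of f]) (auto simp: Cc_def intro!: continuous_intros)

lemma Cc_inner_right: "Cc f \<Longrightarrow> continuous_on UNIV g \<Longrightarrow> Cc (\<lambda>x. g x \<bullet> f x)"
  by (rule Cc_subset[of f]) (auto simp: Cc_def intro!: continuous_intros)

lemma Cc_uminus: "Cc f \<Longrightarrow> Cc (\<lambda>x. - f x)"
  by (rule Cc_subset[of f]) (auto simp: Cc_def intro!: continuous_intros)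

lemma Cc_diff: "Cc f \<Longrightarrow> Cc g \<Longrightarrow> Cc (\<lambda>x. f x - g x)"
  using Cc_add[OF _ Cc_uminus, of f g] by simp

lemma Cc_0: "Cc (\<lambda>x. 0)"
  by (simp add: Cc_def)

lemma Cc_sum: "(\<And>i. i \<in> I \<Longrightarrow> Cc (f i)) \<Longrightarrow> Cc (\<lambda>x. \<Sum>i\<in>I. f i x)"
  by (induction I rule: infinite_finite_induct) (auto intro: Cc_0 Cc_add)

lemma Cc_nth: "Cc f \<Longrightarrow> Cc (\<lambda>x. f x $ i :: real)"
  by (rule Cc_subset[of f]) (auto simp: Cc_def intro!: continuous_intros)

lemma Cc_norm: "Cc f \<Longrightarrow> Cc (\<lambda>x. norm (f x))"
  by (rule Cc_subset[of f]) (auto simp: Cc_def intro!: continuous_intros)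

lemma Cc_power2: "Cc f \<Longrightarrow> Cc (\<lambda>x. (f x :: real)\<^sup>2)"
  by (rule Cc_subset[of f]) (auto simp: Cc_def intro!: continuous_intros)

lemma Cc_shift:
  assumes "Cc f" shows "Cc (\<lambda>x. f (x + a))"
proof -
  obtain r where r: "\<And>x. r < norm x \<Longrightarrow> f x = 0" using Cc_radius[OF assms] by metis
  show ?thesis
  proof (rule CcI_radius[where r = "r + norm a"])
    show "continuous_on UNIV (\<lambda>x. f (x + a))"
      by (intro continuous_on_compose2[OF Cc_continuous[OF assms, of UNIV]] continuous_intros) auto
    show "r + norm a < norm x \<Longrightarrow> f (x + a) = 0" for x
      using norm_diff_ineq[of x a] by (intro r) auto
  qed
qed

lemma Cc_reflect:
  assumes "Cc f" shows "Cc (\<lambda>y. f (x - y))"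
proof -
  obtain r where r: "\<And>x. r < norm x \<Longrightarrow> f x = 0" using Cc_radius[OF assms] by metis
  show ?thesis
  proof (rule CcI_radius[where r = "r + norm x"])
    show "continuous_on UNIV (\<lambda>y. f (x - y))"
      by (intro continuous_on_compose2[OF Cc_continuous[OF assms, of UNIV]] continuous_intros) auto
    show "r + norm x < norm y \<Longrightarrow> f (x - y) = 0" for y
      using norm_triangle_ineq2[of y x] by (intro r) (simp add: norm_minus_commute)
  qed
qed

lemma Cc_square_integrable: "Cc f \<Longrightarrow> square_integrable lborel f"
  unfolding square_integrable_def
  using Cc_integrable[OF Cc_power2[OF Cc_norm]] by (auto dest: Cc_borel)

lemma Cc_uniformly_continuous:
  assumes "Cc f" shows "uniformly_continuous_on UNIV f"
proof -
  obtain r where r: "\<And>x. r < norm x \<Longrightarrow> f x = 0" using Cc_radius[OF assms] by metis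
  have uc: "uniformly_continuous_on (cball 0 (r + 1)) f"
    by (intro compact_uniformly_continuous Cc_continuous[OF assms]) auto
  show ?thesis unfolding uniformly_continuous_on_def
  proof (intro allI impI)
    fix e :: real assume "e > 0"
    then obtain d where d: "d > 0" "\<And>x x'. x \<in> cball 0 (r + 1) \<Longrightarrow> x' \<in> cball 0 (r + 1) \<Longrightarrow>
        dist x' x < d \<Longrightarrow> dist (f x') (f x) < e"
      using uc unfolding uniformly_continuous_on_def by blast
    show "\<exists>d>0. \<forall>x\<in>UNIV. \<forall>x'\<in>UNIV. dist x' x < d \<longrightarrow> dist (f x') (f x) < e"
    proof (intro exI[of _ "min d 1"] conjI ballI impI)
      fix x x' :: 'a assume dd: "dist x' x < min d 1"
      show "dist (f x') (f x) < e"
      proof (cases "x \<in> cball 0 (r + 1) \<and> x' \<in> cball 0 (r + 1)")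
        case True then show ?thesis using d dd by auto
      next
        case False
        then have "r < norm x \<and> r < norm x'"
          using dd norm_triangle_sub[of x x'] norm_triangle_sub[of x' x]
          by (auto simp: dist_norm norm_minus_commute)
        then show ?thesis using r \<open>e > 0\<close> by auto
      qed
    qed (use d in auto)
  qed
qed

lemma lborel_integral_shift:
  fixes f :: "'a::euclidean_space \<Rightarrow> 'b::euclidean_space"
  assumes "f \<in> borel_measurable borel"
  shows "(\<integral>x. f (x + a) \<partial>lborel) = integral\<^sup>L lborel f"
proof -
  have "integral\<^sup>L lborel f = integral\<^sup>L (distr lborel borel ((+) a)) f"
    by (simp add: lborel_distr_plus)
  also have "\<dots> = (\<integral>x. f (a + x) \<partial>lborel)"
    using assms by (intro integral_distr) auto
  finally show ?thesis by (simp add: add.commute)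
qed

lemma Cc_Fubini:
  fixes k :: "'a::euclidean_space \<Rightarrow> 'c::euclidean_space \<Rightarrow> real"
  assumes "Cc (\<lambda>(x, y). k x y)"
  shows "(\<integral>y. (\<integral>x. k x y \<partial>lborel) \<partial>lborel) = (\<integral>x. (\<integral>y. k x y \<partial>lborel) \<partial>lborel)"
  using Cc_integrable[OF assms] by (intro lborel_pair.Fubini_integral) (simp add: lborel_prod)

section \<open>Continuously differentiable functions\<close>

text \<open>A relation between a C1 function and its gradient: gradients are assembled by the rules
  below, and \<open>cgrad_unique\<close> identifies them with those computed otherwise. Second
  derivatives are recorded only for the potentials \<open>V\<close>, as gradients of the components
  of \<open>V'\<close>.\<close>

definition cgrad :: "('a::euclidean_space \<Rightarrow> real) \<Rightarrow> ('a \<Rightarrow> 'a) \<Rightarrow> bool" where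
  "cgrad f g \<longleftrightarrow> (\<forall>x. (f has_derivative (\<lambda>v. g x \<bullet> v)) (at x)) \<and> continuous_on UNIV g"

lemma cgradI:
  "(\<And>x. (f has_derivative (\<lambda>v. g x \<bullet> v)) (at x)) \<Longrightarrow> continuous_on UNIV g \<Longrightarrow> cgrad f g"
  by (simp add: cgrad_def)

lemma cgradD: "cgrad f g \<Longrightarrow> (f has_derivative (\<lambda>v. g x \<bullet> v)) (at x within S)"
  unfolding cgrad_def using has_derivative_at_withinI by blast

lemma cgrad_cont_grad: "cgrad f g \<Longrightarrow> continuous_on A g"
  unfolding cgrad_def using continuous_on_subset by blast

lemma cgrad_continuous: "cgrad f g \<Longrightarrow> continuous_on A f"
  by (meson cgradD has_derivative_continuous_on)

lemma cgrad_const: "cgrad (\<lambda>x. c) (\<lambda>x. 0)"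
  by (rule cgradI) (auto intro!: derivative_eq_intros)

lemma cgrad_inner: "cgrad (\<lambda>x. x \<bullet> a) (\<lambda>x. a)"
  by (rule cgradI) (auto intro!: derivative_eq_intros simp: inner_commute)

lemma cgrad_norm_sq: "cgrad (\<lambda>x. x \<bullet> x) (\<lambda>x. 2 *\<^sub>R x)"
  by (rule cgradI) (auto intro!: derivative_eq_intros continuous_intros simp: inner_commute)

lemma cgrad_add: "cgrad f f' \<Longrightarrow> cgrad h h' \<Longrightarrow> cgrad (\<lambda>x. f x + h x) (\<lambda>x. f' x + h' x)"
  by (rule cgradI)
    (auto intro!: derivative_eq_intros continuous_intros simp: inner_add_left
      elim: cgradD cgrad_cont_grad)

lemma cgrad_mult:
  "cgrad f f' \<Longrightarrow> cgrad h h' \<Longrightarrow> cgrad (\<lambda>x. f x * h x) (\<lambda>x. f x *\<^sub>R h' x + h x *\<^sub>R f' x)"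
  by (rule cgradI)
    (auto intro!: derivative_eq_intros continuous_on_add continuous_on_scaleR
      simp: inner_add_left algebra_simps elim: cgradD cgrad_cont_grad cgrad_continuous)

lemma cgrad_cmult: "cgrad f f' \<Longrightarrow> cgrad (\<lambda>x. c * f x) (\<lambda>x. c *\<^sub>R f' x)"
  using cgrad_mult[OF cgrad_const, of f f' c] by simp

lemma cgrad_uminus: "cgrad f f' \<Longrightarrow> cgrad (\<lambda>x. - f x) (\<lambda>x. - f' x)"
  using cgrad_cmult[of f f' "-1"] by simp

lemma cgrad_diff: "cgrad f f' \<Longrightarrow> cgrad h h' \<Longrightarrow> cgrad (\<lambda>x. f x - h x) (\<lambda>x. f' x - h' x)"
  using cgrad_add[OF _ cgrad_uminus, of f f' h h'] by simp

lemma cgrad_sum: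
  "(\<And>i. i \<in> I \<Longrightarrow> cgrad (f i) (f' i)) \<Longrightarrow> cgrad (\<lambda>x. \<Sum>i\<in>I. f i x) (\<lambda>x. \<Sum>i\<in>I. f' i x)"
  by (induction I rule: infinite_finite_induct) (auto intro: cgrad_const cgrad_add)

lemma cgrad_compose_real:
  assumes f: "cgrad f f'" and p: "\<And>t. (p has_real_derivative p' t) (at t)" and c: "continuous_on UNIV p'"
  shows "cgrad (\<lambda>x. p (f x)) (\<lambda>x. p' (f x) *\<^sub>R f' x)"
proof (rule cgradI)
  show "((\<lambda>x. p (f x)) has_derivative (\<lambda>v. (p' (f x) *\<^sub>R f' x) \<bullet> v)) (at x)" for x
    using has_derivative_compose[OF cgradD[OF f] p[unfolded has_field_derivative_def], of x UNIV]
    by (simp add: mult.commute)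
  show "continuous_on UNIV (\<lambda>x. p' (f x) *\<^sub>R f' x)"
    by (intro continuous_on_scaleR continuous_on_compose2[OF c] cgrad_continuous[OF f]
        cgrad_cont_grad[OF f]) auto
qed

lemma cgrad_affine:
  assumes "cgrad f f'" 
  shows "cgrad (\<lambda>x. f (a + c *\<^sub>R x)) (\<lambda>x. c *\<^sub>R f' (a + c *\<^sub>R x))"
proof (rule cgradI)
  have "((\<lambda>x. a + c *\<^sub>R x) has_derivative (\<lambda>v. c *\<^sub>R v)) (at x)" for x
    by (auto intro!: derivative_eq_intros)
  from has_derivative_compose[OF this cgradD[OF assms]]
  show "((\<lambda>x. f (a + c *\<^sub>R x)) has_derivative (\<lambda>v. (c *\<^sub>R f' (a + c *\<^sub>R x)) \<bullet> v)) (at x)" for x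
    by simp
  show "continuous_on UNIV (\<lambda>x. c *\<^sub>R f' (a + c *\<^sub>R x))"
    by (intro continuous_on_scaleR continuous_on_compose2[OF cgrad_cont_grad[OF assms, of UNIV]]
        continuous_intros) auto
qed

lemma cgrad_reflect:
  assumes "cgrad f f'" shows "cgrad (\<lambda>y. f (x - y)) (\<lambda>y. - f' (x - y))"
  using cgrad_affine[OF assms, of x "-1"] by simp

lemma cgrad_unique:
  assumes "cgrad f g" "cgrad f h" shows "g = h"
proof
  fix x
  have "(\<lambda>v. g x \<bullet> v) = (\<lambda>v. h x \<bullet> v)"
    using has_derivative_unique[OF cgradD[OF assms(1)] cgradD[OF assms(2)]] .
  then show "g x = h x"
    by (metis vector_eq_rdot inner_commute)
qed

lemma cgrad_cong_open:
  assumes "cgrad f g" "cgrad h k" "open S" "x \<in> S" "\<And>y. y \<in> S \<Longrightarrow> f y = h y"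
  shows "g x = k x"
proof -
  have "(f has_derivative (\<lambda>v. k x \<bullet> v)) (at x)"
    using has_derivative_transform_within_open[OF cgradD[OF assms(2)] assms(3,4)] assms(5) by metis
  then have "(\<lambda>v. g x \<bullet> v) = (\<lambda>v. k x \<bullet> v)"
    using has_derivative_unique[OF cgradD[OF assms(1)]] by blast
  then show ?thesis
    by (metis vector_eq_rdot inner_commute)
qed

lemma cgrad_zero_open:
  assumes "cgrad f g" "open S" "x \<in> S" "\<And>y. y \<in> S \<Longrightarrow> f y = 0"
  shows "g x = 0"
  using cgrad_cong_open[OF assms(1) cgrad_const[of 0] assms(2,3)] assms(4) by simp

lemma Cc_cgrad:
  assumes "Cc f" "cgrad f g" shows "Cc g"
proof -
  obtain r where r: "\<And>x. r < norm x \<Longrightarrow> f x = 0" using Cc_radius[OF assms(1)] by metis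
  show ?thesis
  proof (rule CcI_radius)
    show "continuous_on UNIV g" using assms(2) by (rule cgrad_cont_grad)
    fix x :: 'a assume "r < norm x"
    show "g x = 0"
    proof (rule cgrad_zero_open[OF assms(2)])
      show "open {x::'a. r < norm x}" by (intro open_Collect_less continuous_intros)
    qed (use r \<open>r < norm x\<close> in auto)
  qed
qed

lemma cgrad_lipschitz:
  fixes f :: "'a::euclidean_space \<Rightarrow> real"
  assumes "cgrad f g" "\<And>x. norm (g x) \<le> B"
  shows "\<bar>f (x + v) - f x\<bar> \<le> B * norm v"
proof -
  have "norm (f (x + v) - f x) \<le> B * norm (x + v - x)"
  proof (rule differentiable_bound[OF convex_UNIV])
    show "(f has_derivative (\<lambda>v. g y \<bullet> v)) (at y within UNIV)" for y by (rule cgradD[OF assms(1)])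
    show "onorm (\<lambda>v. g y \<bullet> v) \<le> B" for y
    proof (rule onorm_le)
      show "norm (g y \<bullet> v) \<le> B * norm v" for v
        using Cauchy_Schwarz_ineq2[of "g y" v] mult_right_mono[OF assms(2)[of y], of "norm v"] by simp
    qed
  qed auto
  then show ?thesis by simp
qed

text \<open>Step length \<open>1 / (n + 1)\<close>, so that limits are along a sequence and
  dominated convergence applies.\<close>

definition diff_quotient :: "('a::euclidean_space \<Rightarrow> real) \<Rightarrow> 'a \<Rightarrow> nat \<Rightarrow> 'a \<Rightarrow> real" where
  "diff_quotient f v n x = real (Suc n) * (f (x + inverse (real (Suc n)) *\<^sub>R v) - f x)"

lemma diff_quotient_tendsto:
  assumes "cgrad f g"
  shows "(\<lambda>n. diff_quotient f v n x) \<longlonglongrightarrow> g x \<bullet> v"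
proof -
  have "((\<lambda>t. f (x + t *\<^sub>R v)) has_derivative (\<lambda>t. g (x + 0 *\<^sub>R v) \<bullet> (t *\<^sub>R v))) (at 0)"
    by (rule has_derivative_compose[OF _ cgradD[OF assms]]) (auto intro!: derivative_eq_intros)
  then have "((\<lambda>t. f (x + t *\<^sub>R v)) has_real_derivative g x \<bullet> v) (at 0)"
    by (simp add: has_field_derivative_def mult_commute_abs)
  then have "((\<lambda>h. (f (x + h *\<^sub>R v) - f x) / h) \<longlongrightarrow> g x \<bullet> v) (at 0)"
    by (simp add: DERIV_def)
  moreover have "filterlim (\<lambda>n. inverse (real (Suc n))) (at 0) sequentially"
    unfolding filterlim_at using LIMSEQ_inverse_real_of_nat by auto
  ultimately have "(\<lambda>n. (f (x + inverse (real (Suc n)) *\<^sub>R v) - f x) / inverse (real (Suc n))) \<longlonglongrightarrow> g x \<bullet> v"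
    by (rule filterlim_compose)
  then show ?thesis by (simp add: diff_quotient_def divide_inverse mult.commute)
qed

lemma diff_quotient_bound:
  assumes "cgrad f g" "\<And>x. norm (g x) \<le> B"
  shows "\<bar>diff_quotient f v n x\<bar> \<le> B * norm v"
proof -
  have "\<bar>diff_quotient f v n x\<bar> = real (Suc n) * \<bar>f (x + inverse (real (Suc n)) *\<^sub>R v) - f x\<bar>"
    by (simp add: diff_quotient_def abs_mult)
  also have "\<dots> \<le> real (Suc n) * (B * norm (inverse (real (Suc n)) *\<^sub>R v))"
    by (intro mult_left_mono cgrad_lipschitz[OF assms]) auto
  also have "\<dots> = B * norm v" by (simp add: field_simps del: of_nat_Suc)
  finally show ?thesis .
qed

lemma diff_quotient_zero:
  assumes "\<And>x. r < norm x \<Longrightarrow> f x = 0" "r + norm v < norm x"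
  shows "diff_quotient f v n x = 0"
proof -
  have "norm (inverse (real (Suc n)) *\<^sub>R v) \<le> norm v"
    by (simp add: field_simps mult_left_le)
  then have "r < norm (x + inverse (real (Suc n)) *\<^sub>R v)"
    using norm_diff_ineq[of x "inverse (real (Suc n)) *\<^sub>R v"] assms(2) by linarith
  moreover have "r < norm x" using assms(2) norm_ge_zero[of v] by linarith
  ultimately show ?thesis using assms(1) by (simp add: diff_quotient_def)
qed

lemma Cc_diff_quotient: "Cc f \<Longrightarrow> Cc (diff_quotient f v n)"
  unfolding diff_quotient_def
  by (intro Cc_mult_right Cc_diff Cc_shift) auto

text \<open>Every difference quotient has integral zero by translation invariance. All of them share
  a bounded support and a Lipschitz bound, so dominated convergence passes this on to the
  derivative.\<close>

lemma integral_cgrad_eq_0: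
  fixes f :: "'a::euclidean_space \<Rightarrow> real"
  assumes f: "Cc f" and g: "cgrad f g"
  shows "(\<integral>x. g x \<bullet> v \<partial>lborel) = 0"
proof -
  obtain r where r: "\<And>x. r < norm x \<Longrightarrow> f x = 0" using Cc_radius[OF f] by metis
  obtain B where B: "B > 0" "\<And>x. norm (g x) \<le> B" using Cc_bound[OF Cc_cgrad[OF f g]] by metis
  let ?w = "\<lambda>x::'a. indicator (cball 0 (r + norm v)) x *\<^sub>R (B * norm v)"
  have "(\<lambda>n. integral\<^sup>L lborel (diff_quotient f v n)) \<longlonglongrightarrow> (\<integral>x. g x \<bullet> v \<partial>lborel)"
  proof (rule integral_dominated_convergence[where w = ?w])
    show "(\<lambda>x. g x \<bullet> v) \<in> borel_measurable lborel"
      using Cc_borel[OF Cc_cgrad[OF f g]] by simp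
    show "diff_quotient f v n \<in> borel_measurable lborel" for n
      using Cc_borel[OF Cc_diff_quotient[OF f]] by simp
    show "integrable lborel ?w"
      by (rule borel_integrable_compact) auto
    show "AE x in lborel. (\<lambda>n. diff_quotient f v n x) \<longlonglongrightarrow> g x \<bullet> v"
      using diff_quotient_tendsto[OF g] by simp
    show "AE x in lborel. norm (diff_quotient f v n x) \<le> ?w x" for n
      using diff_quotient_bound[OF g B(2)] diff_quotient_zero[of r f, OF r]
      by (auto simp: indicator_def not_le)
  qed
  moreover have "integral\<^sup>L lborel (diff_quotient f v n) = 0" for n
  proof -
    have "integral\<^sup>L lborel (diff_quotient f v n)
      = real (Suc n) * (integral\<^sup>L lborel (\<lambda>x. f (x + inverse (real (Suc n)) *\<^sub>R v)) - integral\<^sup>L lborel f)"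
      unfolding diff_quotient_def
      by (simp add: Bochner_Integration.integral_diff Cc_integrable Cc_shift f del: of_nat_Suc)
    then show ?thesis
      by (simp add: lborel_integral_shift Cc_borel[OF f])
  qed
  ultimately show ?thesis by (simp add: LIMSEQ_const_iff)
qed

lemma integral_by_parts:
  assumes f: "Cc f" "cgrad f f'" and h: "cgrad h h'"
  shows "(\<integral>x. f x * (h' x \<bullet> v) \<partial>lborel) = - (\<integral>x. h x * (f' x \<bullet> v) \<partial>lborel)"
proof -
  have 1: "integrable lborel (\<lambda>x. f x * (h' x \<bullet> v))"
    by (intro Cc_integrable Cc_mult_left f continuous_intros cgrad_cont_grad[OF h])
  have 2: "integrable lborel (\<lambda>x. h x * (f' x \<bullet> v))"
    by (intro Cc_integrable Cc_mult_right Cc_inner_left Cc_cgrad[OF f] continuous_intros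
        cgrad_continuous[OF h])
  have "0 = (\<integral>x. (f x *\<^sub>R h' x + h x *\<^sub>R f' x) \<bullet> v \<partial>lborel)"
    by (intro integral_cgrad_eq_0[OF _ cgrad_mult[OF f(2) h], symmetric] Cc_mult_left f
        cgrad_continuous[OF h])
  also have "\<dots> = (\<integral>x. f x * (h' x \<bullet> v) \<partial>lborel) + (\<integral>x. h x * (f' x \<bullet> v) \<partial>lborel)"
    using 1 2 by (simp add: inner_add_left)
  finally show ?thesis by simp
qed

text \<open>A discrete symmetry of second derivatives: after expansion each term is an integral of
  \<open>f (x + a) * g (x + b)\<close>, which by translation depends only on
  \<open>a - b\<close>.\<close>

lemma integral_increments_swap:
  fixes f g :: "'a::euclidean_space \<Rightarrow> real"
  assumes "Cc f" "Cc g"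
  shows "(\<integral>x. (f (x + p) - f x) * (g (x + q) - g x) \<partial>lborel)
       = (\<integral>x. (f (x + - q) - f x) * (g (x + - p) - g x) \<partial>lborel)"
proof -
  have i: "integrable lborel (\<lambda>x. f (x + a) * g (x + b))" for a b
    by (intro Cc_integrable Cc_mult_left Cc_shift assms Cc_continuous)
  note i0 = i[of 0 0, simplified] i[of _ 0, simplified] i[of 0 _, simplified]
  have e: "(\<integral>x. (f (x + a) - f x) * (g (x + b) - g x) \<partial>lborel)
    = (\<integral>x. f (x + a) * g (x + b) \<partial>lborel) - (\<integral>x. f (x + a) * g x \<partial>lborel)
      - ((\<integral>x. f x * g (x + b) \<partial>lborel) - (\<integral>x. f x * g x \<partial>lborel))" for a b
    using i i0 by (simp add: left_diff_distrib right_diff_distrib)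
  have s: "(\<integral>x. f (x + a) * g (x + b) \<partial>lborel) = (\<integral>x. f (x - b) * g (x - a) \<partial>lborel)" for a b
  proof -
    have "(\<lambda>x. f (x - b) * g (x - a)) \<in> borel_measurable borel"
      using Cc_borel[OF Cc_mult_left[OF Cc_shift[OF assms(1), of "-b"] Cc_continuous[OF Cc_shift[OF assms(2), of "-a"]]]]
      by simp
    from lborel_integral_shift[OF this, of "a + b"] show ?thesis
      by (simp add: algebra_simps)
  qed
  show ?thesis
    unfolding e using s[of p q] s[of p 0] s[of 0 q] by simp
qed

text \<open>For C2 functions these are two integrations by parts and the symmetry of second
  derivatives; for C1 functions it is the limit of \<open>integral_increments_swap\<close>, where
  the signs of \<open>- b\<close> and \<open>- a\<close> cancel. It is the source of rot grad = 0,
  of div rot = 0 and of the vanishing null Lagrangian in \<open>weighted_Gaffney\<close>.\<close>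

lemma integral_grad_swap:
  fixes f g :: "'a::euclidean_space \<Rightarrow> real"
  assumes f: "Cc f" "cgrad f f'" and g: "Cc g" "cgrad g g'"
  shows "(\<integral>x. (f' x \<bullet> a) * (g' x \<bullet> b) \<partial>lborel) = (\<integral>x. (f' x \<bullet> b) * (g' x \<bullet> a) \<partial>lborel)"
proof -
  have lim: "(\<lambda>n. \<integral>x. diff_quotient f a n x * diff_quotient g b n x \<partial>lborel)
    \<longlonglongrightarrow> (\<integral>x. (f' x \<bullet> a) * (g' x \<bullet> b) \<partial>lborel)" for a b
  proof -
    obtain r where r: "\<And>x. r < norm x \<Longrightarrow> f x = 0" using Cc_radius[OF f(1)] by metis
    obtain B where B: "B > 0" "\<And>x. norm (f' x) \<le> B" using Cc_bound[OF Cc_cgrad[OF f]] by metis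
    obtain C where C: "C > 0" "\<And>x. norm (g' x) \<le> C" using Cc_bound[OF Cc_cgrad[OF g]] by metis
    let ?w = "\<lambda>x::'a. indicator (cball 0 (r + norm a)) x *\<^sub>R ((B * norm a) * (C * norm b))"
    show ?thesis
    proof (rule integral_dominated_convergence[where w = ?w])
      show "(\<lambda>x. (f' x \<bullet> a) * (g' x \<bullet> b)) \<in> borel_measurable lborel"
        using Cc_borel[OF Cc_cgrad[OF f]] Cc_borel[OF Cc_cgrad[OF g]] by simp
      show "(\<lambda>x. diff_quotient f a n x * diff_quotient g b n x) \<in> borel_measurable lborel" for n
        using Cc_borel[OF Cc_diff_quotient[OF f(1)]] Cc_borel[OF Cc_diff_quotient[OF g(1)]] by simp
      show "integrable lborel ?w"
        by (rule borel_integrable_compact) auto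
      show "AE x in lborel. (\<lambda>n. diff_quotient f a n x * diff_quotient g b n x) \<longlonglongrightarrow> (f' x \<bullet> a) * (g' x \<bullet> b)"
        by (intro AE_I2 tendsto_mult diff_quotient_tendsto f g)
      have "\<bar>diff_quotient f a n x * diff_quotient g b n x\<bar> \<le> (B * norm a) * (C * norm b)" for n x
        unfolding abs_mult
        by (intro mult_mono diff_quotient_bound[OF f(2) B(2)] diff_quotient_bound[OF g(2) C(2)])
          (use B(1) in auto)
      then show "AE x in lborel. norm (diff_quotient f a n x * diff_quotient g b n x) \<le> ?w x" for n
        using diff_quotient_zero[of r f, OF r] by (auto simp: indicator_def not_le)
    qed
  qed
  have "(\<integral>x. diff_quotient f a n x * diff_quotient g b n x \<partial>lborel)
    = (\<integral>x. diff_quotient f (- b) n x * diff_quotient g (- a) n x \<partial>lborel)" for n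
  proof -
    have *: "(\<integral>x. diff_quotient f a n x * diff_quotient g b n x \<partial>lborel) = (real (Suc n))\<^sup>2 *
      (\<integral>x. (f (x + inverse (real (Suc n)) *\<^sub>R a) - f x) * (g (x + inverse (real (Suc n)) *\<^sub>R b) - g x) \<partial>lborel)" for a b
      by (subst Bochner_Integration.integral_mult_right_zero[symmetric])
        (simp add: diff_quotient_def power2_eq_square algebra_simps del: of_nat_Suc)
    show ?thesis
      unfolding * using integral_increments_swap[OF f(1) g(1), of "inverse (real (Suc n)) *\<^sub>R a" "inverse (real (Suc n)) *\<^sub>R b"]
      by simp
  qed
  then have "(\<lambda>n. \<integral>x. diff_quotient f a n x * diff_quotient g b n x \<partial>lborel)
    \<longlonglongrightarrow> (\<integral>x. (f' x \<bullet> (-b)) * (g' x \<bullet> (-a)) \<partial>lborel)"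
    using lim[of "-b" "-a"] by simp
  with lim[of a b] show ?thesis
    using LIMSEQ_unique by fastforce
qed

section \<open>Mollification\<close>

text \<open>The kernel may be vector valued, so that the gradient of a convolution is again a
  convolution, with the gradient of the kernel.\<close>

definition conv :: "('a::euclidean_space \<Rightarrow> real) \<Rightarrow> ('a \<Rightarrow> 'b::euclidean_space) \<Rightarrow> 'a \<Rightarrow> 'b" where
  "conv f k x = (\<integral>y. f y *\<^sub>R k (x - y) \<partial>lborel)"

lemma Cc_conv_integrand:
  "Cc f \<Longrightarrow> Cc k \<Longrightarrow> Cc (\<lambda>y. f y *\<^sub>R k (x - y))"
  by (intro Cc_scaleR_left Cc_continuous[OF Cc_reflect])

lemma conv_integrable: "Cc f \<Longrightarrow> Cc k \<Longrightarrow> integrable lborel (\<lambda>y. f y *\<^sub>R k (x - y))"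
  by (intro Cc_integrable Cc_conv_integrand)

text \<open>One estimate for two purposes: \<open>g = 0\<close> gives continuity of the convolution,
  and the linear part of the increment of \<open>k\<close> in place of \<open>g\<close> gives its
  differentiability.\<close>

lemma conv_increment_bound:
  assumes f: "Cc f" and k: "Cc k" "Cc l" and le: "\<And>y. norm (k (x' - y) - k (x - y) - g (x - y)) \<le> e"
    and g: "Cc g"
  shows "norm (conv f k x' - conv f k x - conv f g x) \<le> e * (\<integral>y. \<bar>f y\<bar> \<partial>lborel)"
proof -
  have "conv f k x' - conv f k x - conv f g x
      = (\<integral>y. f y *\<^sub>R (k (x' - y) - k (x - y) - g (x - y)) \<partial>lborel)"
    using conv_integrable[OF f k(1)] conv_integrable[OF f g]
    by (simp add: conv_def scaleR_diff_right)
  also have "norm \<dots> \<le> (\<integral>y. e * \<bar>f y\<bar> \<partial>lborel)"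
  proof (rule Bochner_Integration.integral_norm_bound_integral)
    show "integrable lborel (\<lambda>y. f y *\<^sub>R (k (x' - y) - k (x - y) - g (x - y)))"
      using conv_integrable[OF f k(1)] conv_integrable[OF f g] by (simp add: scaleR_diff_right)
    show "integrable lborel (\<lambda>y. e * \<bar>f y\<bar>)"
      using Cc_integrable[OF Cc_norm[OF f]] by simp
    show "norm (f y *\<^sub>R (k (x' - y) - k (x - y) - g (x - y))) \<le> e * \<bar>f y\<bar>" for y
      using mult_left_mono[OF le[of y], of "\<bar>f y\<bar>"] by (simp add: mult.commute)
  qed
  finally show ?thesis by simp
qed

lemma continuous_conv:
  assumes f: "Cc f" and k: "Cc k"
  shows "continuous_on A (conv f k)"
proof -
  have "continuous_on UNIV (conv f k)"
    unfolding continuous_on_iff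
  proof (intro ballI allI impI)
    fix x :: 'a and e :: real assume "0 < e"
    define K where "K = (\<integral>y. \<bar>f y\<bar> \<partial>lborel) + 1"
    have K: "0 < K" unfolding K_def by (intro add_nonneg_pos Bochner_Integration.integral_nonneg) auto
    obtain d where d: "d > 0" "\<And>z z'. dist z' z < d \<Longrightarrow> dist (k z') (k z) < e / K"
      using Cc_uniformly_continuous[OF k] \<open>0 < e\<close> K unfolding uniformly_continuous_on_def
      by (metis UNIV_I divide_pos_pos)
    show "\<exists>d>0. \<forall>x'\<in>UNIV. dist x' x < d \<longrightarrow> dist (conv f k x') (conv f k x) < e"
    proof (intro exI conjI ballI impI)
      show "d > 0" by fact
      fix x' assume "dist x' x < d"
      then have "norm (k (x' - y) - k (x - y) - 0) \<le> e / K" for y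
        using d(2)[of "x' - y" "x - y"] by (simp add: dist_norm)
      from conv_increment_bound[OF f k k this Cc_0]
      have "norm (conv f k x' - conv f k x) \<le> e / K * (\<integral>y. \<bar>f y\<bar> \<partial>lborel)"
        by (simp add: conv_def)
      also have "\<dots> < e / K * K"
        using \<open>0 < e\<close> K by (intro mult_strict_left_mono) (auto simp: K_def)
      finally show "dist (conv f k x') (conv f k x) < e" using K by (simp add: dist_norm)
    qed
  qed
  then show ?thesis using continuous_on_subset by blast
qed

lemma Cc_conv:
  assumes f: "Cc f" and k: "Cc k"
  shows "Cc (conv f k)"
proof -
  obtain r where r: "\<And>x. r < norm x \<Longrightarrow> f x = 0" using Cc_radius[OF f] by metis
  obtain s where s: "\<And>x. s < norm x \<Longrightarrow> k x = 0" using Cc_radius[OF k] by metis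
  show ?thesis
  proof (rule CcI_radius[OF continuous_conv[OF f k]])
    fix x :: 'a assume x: "r + s < norm x"
    have z: "f y *\<^sub>R k (x - y) = 0" for y
    proof (cases "r < norm y")
      case False
      then have "s < norm (x - y)" using x norm_triangle_ineq2[of x y] by linarith
      then show ?thesis by (simp add: s)
    qed (simp add: r)
    show "conv f k x = 0" unfolding conv_def z by simp
  qed
qed

lemma conv_inner: "Cc f \<Longrightarrow> Cc k \<Longrightarrow> conv f k x \<bullet> v = conv f (\<lambda>z. k z \<bullet> v) x"
  using conv_integrable[of f k x] by (simp add: conv_def integral_inner_left[symmetric] del: integral_inner_left)

lemma cgrad_conv:
  fixes f k :: "'a::euclidean_space \<Rightarrow> real"
  assumes f: "Cc f" and k: "Cc k" "cgrad k k'"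
  shows "cgrad (conv f k) (conv f k')"
proof (rule cgradI)
  have k': "Cc k'" using Cc_cgrad[OF k] .
  show "continuous_on UNIV (conv f k')" by (rule continuous_conv[OF f k'])
  fix x
  show "(conv f k has_derivative (\<lambda>v. conv f k' x \<bullet> v)) (at x)"
    unfolding has_derivative_at_alt
  proof (intro conjI allI impI)
    show "bounded_linear (\<lambda>v. conv f k' x \<bullet> v)" by (rule bounded_linear_inner_right)
    fix e :: real assume "0 < e"
    define K where "K = (\<integral>y. \<bar>f y\<bar> \<partial>lborel) + 1"
    have K: "0 < K" unfolding K_def by (intro add_nonneg_pos Bochner_Integration.integral_nonneg) auto
    obtain d where d: "d > 0" "\<And>z z'. dist z' z < d \<Longrightarrow> dist (k' z') (k' z) < e / K"
      using Cc_uniformly_continuous[OF k'] \<open>0 < e\<close> K unfolding uniformly_continuous_on_def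
      by (metis UNIV_I divide_pos_pos)
    show "\<exists>d>0. \<forall>y. norm (y - x) < d \<longrightarrow>
        norm (conv f k y - conv f k x - conv f k' x \<bullet> (y - x)) \<le> e * norm (y - x)"
    proof (intro exI conjI allI impI)
      show "d > 0" by fact
      fix y assume y: "norm (y - x) < d"
      have lin: "norm (k (y - t) - k (x - t) - k' (x - t) \<bullet> (y - x)) \<le> norm (y - x) * (e / K)" for t
      proof -
        have "norm (k (y - t) - k (x - t) - k' (x - t) \<bullet> ((y - t) - (x - t)))
            \<le> norm ((y - t) - (x - t)) * (e / K)"
        proof (rule differentiable_bound_linearization[where S = "ball (x - t) d" and f' = "\<lambda>z v. k' z \<bullet> v"])
          show "(x - t) + s *\<^sub>R ((y - t) - (x - t)) \<in> ball (x - t) d" if "s \<in> {0..1}" for s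
          proof -
            have "\<bar>s\<bar> * norm (y - x) \<le> 1 * norm (y - x)" using that by (intro mult_right_mono) auto
            then show ?thesis using y by (simp add: dist_norm)
          qed
          show "(k has_derivative (\<lambda>v. k' z \<bullet> v)) (at z within ball (x - t) d)" for z
            by (rule cgradD[OF k(2)])
          show "onorm ((\<lambda>v. k' z \<bullet> v) - (\<lambda>v. k' (x - t) \<bullet> v)) \<le> e / K" if "z \<in> ball (x - t) d" for z
            unfolding fun_diff_def
          proof (rule onorm_le)
            fix v :: 'a
            have "norm (k' z - k' (x - t)) \<le> e / K"
              using d(2)[of z "x - t"] that by (simp add: dist_norm norm_minus_commute)
            then have "norm (k' z - k' (x - t)) * norm v \<le> e / K * norm v"
              by (rule mult_right_mono) simp
            then show "norm (k' z \<bullet> v - k' (x - t) \<bullet> v) \<le> e / K * norm v"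
              using Cauchy_Schwarz_ineq2[of "k' z - k' (x - t)" v] by (simp add: inner_diff_left)
          qed
        qed (use d in auto)
        then show ?thesis by simp
      qed
      have "norm (conv f k y - conv f k x - conv f (\<lambda>z. k' z \<bullet> (y - x)) x)
          \<le> norm (y - x) * (e / K) * (\<integral>y. \<bar>f y\<bar> \<partial>lborel)"
        by (rule conv_increment_bound[OF f k(1) k(1) lin Cc_inner_left[OF k' continuous_on_const]])
      also have "\<dots> \<le> norm (y - x) * (e / K) * K"
        using \<open>0 < e\<close> K by (intro mult_left_mono) (auto simp: K_def)
      finally show "norm (conv f k y - conv f k x - conv f k' x \<bullet> (y - x)) \<le> e * norm (y - x)"
        using K by (simp add: conv_inner[OF f k'] mult.commute)
    qed
  qed
qed

lemma conv_grad_swap: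
  fixes f k :: "'a::euclidean_space \<Rightarrow> real"
  assumes f: "Cc f" "cgrad f f'" and k: "Cc k" "cgrad k k'"
  shows "conv f k' x \<bullet> v = conv (\<lambda>y. f' y \<bullet> v) k x"
proof -
  have "conv f k' x \<bullet> v = - (\<integral>y. f y * (- k' (x - y) \<bullet> v) \<partial>lborel)"
    by (simp add: conv_inner[OF f(1) Cc_cgrad[OF k]]) (simp add: conv_def)
  also have "\<dots> = (\<integral>y. k (x - y) * (f' y \<bullet> v) \<partial>lborel)"
    using integral_by_parts[OF f cgrad_reflect[OF k(2), of x], of v] by simp
  finally show ?thesis by (simp add: conv_def mult.commute)
qed

text \<open>\<open>h\<close> bounds the radius of the support. Evenness makes convolution with
  \<open>\<rho>\<close> self-adjoint, see \<open>conv_swap\<close>. Differentiability is supplied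
  separately by \<open>mollifier_exists\<close>, since many estimates below need only the averaging
  property.\<close>

definition mollifier :: "real \<Rightarrow> ('a::euclidean_space \<Rightarrow> real) \<Rightarrow> bool" where
  "mollifier h \<rho> \<longleftrightarrow> Cc \<rho> \<and> (\<forall>z. 0 \<le> \<rho> z) \<and> integral\<^sup>L lborel \<rho> = 1 \<and> (\<forall>z. \<rho> (- z) = \<rho> z) \<and>
     (\<forall>z. h \<le> norm z \<longrightarrow> \<rho> z = 0)"

lemma mollifier_commute: "mollifier h \<rho> \<Longrightarrow> \<rho> (x - y) = \<rho> (y - x)"
  unfolding mollifier_def by (metis minus_diff_eq)

lemma mollifier_integral_reflect:
  assumes "mollifier h \<rho>" shows "(\<integral>y. \<rho> (x - y) \<partial>lborel) = 1"
proof -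
  have "\<rho> \<in> borel_measurable borel" using assms Cc_borel unfolding mollifier_def by blast
  from lborel_integral_shift[OF this, of "-x"] show ?thesis
    using assms mollifier_commute[OF assms, of x] by (simp add: mollifier_def)
qed

lemma conv_local_mono:
  assumes f: "Cc f" and g: "Cc g" and m: "mollifier h \<rho>"
    and le: "\<And>y. norm (x - y) < h \<Longrightarrow> f y \<le> g y"
  shows "conv f \<rho> x \<le> conv g \<rho> x"
  unfolding conv_def
proof (rule integral_mono)
  have k: "Cc \<rho>" using m by (simp add: mollifier_def)
  show "integrable lborel (\<lambda>y. f y *\<^sub>R \<rho> (x - y))" "integrable lborel (\<lambda>y. g y *\<^sub>R \<rho> (x - y))"
    by (rule conv_integrable[OF f k] conv_integrable[OF g k])+
  show "f y *\<^sub>R \<rho> (x - y) \<le> g y *\<^sub>R \<rho> (x - y)" for y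
  proof (cases "norm (x - y) < h")
    case True then show ?thesis
      using le m by (simp add: mollifier_def mult_right_mono)
  next
    case False then have "\<rho> (x - y) = 0" using m by (simp add: mollifier_def)
    then show ?thesis by simp
  qed
qed

text \<open>Besides the usual approximation, the case \<open>c = 0\<close>, \<open>e = 0\<close>
  shows that a convolution vanishes at points whose \<open>h\<close>-neighbourhood misses the
  support of \<open>f\<close>.\<close>

lemma conv_close:
  assumes f: "Cc f" and m: "mollifier h \<rho>"
    and le: "\<And>y. norm (x - y) < h \<Longrightarrow> \<bar>f y - c\<bar> \<le> e"
  shows "\<bar>conv f \<rho> x - c\<bar> \<le> e"
proof -
  have k: "Cc \<rho>" using m by (simp add: mollifier_def)
  have i: "integrable lborel (\<lambda>y. \<rho> (x - y))" using Cc_integrable[OF Cc_reflect[OF k]] .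
  note fi = conv_integrable[OF f k, of x]
  have "conv f \<rho> x - c = (\<integral>y. (f y - c) * \<rho> (x - y) \<partial>lborel)"
    using i fi mollifier_integral_reflect[OF m, of x] by (simp add: conv_def left_diff_distrib)
  also have "\<bar>\<dots>\<bar> \<le> (\<integral>y. e * \<rho> (x - y) \<partial>lborel)"
    unfolding real_norm_def[symmetric]
  proof (rule Bochner_Integration.integral_norm_bound_integral)
    show "integrable lborel (\<lambda>y. (f y - c) * \<rho> (x - y))" using i fi by (simp add: left_diff_distrib)
    show "integrable lborel (\<lambda>y. e * \<rho> (x - y))" using i by simp
    show "norm ((f y - c) * \<rho> (x - y)) \<le> e * \<rho> (x - y)" for y
    proof (cases "norm (x - y) < h")
      case True then show ?thesis
        using le[OF True] m by (simp add: mollifier_def abs_mult mult_right_mono)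
    next
      case False then have "\<rho> (x - y) = 0" using m by (simp add: mollifier_def)
      then show ?thesis by simp
    qed
  qed
  also have "\<dots> = e" using mollifier_integral_reflect[OF m, of x] by simp
  finally show ?thesis .
qed

text \<open>Jensen's inequality, read off from the nonnegative variance of \<open>f\<close> under
  the probability density \<open>\<rho> (x - y)\<close>.\<close>

lemma conv_power2_le:
  assumes f: "Cc f" and m: "mollifier h \<rho>"
  shows "(conv f \<rho> x)\<^sup>2 \<le> conv (\<lambda>y. (f y)\<^sup>2) \<rho> x"
proof -
  have k: "Cc \<rho>" using m by (simp add: mollifier_def)
  have i: "integrable lborel (\<lambda>y. \<rho> (x - y))" using Cc_integrable[OF Cc_reflect[OF k]] .
  note fi = conv_integrable[OF f k, of x] and gi = conv_integrable[OF Cc_power2[OF f] k, of x]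
  define c where "c = conv f \<rho> x"
  have "0 \<le> (\<integral>y. (f y - c)\<^sup>2 * \<rho> (x - y) \<partial>lborel)"
    using m by (intro Bochner_Integration.integral_nonneg) (simp add: mollifier_def)
  also have "\<dots> = (\<integral>y. (f y)\<^sup>2 * \<rho> (x - y) - 2 * c * (f y * \<rho> (x - y)) + c\<^sup>2 * \<rho> (x - y) \<partial>lborel)"
    by (simp add: power2_diff algebra_simps)
  also have "\<dots> = conv (\<lambda>y. (f y)\<^sup>2) \<rho> x - 2 * c * conv f \<rho> x + c\<^sup>2"
    using i fi gi mollifier_integral_reflect[OF m, of x] by (simp add: conv_def)
  finally show ?thesis by (simp add: c_def power2_eq_square)
qed

lemma conv_transfer:
  fixes f J \<rho> :: "'a::euclidean_space \<Rightarrow> real"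
  assumes f: "Cc f" and J: "continuous_on UNIV J" and \<rho>: "Cc \<rho>"
  shows "(\<integral>x. J x * conv f \<rho> x \<partial>lborel) = (\<integral>y. (\<integral>x. J x * \<rho> (x - y) \<partial>lborel) * f y \<partial>lborel)"
proof -
  have "Cc (\<lambda>(x, y). J x * (f y * \<rho> (x - y)))"
  proof -
    obtain r where r: "\<And>x. r < norm x \<Longrightarrow> f x = 0" using Cc_radius[OF f] by metis
    obtain s where s: "\<And>x. s < norm x \<Longrightarrow> \<rho> x = 0" using Cc_radius[OF \<rho>] by metis
    show ?thesis
    proof (rule CcI_radius)
      show "continuous_on UNIV (\<lambda>(x, y). J x * (f y * \<rho> (x - y)))"
        unfolding case_prod_beta
        by (intro continuous_on_mult continuous_on_compose2[OF Cc_continuous[OF f, of UNIV]]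
            continuous_on_compose2[OF J]
            continuous_on_compose2[OF Cc_continuous[OF \<rho>, of UNIV]] continuous_intros) auto
      fix p :: "'a \<times> 'a" assume p: "(r + s) + r < norm p"
      have "J x * (f y * \<rho> (x - y)) = 0" if "p = (x, y)" for x y
      proof (cases "r < norm y")
        case False
        then have "r + s < norm x" using p that norm_Pair_le[of x y] by simp
        then have "s < norm (x - y)" using False norm_triangle_ineq2[of x y] by linarith
        then show ?thesis by (simp add: s)
      qed (simp add: r)
      then show "(case p of (x, y) \<Rightarrow> J x * (f y * \<rho> (x - y))) = 0" by (cases p) auto
    qed
  qed
  from Cc_Fubini[OF this]
  have "(\<integral>x. (\<integral>y. J x * (f y * \<rho> (x - y)) \<partial>lborel) \<partial>lborel) = (\<integral>y. (\<integral>x. J x * (f y * \<rho> (x - y)) \<partial>lborel) \<partial>lborel)"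
    by simp
  moreover have "(\<integral>x. J x * (f y * \<rho> (x - y)) \<partial>lborel) = (\<integral>x. J x * \<rho> (x - y) \<partial>lborel) * f y" for y
    by (subst integral_mult_left_zero[symmetric]) (simp add: mult_ac)
  ultimately show ?thesis by (simp add: conv_def)
qed

lemma conv_swap:
  assumes f: "Cc f" and J: "Cc J" and m: "mollifier h \<rho>"
  shows "(\<integral>x. J x * conv f \<rho> x \<partial>lborel) = (\<integral>y. conv J \<rho> y * f y \<partial>lborel)"
proof -
  have "Cc \<rho>" using m by (simp add: mollifier_def)
  then show ?thesis
    using conv_transfer[OF f Cc_continuous[OF J]] mollifier_commute[OF m] by (simp add: conv_def)
qed

lemma integral_conv:
  assumes f: "Cc f" and m: "mollifier h \<rho>"
  shows "integral\<^sup>L lborel (conv f \<rho>) = integral\<^sup>L lborel f"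
proof -
  have "Cc \<rho>" using m by (simp add: mollifier_def)
  from conv_transfer[OF f _ this, of "\<lambda>x. 1"]
  have "integral\<^sup>L lborel (conv f \<rho>) = (\<integral>y. (\<integral>x. \<rho> (x - y) \<partial>lborel) * f y \<partial>lborel)"
    by simp
  also have "\<dots> = integral\<^sup>L lborel f"
    using mollifier_integral_reflect[OF m] mollifier_commute[OF m] by simp
  finally show ?thesis .
qed

subsection \<open>A smooth bump function\<close>

text \<open>For \<open>m = 0\<close> this is the classical smooth function that vanishes to infinite
  order at 0. The powers of \<open>inverse t\<close> make the linear span of the family closed under
  differentiation.\<close>

definition flat :: "nat \<Rightarrow> real \<Rightarrow> real" where
  "flat m t = (if t \<le> 0 then 0 else exp (- inverse t) * inverse t ^ m)"

lemma power_le_fact_exp: "0 \<le> s \<Longrightarrow> s ^ n \<le> fact n * exp s" for s :: real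
proof -
  assume s: "0 \<le> s"
  have "s ^ n / fact n \<le> exp s"
    using sum_le_suminf[OF summable_exp_generic[of s], of "{n}"] s
    by (simp add: exp_def divide_inverse mult.commute)
  then show ?thesis by (simp add: field_simps)
qed

text \<open>The exponential absorbs two more powers of \<open>inverse t\<close> than
  \<open>flat m\<close> carries. The resulting quadratic smallness sends the difference quotient at
  0 to zero, the one delicate point of \<open>flat_has_derivative\<close>.\<close>

lemma flat_le: "\<bar>flat m t\<bar> \<le> fact (m + 2) * t\<^sup>2"
proof (cases "t \<le> 0")
  case False
  let ?s = "inverse t"
  have "exp (- ?s) * ?s ^ (m + 2) \<le> fact (m + 2)"
    using power_le_fact_exp[of ?s "m + 2"] False by (simp add: exp_minus field_simps del: fact_Suc)
  then have "exp (- ?s) * ?s ^ (m + 2) * t\<^sup>2 \<le> fact (m + 2) * t\<^sup>2"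
    by (rule mult_right_mono) simp
  moreover have "exp (- ?s) * ?s ^ (m + 2) * t\<^sup>2 = flat m t"
    using False by (simp add: flat_def field_simps power_add power2_eq_square)
  moreover have "0 \<le> flat m t" using False by (simp add: flat_def)
  ultimately show ?thesis by (simp del: fact_Suc)
qed (simp add: flat_def)

lemma flat_has_derivative:
  "(flat m has_real_derivative flat (m + 2) t - real m * flat (m + 1) t) (at t)"
proof (cases "t = 0")
  case True
  have "(\<lambda>h. (flat m (0 + h) - flat m 0) / h) \<midarrow>0\<rightarrow> 0"
  proof (rule Lim_null_comparison)
    show "\<forall>\<^sub>F h in at 0. norm ((flat m (0 + h) - flat m 0) / h) \<le> fact (m + 2) * \<bar>h\<bar>"
    proof (rule always_eventually, rule allI)
      fix h :: real
      show "norm ((flat m (0 + h) - flat m 0) / h) \<le> fact (m + 2) * \<bar>h\<bar>"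
        using flat_le[of m h] by (cases "h = 0") (auto simp: flat_def divide_le_eq power2_eq_square abs_mult[symmetric] mult.assoc simp del: fact_Suc)
    qed
    have "((\<lambda>h. fact (m + 2) * \<bar>h\<bar>) \<longlongrightarrow> fact (m + 2) * \<bar>0::real\<bar>) (at 0)"
      by (intro tendsto_intros)
    then show "((\<lambda>h::real. fact (m + 2) * \<bar>h\<bar>) \<longlongrightarrow> 0) (at 0)" by simp
  qed
  then show ?thesis using True by (simp add: DERIV_def flat_def)
next
  case False
  show ?thesis
  proof (cases "t < 0")
    case True
    have "((\<lambda>t. 0) has_real_derivative 0) (at t)" by simp
    then have "(flat m has_real_derivative 0) (at t)"
      by (rule has_field_derivative_transform_within_open[where S = "{..<0}"]) (use True in \<open>auto simp: flat_def\<close>)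
    then show ?thesis using True by (simp add: flat_def)
  next
    case False
    then have t: "0 < t" using \<open>t \<noteq> 0\<close> by simp
    have "((\<lambda>t. exp (- inverse t) * inverse t ^ m) has_real_derivative
        exp (- inverse t) * inverse t ^ (m + 2) - real m * (exp (- inverse t) * inverse t ^ (m + 1))) (at t)"
    proof -
      have e: "((\<lambda>t. exp (- inverse t)) has_real_derivative exp (- inverse t) * (inverse t)\<^sup>2) (at t)"
        using t by (auto intro!: derivative_eq_intros simp: power2_eq_square)
      have i: "(inverse has_real_derivative - (inverse t)\<^sup>2) (at t)"
        using t by (auto intro!: derivative_eq_intros simp: power2_eq_square)
      show ?thesis
      proof (cases m)
        case 0
        then show ?thesis using e by (simp add: power2_eq_square)
      next
        case (Suc n)
        show ?thesis
          unfolding Suc by (rule DERIV_cong[OF DERIV_mult[OF e DERIV_power_Suc[OF i]]])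
            (simp add: algebra_simps power2_eq_square)
      qed
    qed
    then have "(flat m has_real_derivative
        exp (- inverse t) * inverse t ^ (m + 2) - real m * (exp (- inverse t) * inverse t ^ (m + 1))) (at t)"
      by (rule has_field_derivative_transform_within_open[where S = "{0<..}"]) (use t in \<open>auto simp: flat_def\<close>)
    then show ?thesis using t by (simp add: flat_def)
  qed
qed

lemma continuous_flat: "continuous_on A (flat m)"
  by (meson DERIV_continuous continuous_at_imp_continuous_on flat_has_derivative)

text \<open>An algebra of functions that contains the bump and is closed under directional
  derivatives. Since \<open>Ck\<close> is defined by recursion on derivatives, all orders of
  smoothness follow by one induction, without formulas for higher derivatives.\<close>

inductive bump_algebra :: "real \<Rightarrow> 'a::euclidean_space \<Rightarrow> ('a \<Rightarrow> real) \<Rightarrow> bool" for h c where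
  const: "bump_algebra h c (\<lambda>x. k)"
| linear: "bump_algebra h c (\<lambda>x. x \<bullet> a)"
| flat: "bump_algebra h c (\<lambda>x. flat m (h\<^sup>2 - (x - c) \<bullet> (x - c)))"
| add: "bump_algebra h c f \<Longrightarrow> bump_algebra h c g \<Longrightarrow> bump_algebra h c (\<lambda>x. f x + g x)"
| mult: "bump_algebra h c f \<Longrightarrow> bump_algebra h c g \<Longrightarrow> bump_algebra h c (\<lambda>x. f x * g x)"

lemma bump_algebra_derivative:
  "bump_algebra h c f \<Longrightarrow>
    \<exists>f'. (\<forall>x. (f has_derivative f' x) (at x)) \<and> (\<forall>v. bump_algebra h c (\<lambda>x. f' x v))"
proof (induction rule: bump_algebra.induct)
  case (const k)
  show ?case by (rule exI[of _ "\<lambda>x v. 0"]) (auto intro: bump_algebra.const)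
next
  case (linear a)
  show ?case by (rule exI[of _ "\<lambda>x v. v \<bullet> a"]) (auto intro: bump_algebra.const intro!: derivative_eq_intros)
next
  case (flat m)
  let ?q = "\<lambda>x. h\<^sup>2 - (x - c) \<bullet> (x - c)"
  let ?p = "\<lambda>x. flat (m + 2) (?q x) - real m * flat (m + 1) (?q x)"
  show ?case
  proof (intro exI conjI allI)
    fix x v
    have "(?q has_derivative (\<lambda>v. - 2 * ((x - c) \<bullet> v))) (at x)"
      by (auto intro!: derivative_eq_intros simp: inner_commute)
    from has_derivative_compose[OF this flat_has_derivative[unfolded has_field_derivative_def]]
    show "((\<lambda>x. flat m (?q x)) has_derivative (\<lambda>v. ?p x * (- 2 * ((x - c) \<bullet> v)))) (at x)" .
  next
    fix v
    have "bump_algebra h c (\<lambda>x. (flat (m + 2) (?q x) + (- real m) * flat (m + 1) (?q x)) * ((- 2) * (x \<bullet> v + - (c \<bullet> v))))"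
      by (intro bump_algebra.intros)
    then show "bump_algebra h c (\<lambda>x. ?p x * (- 2 * ((x - c) \<bullet> v)))"
      by (simp add: inner_diff_left)
  qed
next
  case (add f g)
  then obtain f' g' where
    "\<forall>x. (f has_derivative f' x) (at x)" "\<forall>v. bump_algebra h c (\<lambda>x. f' x v)"
    "\<forall>x. (g has_derivative g' x) (at x)" "\<forall>v. bump_algebra h c (\<lambda>x. g' x v)"
    by blast
  then show ?case
    by (intro exI[of _ "\<lambda>x v. f' x v + g' x v"]) (auto intro: bump_algebra.add has_derivative_add)
next
  case (mult f g)
  then obtain f' g' where
    "\<forall>x. (f has_derivative f' x) (at x)" "\<forall>v. bump_algebra h c (\<lambda>x. f' x v)"
    "\<forall>x. (g has_derivative g' x) (at x)" "\<forall>v. bump_algebra h c (\<lambda>x. g' x v)"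
    by blast
  with mult.hyps show ?case
    by (intro exI[of _ "\<lambda>x v. f x * g' x v + f' x v * g x"])
      (auto intro!: bump_algebra.add bump_algebra.mult has_derivative_mult)
qed

lemma bump_algebra_Ck: "bump_algebra h c f \<Longrightarrow> Ck k f"
proof (induction k arbitrary: f)
  case 0
  then obtain f' where "\<forall>x. (f has_derivative f' x) (at x)"
    using bump_algebra_derivative by blast
  then show ?case
    using has_derivative_continuous continuous_at_imp_continuous_on by (metis Ck.simps(1))
next
  case (Suc k)
  then obtain f' where f': "\<And>x. (f has_derivative f' x) (at x)" "\<And>v. bump_algebra h c (\<lambda>x. f' x v)"
    using bump_algebra_derivative by blast
  have "frechet_derivative f (at x) = f' x" for x
    using frechet_derivative_at[OF f'(1)] by metis
  then show ?case
    using Suc.IH[OF f'(2)] f'(1) by (auto simp: differentiable_on_def differentiable_def intro: has_derivative_at_withinI)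
qed

lemma mollifier_exists:
  fixes h :: real assumes "0 < h"
  obtains \<rho> :: "'a::euclidean_space \<Rightarrow> real" and \<rho>' where "mollifier h \<rho>" "cgrad \<rho> \<rho>'"
    "\<And>x. smooth (\<lambda>y. \<rho> (x - y))"
proof -
  let ?\<beta> = "\<lambda>z::'a. flat 0 (h\<^sup>2 - z \<bullet> z)"
  define I where "I = integral\<^sup>L lborel ?\<beta>"
  define \<rho> where "\<rho> z = inverse I * ?\<beta> z" for z
  have supp: "?\<beta> z = 0" if "h \<le> norm z" for z
    using power_mono[OF that, of 2] assms by (simp add: flat_def power2_norm_eq_inner)
  have cont: "continuous_on UNIV ?\<beta>"
    by (intro continuous_on_compose2[OF continuous_flat[of UNIV]] continuous_intros) auto
  have Cc: "Cc ?\<beta>" by (rule CcI_radius[OF cont, where r = h]) (simp add: supp)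
  have nn: "0 \<le> ?\<beta> z" for z by (simp add: flat_def)
  have "I > 0"
  proof -
    have "?\<beta> 0 > 0" using assms by (simp add: flat_def)
    \<comment> \<open>A vanishing integral would give the zero set of the bump full measure; being
      closed, that set would then contain the origin, where the bump is positive.\<close>
    have "I \<noteq> 0"
    proof
      assume "I = 0"
      then have "AE x in lborel. ?\<beta> x = 0"
        using integral_nonneg_eq_0_iff_AE[OF Cc_integrable[OF Cc]] nn by (simp add: I_def)
      then have "AE x in lebesgue. ?\<beta> x = 0" by (rule AE_completion)
      then have "AE x in lebesgue. x \<in> {x. ?\<beta> x = 0}" by simp
      moreover have "closed {x. ?\<beta> x = 0}"
        by (intro closed_Collect_eq cont continuous_on_const)
      ultimately have "0 \<in> {x. ?\<beta> x = 0}"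
        by (intro mem_closed_if_AE_lebesgue)
      then show False using \<open>?\<beta> 0 > 0\<close> by simp
    qed
    moreover have "0 \<le> I" unfolding I_def using nn by simp
    ultimately show ?thesis by simp
  qed
  show thesis
  proof
    have "continuous_on UNIV (\<lambda>z. inverse I)" by simp
    then have "Cc \<rho>" unfolding \<rho>_def by (rule Cc_mult_right[OF Cc])
    moreover have "integral\<^sup>L lborel \<rho> = 1"
      unfolding \<rho>_def using \<open>I > 0\<close> by (simp add: I_def[symmetric])
    ultimately show "mollifier h \<rho>"
      unfolding mollifier_def using \<open>I > 0\<close> nn supp by (auto simp: \<rho>_def)
    have q: "cgrad (\<lambda>z::'a. h\<^sup>2 - z \<bullet> z) (\<lambda>z. 0 - 2 *\<^sub>R z)"
      by (intro cgrad_diff cgrad_const cgrad_norm_sq)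
    have c2: "continuous_on UNIV (\<lambda>t. flat (0 + 2) t - real 0 * flat (0 + 1) t)"
      by (intro continuous_intros continuous_flat)
    show "cgrad \<rho> (\<lambda>x. inverse I *\<^sub>R ((flat (0 + 2) (h\<^sup>2 - x \<bullet> x) - real 0 * flat (0 + 1) (h\<^sup>2 - x \<bullet> x)) *\<^sub>R (0 - 2 *\<^sub>R x)))"
      unfolding \<rho>_def by (intro cgrad_cmult cgrad_compose_real[OF q flat_has_derivative c2])
    fix x
    have "\<rho> (x - y) = inverse I * flat 0 (h\<^sup>2 - (y - x) \<bullet> (y - x))" for y
      by (simp add: \<rho>_def power2_norm_eq_inner[symmetric] norm_minus_commute)
    moreover have "bump_algebra h x (\<lambda>y. inverse I * flat 0 (h\<^sup>2 - (y - x) \<bullet> (y - x)))"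
      by (intro bump_algebra.intros)
    ultimately show "smooth (\<lambda>y. \<rho> (x - y))"
      unfolding smooth_def by (auto intro: bump_algebra_Ck)
  qed
qed

section \<open>Vector fields\<close>

text \<open>\<open>G i\<close> is the \<open>i\<close>-th row of the Jacobian matrix:
  \<open>G i x $ j\<close> is the derivative of component \<open>i\<close> in direction
  \<open>j\<close>. \<open>curl\<close> and \<open>dvg\<close> act on this matrix.\<close>

definition vgrad :: "(real^3 \<Rightarrow> real^3) \<Rightarrow> (3 \<Rightarrow> real^3 \<Rightarrow> real^3) \<Rightarrow> bool" where
  "vgrad F G \<longleftrightarrow> (\<forall>i. cgrad (\<lambda>x. F x $ i) (G i))"

definition curl :: "(3 \<Rightarrow> real^3 \<Rightarrow> real^3) \<Rightarrow> real^3 \<Rightarrow> real^3" where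
  "curl G x = vector [G 3 x $ 2 - G 2 x $ 3, G 1 x $ 3 - G 3 x $ 1, G 2 x $ 1 - G 1 x $ 2]"

definition dvg :: "(3 \<Rightarrow> real^3 \<Rightarrow> real^3) \<Rightarrow> real^3 \<Rightarrow> real" where
  "dvg G x = (\<Sum>i\<in>UNIV. G i x $ i)"

lemma curl_nth [simp]:
  "curl G x $ 1 = G 3 x $ 2 - G 2 x $ 3"
  "curl G x $ 2 = G 1 x $ 3 - G 3 x $ 1"
  "curl G x $ 3 = G 2 x $ 1 - G 1 x $ 2"
  by (simp_all add: curl_def)

lemma vgradD: "vgrad F G \<Longrightarrow> cgrad (\<lambda>x. F x $ i) (G i)"
  by (simp add: vgrad_def)

lemma inner_3: "x \<bullet> y = x $ 1 * y $ 1 + x $ 2 * y $ 2 + x $ 3 * y $ 3" for x y :: "real^3"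
  by (simp add: inner_vec_def sum_3)

lemma norm_sq_3: "(norm x)\<^sup>2 = (x $ 1)\<^sup>2 + (x $ 2)\<^sup>2 + (x $ 3)\<^sup>2" for x :: "real^3"
  unfolding power2_norm_eq_inner inner_3 by (simp add: power2_eq_square)

lemma inner_axis_1: "x \<bullet> axis i 1 = x $ i" for x :: "real^3"
  by (simp add: inner_axis)

lemma Cc_vec: "(\<And>i. Cc (\<lambda>x. f x $ i :: real)) \<Longrightarrow> Cc f" for f :: "'a::euclidean_space \<Rightarrow> real^3"
proof -
  assume f: "\<And>i. Cc (\<lambda>x. f x $ i)"
  have "Cc (\<lambda>x. \<Sum>i\<in>UNIV. f x $ i *\<^sub>R axis i 1 :: real^3)"
    by (intro Cc_sum Cc_scaleR_left f continuous_on_const)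
  moreover have "(\<Sum>i\<in>UNIV. f x $ i *\<^sub>R axis i 1) = f x" for x
    by (simp add: vec_eq_iff axis_def if_distrib[of "\<lambda>t. _ * t"] cong: if_cong)
  ultimately show ?thesis by simp
qed

lemma Cc_curl:
  assumes "\<And>i. Cc (G i)" shows "Cc (curl G)"
proof (rule Cc_vec)
  fix i :: 3
  show "Cc (\<lambda>x. curl G x $ i)"
    using exhaust_3[of i] by (elim disjE) (simp_all add: Cc_diff Cc_nth assms)
qed

lemma Cc_vgrad: "Cc F \<Longrightarrow> vgrad F G \<Longrightarrow> Cc (G i)"
  by (rule Cc_cgrad[OF Cc_nth vgradD])

lemma integral_curl_eq_0:
  assumes F: "Cc F" "vgrad F G"
  shows "(\<integral>x. curl G x $ i \<partial>lborel) = 0"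
proof -
  have "(\<integral>x. G i x $ j \<partial>lborel) = 0" for i j
    using integral_cgrad_eq_0[OF Cc_nth[OF F(1)] vgradD[OF F(2)], of i "axis j 1"]
    by (simp add: inner_axis_1)
  moreover have "integrable lborel (\<lambda>x. G i x $ j)" for i j
    by (intro Cc_integrable Cc_nth Cc_vgrad[OF F])
  ultimately show ?thesis
    using exhaust_3[of i] by auto
qed

text \<open>The weak form of div rot = 0: the expanded terms cancel in pairs by
  \<open>integral_grad_swap\<close>, which asks for no second derivatives of \<open>F\<close> or
  \<open>w\<close>.\<close>

lemma integral_curl_grad_eq_0:
  assumes F: "Cc F" "vgrad F G" and w: "Cc w" "cgrad w w'"
  shows "(\<integral>x. curl G x \<bullet> w' x \<partial>lborel) = 0"
proof -
  have i: "integrable lborel (\<lambda>x. G i x $ j * w' x $ k)" for i j k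
    by (intro Cc_integrable Cc_mult_left Cc_nth Cc_vgrad[OF F] Cc_continuous[OF Cc_nth]
        Cc_cgrad[OF w])
  have s: "(\<integral>x. G i x $ j * w' x $ k \<partial>lborel) = (\<integral>x. G i x $ k * w' x $ j \<partial>lborel)" for i j k
    using integral_grad_swap[OF Cc_nth[OF F(1)] vgradD[OF F(2)] w, of i "axis j 1" "axis k 1"]
    by (simp add: inner_axis_1)
  show ?thesis
    using i s[of 3 2 1] s[of 2 3 1] s[of 1 3 2]
    by (simp add: inner_3 left_diff_distrib)
qed

lemma integral_curl_by_parts:
  assumes F: "Cc F" "vgrad F G" and A: "vgrad A H"
  shows "(\<integral>x. curl G x \<bullet> A x \<partial>lborel) = (\<integral>x. F x \<bullet> curl H x \<partial>lborel)"
proof -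
  have i: "integrable lborel (\<lambda>x. G i x $ j * A x $ k)" for i j k
    by (intro Cc_integrable Cc_mult_left Cc_nth Cc_vgrad[OF F] cgrad_continuous[OF vgradD[OF A]])
  have i': "integrable lborel (\<lambda>x. F x $ i * H j x $ k)" for i j k
    by (intro Cc_integrable Cc_mult_left Cc_nth F(1) continuous_intros cgrad_cont_grad[OF vgradD[OF A]])
  have s: "(\<integral>x. G i x $ j * A x $ k \<partial>lborel) = - (\<integral>x. F x $ i * H k x $ j \<partial>lborel)" for i j k
    using integral_by_parts[OF Cc_nth[OF F(1)] vgradD[OF F(2)] vgradD[OF A], of i k "axis j 1"]
    by (simp add: inner_axis_1 mult.commute)
  show ?thesis
    using i i' by (simp add: inner_3 left_diff_distrib right_diff_distrib s)
qed

section \<open>Gaffney's inequality with a convex weight\<close>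

lemma vgrad_scale:
  assumes F: "vgrad F G" and p: "cgrad p p'"
  shows "vgrad (\<lambda>x. p x *\<^sub>R F x) (\<lambda>i x. p x *\<^sub>R G i x + F x $ i *\<^sub>R p' x)"
  unfolding vgrad_def using cgrad_mult[OF p vgradD[OF F]] by simp

text \<open>Passing to \<open>\<Theta> = exp (- V / 2) \<Phi>\<close> turns the weighted identity into unweighted integrations
  by parts that need no second derivatives of the field.\<close>

lemma weighted_Gaffney:
  assumes V: "cgrad V V'" "vgrad V' H"
    and convex: "\<And>x \<xi>. 0 \<le> (\<Sum>i\<in>UNIV. \<Sum>j\<in>UNIV. H i x $ j * (\<xi> $ i * \<xi> $ j))"
    and \<Phi>: "Cc \<Phi>" "vgrad \<Phi> G"
  shows "(\<integral>x. exp (- V x) * (\<Sum>i\<in>UNIV. (norm (G i x))\<^sup>2) \<partial>lborel)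
    \<le> (\<integral>x. exp (- V x) * (norm (curl G x))\<^sup>2 \<partial>lborel)
      + (\<integral>x. exp (- V x) * (dvg G x - V' x \<bullet> \<Phi> x)\<^sup>2 \<partial>lborel)"
proof -
  define w where "w x = exp (- V x / 2)" for x
  have w: "cgrad w (\<lambda>x. (- (1/2) * w x) *\<^sub>R V' x)"
  proof -
    have "((\<lambda>t. exp (- t / 2)) has_real_derivative - (1/2) * exp (- t / 2)) (at t)" for t :: real
      by (auto intro!: derivative_eq_intros)
    from cgrad_compose_real[OF V(1) this] show ?thesis
      unfolding w_def by (simp add: continuous_intros)
  qed
  have ww: "exp (- V x) = w x * w x" for x
    by (simp add: w_def exp_add[symmetric])
  define \<Theta> where "\<Theta> x = w x *\<^sub>R \<Phi> x" for x
  define T where "T i x = w x *\<^sub>R G i x + \<Phi> x $ i *\<^sub>R ((- (1/2) * w x) *\<^sub>R V' x)" for i x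
  have \<Theta>: "Cc \<Theta>" "vgrad \<Theta> T"
    unfolding \<Theta>_def T_def
    by (intro Cc_scaleR_right \<Phi> cgrad_continuous[OF w]) (rule vgrad_scale[OF \<Phi>(2) w])
  have V'c: "continuous_on UNIV (\<lambda>x. V' x $ i)" for i
    by (intro cgrad_continuous[OF vgradD[OF V(2)]])
  have Vc: "continuous_on UNIV (\<lambda>x. exp (- V x))"
    by (intro continuous_intros cgrad_continuous[OF V(1)])
  note G = Cc_vgrad[OF \<Phi>] and Tc = Cc_vgrad[OF \<Theta>]
  have V'c': "continuous_on UNIV V'" using cgrad_cont_grad[OF V(1)] .
  let ?A = "\<lambda>x. exp (- V x) * (\<Sum>i\<in>UNIV. (norm (G i x))\<^sup>2)"
  let ?B = "\<lambda>x. exp (- V x) * (norm (curl G x))\<^sup>2"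
  let ?C = "\<lambda>x. exp (- V x) * (dvg G x - V' x \<bullet> \<Phi> x)\<^sup>2"
  let ?P = "\<lambda>x i j. T i x $ j * T j x $ i - T i x $ i * T j x $ j"
  let ?Q = "\<lambda>x i j. V' x $ j * (\<Theta> x $ i * T j x $ i + \<Theta> x $ j * T i x $ i)"
  have int: "integrable lborel ?A" "integrable lborel ?B" "integrable lborel ?C"
  proof -
    show "integrable lborel ?A"
      by (intro Cc_integrable Cc_mult_right Cc_sum Cc_power2 Cc_norm G Vc)
    show "integrable lborel ?B"
      by (intro Cc_integrable Cc_mult_right Cc_power2 Cc_norm Cc_curl G Vc)
    show "integrable lborel ?C"
      unfolding dvg_def
      by (intro Cc_integrable Cc_mult_right Cc_power2 Cc_diff Cc_sum Cc_nth G Vc Cc_inner_right \<Phi> V'c')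
  qed
  \<comment> \<open>Starting point is \<open>|grad|^2 - |rot|^2 =\<close> sum of
    \<open>G i x $ j * G j x $ i\<close>. Rewritten in \<open>\<Theta>\<close> and \<open>T\<close>,
    the difference splits into \<open>?P\<close>, a null Lagrangian whose integral vanishes by
    \<open>integral_grad_swap\<close>, and \<open>?Q\<close>, where \<open>V' x $ j\<close>
    multiplies the \<open>i\<close>-th derivative of \<open>\<Theta> x $ i * \<Theta> x $ j\<close>.
    One integration by parts turns \<open>?Q\<close> into minus the Hessian form of \<open>V\<close>
    at \<open>\<Theta>\<close>.\<close>
  have pointwise: "?A x - ?B x - ?C x = (\<Sum>i\<in>UNIV. \<Sum>j\<in>UNIV. ?P x i j + ?Q x i j)" for x
    unfolding ww dvg_def T_def \<Theta>_def norm_sq_3 curl_nth inner_3 sum_3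
    by (simp add: power2_eq_square) algebra
  have iP: "integrable lborel (\<lambda>x. T i x $ j * T k x $ l)" for i j k l
    by (intro Cc_integrable Cc_mult_left Cc_nth Tc Cc_continuous[OF Cc_nth])
  have P: "(\<integral>x. ?P x i j \<partial>lborel) = 0" for i j
  proof -
    have "(\<integral>x. T i x $ j * T j x $ i \<partial>lborel) = (\<integral>x. T i x $ i * T j x $ j \<partial>lborel)"
      using integral_grad_swap[OF Cc_nth[OF \<Theta>(1)] vgradD[OF \<Theta>(2)] Cc_nth[OF \<Theta>(1)] vgradD[OF \<Theta>(2)],
          of i "axis j 1" j "axis i 1"]
      by (simp add: inner_axis_1)
    then show ?thesis using iP by simp
  qed
  have Q: "(\<integral>x. ?Q x i j \<partial>lborel) = - (\<integral>x. H j x $ i * (\<Theta> x $ j * \<Theta> x $ i) \<partial>lborel)" for i j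
  proof -
    have c: "cgrad (\<lambda>x. \<Theta> x $ i * \<Theta> x $ j) (\<lambda>x. \<Theta> x $ i *\<^sub>R T j x + \<Theta> x $ j *\<^sub>R T i x)"
      by (intro cgrad_mult vgradD \<Theta>)
    have "Cc (\<lambda>x. \<Theta> x $ i * \<Theta> x $ j)"
      by (intro Cc_mult_left Cc_nth \<Theta> Cc_continuous[OF Cc_nth])
    from integral_by_parts[OF this c vgradD[OF V(2), of j], of "axis i 1"]
    show ?thesis
      by (simp add: inner_axis_1 inner_add_left algebra_simps)
  qed
  have iQ: "integrable lborel (\<lambda>x. ?Q x i j)" for i j
    by (intro Cc_integrable Cc_mult_right Cc_add Cc_nth Tc V'c Cc_continuous[OF Cc_nth] \<Theta>)
  have iH: "integrable lborel (\<lambda>x. H j x $ i * (\<Theta> x $ j * \<Theta> x $ i))" for i j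
    by (intro Cc_integrable Cc_mult_right Cc_nth Cc_continuous[OF Cc_nth] \<Theta>
        continuous_intros cgrad_cont_grad[OF vgradD[OF V(2)]])
  have "integral\<^sup>L lborel ?A - integral\<^sup>L lborel ?B - integral\<^sup>L lborel ?C
      = (\<integral>x. ?A x - ?B x - ?C x \<partial>lborel)"
    using int by simp
  also have "\<dots> = (\<Sum>i\<in>UNIV. \<Sum>j\<in>UNIV. (\<integral>x. ?P x i j \<partial>lborel) + (\<integral>x. ?Q x i j \<partial>lborel))"
    unfolding pointwise using iP iQ
    by (subst Bochner_Integration.integral_sum, simp)+ simp
  also have "\<dots> = - (\<Sum>i\<in>UNIV. \<Sum>j\<in>UNIV. \<integral>x. H j x $ i * (\<Theta> x $ j * \<Theta> x $ i) \<partial>lborel)"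
    unfolding P Q by (simp add: sum_negf)
  also have "(\<Sum>i\<in>UNIV. \<Sum>j\<in>UNIV. \<integral>x. H j x $ i * (\<Theta> x $ j * \<Theta> x $ i) \<partial>lborel)
      = (\<integral>x. (\<Sum>j\<in>UNIV. \<Sum>i\<in>UNIV. H j x $ i * (\<Theta> x $ j * \<Theta> x $ i)) \<partial>lborel)"
    using iH by (subst sum.swap) simp
  finally have "integral\<^sup>L lborel ?A - integral\<^sup>L lborel ?B - integral\<^sup>L lborel ?C
      = - (\<integral>x. (\<Sum>j\<in>UNIV. \<Sum>i\<in>UNIV. H j x $ i * (\<Theta> x $ j * \<Theta> x $ i)) \<partial>lborel)" .
  moreover have "0 \<le> (\<integral>x. (\<Sum>j\<in>UNIV. \<Sum>i\<in>UNIV. H j x $ i * (\<Theta> x $ j * \<Theta> x $ i)) \<partial>lborel)"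
    using convex by (intro Bochner_Integration.integral_nonneg) simp
  ultimately show ?thesis by linarith
qed

section \<open>Norm bounds and the Poincare inequality for smooth functions\<close>

lemma l2norm_scaleR: "l2norm M (\<lambda>x. c *\<^sub>R f x) = \<bar>c\<bar> * l2norm M f"
proof -
  have "integral\<^sup>L M (\<lambda>x. (norm (c *\<^sub>R f x))\<^sup>2) = c\<^sup>2 * integral\<^sup>L M (\<lambda>x. (norm (f x))\<^sup>2)"
    by (simp add: power_mult_distrib)
  then show ?thesis by (simp add: l2norm_def real_sqrt_mult)
qed

lemma l2norm_le_ball:
  fixes f :: "'a::euclidean_space \<Rightarrow> 'b::euclidean_space"
  assumes f: "Cc f" and M: "\<And>x. norm (f x) \<le> M" and r: "\<And>x. r < norm x \<Longrightarrow> f x = 0"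
  shows "l2norm lborel f \<le> M * sqrt (measure lborel (cball (0::'a) r))"
proof -
  have "(\<integral>x. (norm (f x))\<^sup>2 \<partial>lborel) \<le> (\<integral>x. indicator (cball (0::'a) r) x *\<^sub>R M\<^sup>2 \<partial>lborel)"
  proof (rule integral_mono)
    show "integrable lborel (\<lambda>x. (norm (f x))\<^sup>2)" using Cc_integrable[OF Cc_power2[OF Cc_norm[OF f]]] .
    show "integrable lborel (\<lambda>x. indicator (cball (0::'a) r) x *\<^sub>R M\<^sup>2)"
      by (rule borel_integrable_compact) auto
    show "(norm (f x))\<^sup>2 \<le> indicator (cball 0 r) x *\<^sub>R M\<^sup>2" for x
      using r[of x] power_mono[OF M[of x], of 2] by (auto simp: indicator_def not_le)
  qed
  also have "\<dots> = measure lborel (cball (0::'a) r) * M\<^sup>2" by simp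
  finally have "l2norm lborel f \<le> sqrt (measure lborel (cball (0::'a) r) * M\<^sup>2)"
    unfolding l2norm_def by (rule real_sqrt_le_mono)
  also have "\<dots> = M * sqrt (measure lborel (cball (0::'a) r))"
    using order_trans[OF norm_ge_zero M] by (simp add: real_sqrt_mult)
  finally show ?thesis .
qed

lemma integrable_indicator_continuous:
  fixes g :: "'a::euclidean_space \<Rightarrow> 'b::euclidean_space"
  assumes "D \<in> sets borel" "bounded D" "continuous_on UNIV g"
  shows "integrable lborel (\<lambda>x. indicator D x *\<^sub>R g x)"
proof -
  have "integrable lborel (\<lambda>x. indicator D x *\<^sub>R (indicator (closure D) x *\<^sub>R g x))"
    using assms by (intro integrable_mult_indicator borel_integrable_compact)
      (auto intro: continuous_on_subset)
  also have "(\<lambda>x. indicator D x *\<^sub>R (indicator (closure D) x *\<^sub>R g x)) = (\<lambda>x. indicator D x *\<^sub>R g x)"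
    using closure_subset[of D] by (auto simp: fun_eq_iff split: split_indicator)
  finally show ?thesis .
qed

text \<open>The inequality is tested on restrictions of C1 functions from the whole space. Leaving
  the subtracted constant \<open>a\<close> unspecified spares all bookkeeping of mean values, in
  particular under the affine maps of \<open>poincare_affine\<close>.\<close>

definition poincare :: "'a::euclidean_space set \<Rightarrow> real \<Rightarrow> bool" where
  "poincare D c \<longleftrightarrow> (\<forall>f f'. Cc f \<longrightarrow> cgrad f f' \<longrightarrow>
     (\<exists>a. (\<integral>x. indicator D x * (f x - a)\<^sup>2 \<partial>lborel)
        \<le> c\<^sup>2 * (\<integral>x. indicator D x * (norm (f' x))\<^sup>2 \<partial>lborel)))"

text \<open>Testing against mean-free fields removes the constants from the Poincare inequality.\<close>

lemma poincare_mean_free: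
  fixes D :: "(real^3) set"
  assumes D: "D \<in> sets borel" "bounded D" and P: "poincare D c" "0 \<le> c"
    and J: "Cc J" "\<And>x. x \<notin> D \<Longrightarrow> J x = 0" "\<And>i. (\<integral>x. J x $ i \<partial>lborel) = 0"
    and \<Phi>: "Cc \<Phi>" "vgrad \<Phi> G"
  shows "\<bar>\<integral>x. J x \<bullet> \<Phi> x \<partial>lborel\<bar>
    \<le> l2norm lborel J * (c * sqrt (\<integral>x. indicator D x * (\<Sum>i\<in>UNIV. (norm (G i x))\<^sup>2) \<partial>lborel))"
proof -
  have "\<forall>i. \<exists>a. (\<integral>x. indicator D x * (\<Phi> x $ i - a)\<^sup>2 \<partial>lborel)
        \<le> c\<^sup>2 * (\<integral>x. indicator D x * (norm (G i x))\<^sup>2 \<partial>lborel)"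
    using P(1) Cc_nth[OF \<Phi>(1)] vgradD[OF \<Phi>(2)] unfolding poincare_def by blast
  from choice[OF this] obtain b where b: "\<And>i. (\<integral>x. indicator D x * (\<Phi> x $ i - b i)\<^sup>2 \<partial>lborel)
        \<le> c\<^sup>2 * (\<integral>x. indicator D x * (norm (G i x))\<^sup>2 \<partial>lborel)" by blast
  define a :: "real^3" where "a = (\<chi> i. b i)"
  define F where "F x = indicator D x *\<^sub>R (\<Phi> x - a)" for x
  have \<Phi>c: "continuous_on UNIV \<Phi>" using Cc_continuous[OF \<Phi>(1)] .
  have nF: "(norm (F x))\<^sup>2 = (\<Sum>i\<in>UNIV. indicator D x * (\<Phi> x $ i - b i)\<^sup>2)" for x
    by (simp add: F_def a_def norm_sq_3 sum_3 indicator_def)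
  have int1: "integrable lborel (\<lambda>x. indicator D x * (\<Phi> x $ i - b i)\<^sup>2)" for i
    using integrable_indicator_continuous[OF D, of "\<lambda>x. (\<Phi> x $ i - b i)\<^sup>2"] \<Phi>c
    by (simp add: continuous_intros)
  have int2: "integrable lborel (\<lambda>x. indicator D x * (norm (G i x))\<^sup>2)" for i
    using integrable_indicator_continuous[OF D, of "\<lambda>x. (norm (G i x))\<^sup>2"] cgrad_cont_grad[OF vgradD[OF \<Phi>(2)]]
    by (simp add: continuous_intros)
  have F: "square_integrable lborel F"
    unfolding square_integrable_def
  proof
    show "F \<in> borel_measurable lborel"
      unfolding F_def
      by (intro borel_measurable_integrable integrable_indicator_continuous D continuous_intros \<Phi>c)
    show "integrable lborel (\<lambda>x. (norm (F x))\<^sup>2)"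
      unfolding nF by (intro Bochner_Integration.integrable_sum int1)
  qed
  have e: "(\<integral>x. indicator D x * (\<Sum>i\<in>UNIV. (norm (G i x))\<^sup>2) \<partial>lborel)
      = (\<Sum>i\<in>UNIV. \<integral>x. indicator D x * (norm (G i x))\<^sup>2 \<partial>lborel)"
    unfolding sum_distrib_left by (intro Bochner_Integration.integral_sum int2)
  have "(\<integral>x. (norm (F x))\<^sup>2 \<partial>lborel) = (\<Sum>i\<in>UNIV. \<integral>x. indicator D x * (\<Phi> x $ i - b i)\<^sup>2 \<partial>lborel)"
    unfolding nF by (intro Bochner_Integration.integral_sum int1)
  also have "\<dots> \<le> (\<Sum>i\<in>UNIV. c\<^sup>2 * (\<integral>x. indicator D x * (norm (G i x))\<^sup>2 \<partial>lborel))"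
    by (intro sum_mono b)
  also have "\<dots> = c\<^sup>2 * (\<integral>x. indicator D x * (\<Sum>i\<in>UNIV. (norm (G i x))\<^sup>2) \<partial>lborel)"
    unfolding e by (rule sum_distrib_left[symmetric])
  finally have nn: "l2norm lborel F \<le> c * sqrt (\<integral>x. indicator D x * (\<Sum>i\<in>UNIV. (norm (G i x))\<^sup>2) \<partial>lborel)"
    unfolding l2norm_def using P(2) by (auto dest: real_sqrt_le_mono simp: real_sqrt_mult)
  have "(\<integral>x. J x \<bullet> a \<partial>lborel) = 0"
    using J(3) Cc_integrable[OF Cc_nth[OF J(1)]] by (simp add: inner_3)
  then have "(\<integral>x. J x \<bullet> \<Phi> x \<partial>lborel) = (\<integral>x. J x \<bullet> \<Phi> x - J x \<bullet> a \<partial>lborel)"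
    using Cc_integrable[OF Cc_inner_left[OF J(1) \<Phi>c]] Cc_integrable[OF Cc_inner_left[OF J(1) continuous_on_const]]
    by simp
  also have "\<dots> = (\<integral>x. J x \<bullet> F x \<partial>lborel)"
    using J(2) by (intro Bochner_Integration.integral_cong) (auto simp: F_def indicator_def inner_diff_right)
  finally have "\<bar>\<integral>x. J x \<bullet> \<Phi> x \<partial>lborel\<bar> \<le> l2norm lborel J * l2norm lborel F"
    using l2_Cauchy_Schwarz[OF Cc_square_integrable[OF J(1)] F] by simp
  also have "\<dots> \<le> l2norm lborel J * (c * sqrt (\<integral>x. indicator D x * (\<Sum>i\<in>UNIV. (norm (G i x))\<^sup>2) \<partial>lborel))"
    by (intro mult_left_mono nn) simp
  finally show ?thesis .
qed

section \<open>Cutoff functions\<close>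

lemma DERIV_max_power:
  "((\<lambda>t::real. (max 0 t) ^ (k + 2)) has_real_derivative real (k + 2) * (max 0 t) ^ (k + 1)) (at t)"
proof -
  consider "t < 0" | "t = 0" | "0 < t" by linarith
  then show ?thesis
  proof cases
    case 1
    have "((\<lambda>t. 0) has_real_derivative 0) (at t)" by simp
    then have "((\<lambda>t::real. (max 0 t) ^ (k + 2)) has_real_derivative 0) (at t)"
      by (rule has_field_derivative_transform_within_open[where S = "{..<0}"]) (use 1 in auto)
    then show ?thesis using 1 by simp
  next
    case 2
    have "(\<lambda>h::real. ((max 0 (0 + h)) ^ (k + 2) - (max 0 0) ^ (k + 2)) / h) \<midarrow>0\<rightarrow> 0"
    proof (rule Lim_null_comparison)
      show "\<forall>\<^sub>F h in at 0. norm (((max 0 (0 + h)) ^ (k + 2) - (max 0 0) ^ (k + 2)) / h) \<le> \<bar>h::real\<bar> ^ (k + 1)"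
      proof (rule always_eventually, rule allI)
        fix h :: real
        show "norm (((max 0 (0 + h)) ^ (k + 2) - (max 0 0) ^ (k + 2)) / h) \<le> \<bar>h\<bar> ^ (k + 1)"
          using zero_le_power[of "\<bar>h\<bar>" "k + 1"]
          by (cases "0 < h") (simp_all add: max_def del: zero_le_power)
      qed
      have "((\<lambda>h. \<bar>h\<bar> ^ (k + 1)) \<longlongrightarrow> \<bar>0::real\<bar> ^ (k + 1)) (at 0)"
        by (intro tendsto_intros)
      then show "((\<lambda>h::real. \<bar>h\<bar> ^ (k + 1)) \<longlongrightarrow> 0) (at 0)" by simp
    qed
    then show ?thesis using 2 by (simp add: DERIV_def)
  next
    case 3
    have "((\<lambda>t. t ^ (k + 2)) has_real_derivative real (k + 2) * t ^ (k + 1)) (at t)"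
      using DERIV_pow[of "k + 2" t UNIV] by simp
    then have "((\<lambda>t::real. (max 0 t) ^ (k + 2)) has_real_derivative real (k + 2) * t ^ (k + 1)) (at t)"
      by (rule has_field_derivative_transform_within_open[where S = "{0<..}"]) (use 3 in auto)
    then show ?thesis using 3 by simp
  qed
qed

text \<open>From exponent 2 on, powers of the positive part are C1. They provide both the compactly
  supported cutoffs and, with exponents 3 and 2, the penalty potentials and their gradients in
  \<open>convex_estimate\<close>.\<close>

lemma cgrad_max_power:
  assumes "cgrad f f'"
  shows "cgrad (\<lambda>x. (max 0 (f x)) ^ (k + 2)) (\<lambda>x. (real (k + 2) * (max 0 (f x)) ^ (k + 1)) *\<^sub>R f' x)"
  by (rule cgrad_compose_real[OF assms DERIV_max_power])
    (intro continuous_intros)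

text \<open>The profile is the squared positive part of
  \<open>1 - (norm x)\<^sup>2 / R\<^sup>2\<close>. Its gradient is of order \<open>1 / R\<close>,
  and on a fixed bounded set it differs from 1 by order \<open>1 / R\<^sup>2\<close>, so both
  effects of cutting off disappear for large \<open>R\<close>.\<close>

lemma cutoff_exists:
  fixes R :: real assumes "0 < R"
  obtains \<zeta> :: "'a::euclidean_space \<Rightarrow> real" and \<zeta>' where "cgrad \<zeta> \<zeta>'" "Cc \<zeta>"
    "\<And>x. 0 \<le> \<zeta> x" "\<And>x. \<zeta> x \<le> 1" "\<And>x. norm (\<zeta>' x) \<le> 4 / R"
    "\<And>x. R < norm x \<Longrightarrow> \<zeta> x = 0" "\<And>x. R < norm x \<Longrightarrow> \<zeta>' x = 0"
    "\<And>x. 1 - \<zeta> x \<le> 2 * (norm x)\<^sup>2 / R\<^sup>2"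
proof -
  let ?f = "\<lambda>x::'a. 1 - inverse (R\<^sup>2) * (x \<bullet> x)"
  define \<zeta> where "\<zeta> x = (max 0 (?f x)) ^ (0 + 2)" for x
  define \<zeta>' where "\<zeta>' x = (real (0 + 2) * (max 0 (?f x)) ^ (0 + 1)) *\<^sub>R (0 - inverse (R\<^sup>2) *\<^sub>R (2 *\<^sub>R x))" for x
  have f: "cgrad ?f (\<lambda>x. 0 - inverse (R\<^sup>2) *\<^sub>R (2 *\<^sub>R x))"
    by (intro cgrad_diff cgrad_const cgrad_cmult cgrad_norm_sq)
  have g: "cgrad \<zeta> \<zeta>'" unfolding \<zeta>_def \<zeta>'_def by (rule cgrad_max_power[OF f])
  have f0: "?f x \<le> 0" if "R \<le> norm x" for x
    using power_mono[OF that, of 2] assms by (simp add: power2_norm_eq_inner field_simps)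
  have f1: "?f x \<le> 1" for x by simp
  show thesis
  proof
    show "cgrad \<zeta> \<zeta>'" by fact
    show z: "\<zeta> x = 0" if "R < norm x" for x using f0[of x] that by (simp add: \<zeta>_def)
    show "\<zeta>' x = 0" if "R < norm x" for x using f0[of x] that by (simp add: \<zeta>'_def)
    show "Cc \<zeta>" by (rule CcI_radius[OF cgrad_continuous[OF g]]) (rule z)
    show "0 \<le> \<zeta> x" for x by (simp add: \<zeta>_def)
    show "\<zeta> x \<le> 1" for x
      unfolding \<zeta>_def by (intro power_le_one) (use f1[of x] in auto)
    show "norm (\<zeta>' x) \<le> 4 / R" for x
    proof (cases "R \<le> norm x")
      case True then show ?thesis using f0[OF True] assms by (simp add: \<zeta>'_def)
    next
      case False
      have "norm (\<zeta>' x) = 2 * max 0 (?f x) * (inverse (R\<^sup>2) * (2 * norm x))"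
        by (simp add: \<zeta>'_def)
      also have "\<dots> \<le> 2 * 1 * (inverse (R\<^sup>2) * (2 * R))"
        using False f1[of x] assms by (intro mult_mono) auto
      also have "\<dots> = 4 / R" using assms by (simp add: field_simps power2_eq_square)
      finally show ?thesis .
    qed
    show "1 - \<zeta> x \<le> 2 * (norm x)\<^sup>2 / R\<^sup>2" for x
    proof -
      define s where "s = inverse (R\<^sup>2) * (x \<bullet> x)"
      have s: "0 \<le> s" by (simp add: s_def)
      have "1 - (max 0 (1 - s))\<^sup>2 \<le> 2 * s"
        using s by (cases "s \<le> 1") (auto simp: max_def power2_eq_square algebra_simps)
      then show ?thesis
        unfolding \<zeta>_def s_def by (simp add: power2_norm_eq_inner divide_inverse mult_ac power2_eq_square[of "max _ _"])
    qed
  qed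
qed

section \<open>Mollified vector fields and their rotation and divergence\<close>

definition mollify :: "(real^3 \<Rightarrow> real) \<Rightarrow> (real^3 \<Rightarrow> real^3) \<Rightarrow> real^3 \<Rightarrow> real^3" where
  "mollify \<rho> F x = (\<chi> i. conv (\<lambda>y. F y $ i) \<rho> x)"

lemma mollify_nth [simp]: "mollify \<rho> F x $ i = conv (\<lambda>y. F y $ i) \<rho> x"
  by (simp add: mollify_def)

lemma vgrad_mollify:
  assumes "Cc F" "Cc \<rho>" "cgrad \<rho> \<rho>'"
  shows "vgrad (mollify \<rho> F) (\<lambda>i. conv (\<lambda>y. F y $ i) \<rho>')"
  unfolding vgrad_def using cgrad_conv[OF Cc_nth[OF assms(1)] assms(2,3)] by simp

lemma Cc_mollify: "Cc F \<Longrightarrow> Cc \<rho> \<Longrightarrow> Cc (mollify \<rho> F)"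
  by (rule Cc_vec) (simp add: Cc_conv Cc_nth)

lemma conv_diff:
  "Cc f \<Longrightarrow> Cc g \<Longrightarrow> Cc k \<Longrightarrow> conv (\<lambda>y. f y - g y) k x = conv f k x - conv g k x"
  using conv_integrable[of f k x] conv_integrable[of g k x]
  by (simp add: conv_def scaleR_diff_left)

lemma conv_cmult: "conv (\<lambda>y. c * f y) k x = c *\<^sub>R conv f k x"
  unfolding conv_def by (subst integral_scaleR_right[symmetric]) simp

lemma conv_nth: "Cc f \<Longrightarrow> Cc k \<Longrightarrow> conv f k x $ i = (\<integral>y. f y * k (x - y) $ i \<partial>lborel)"
  for k :: "'a::euclidean_space \<Rightarrow> real^3"
  using conv_inner[of f k x "axis i 1"] by (simp add: inner_axis_1) (simp add: conv_def)

text \<open>Mollification makes the rotation of \<open>A - w'\<close> meaningful although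
  \<open>w'\<close> is only continuous. The gradient part drops out because
  \<open>integral_grad_swap\<close> makes the derivative of the mollified \<open>w'\<close>
  symmetric, and for \<open>A\<close> the derivative moves from the kernel to the field.\<close>

lemma curl_mollify:
  assumes A: "Cc A" "vgrad A H" and w: "Cc w" "cgrad w w'" and k: "Cc \<rho>" "cgrad \<rho> \<rho>'"
  shows "curl (\<lambda>i. conv (\<lambda>y. (A y - w' y) $ i) \<rho>') x $ m = conv (\<lambda>y. curl H y $ m) \<rho> x"
proof -
  note k' = Cc_cgrad[OF k] and w'c = Cc_cgrad[OF w]
  have W: "conv (\<lambda>y. w' y $ i) \<rho>' x $ j = conv (\<lambda>y. w' y $ j) \<rho>' x $ i" for i j
    using integral_grad_swap[OF w Cc_reflect[OF k(1), of x] cgrad_reflect[OF k(2), of x], of "axis i 1" "axis j 1"]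
    by (simp add: conv_nth Cc_nth w'c k' inner_axis_1)
  have H: "conv (\<lambda>y. A y $ i) \<rho>' x $ j = conv (\<lambda>y. H i y $ j) \<rho> x" for i j
    using conv_grad_swap[OF Cc_nth[OF A(1)] vgradD[OF A(2)] k, of i x "axis j 1"]
    by (simp add: inner_axis_1)
  have e: "conv (\<lambda>y. (A y - w' y) $ i) \<rho>' x $ j = conv (\<lambda>y. H i y $ j) \<rho> x - conv (\<lambda>y. w' y $ i) \<rho>' x $ j" for i j
    by (simp add: conv_diff Cc_nth A w'c k' H)
  have c: "conv (\<lambda>y. H i y $ j - H k y $ l) \<rho> x = conv (\<lambda>y. H i y $ j) \<rho> x - conv (\<lambda>y. H k y $ l) \<rho> x" for i j k l
    by (intro conv_diff Cc_nth Cc_vgrad[OF A] k)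
  show ?thesis
    using exhaust_3[of m] W[of 3 2] W[of 1 3] W[of 2 1]
    by (elim disjE) (simp_all only: curl_nth e c)
qed

lemma norm_mollify_le:
  assumes F: "Cc F" and m: "mollifier h \<rho>"
  shows "(norm (mollify \<rho> F x))\<^sup>2 \<le> conv (\<lambda>y. (norm (F y))\<^sup>2) \<rho> x"
proof -
  have k: "Cc \<rho>" using m by (simp add: mollifier_def)
  have i: "integrable lborel (\<lambda>y. (F y $ i)\<^sup>2 * \<rho> (x - y))" for i
    using conv_integrable[OF Cc_power2[OF Cc_nth[OF F]] k, where x = x] by simp
  have "(norm (mollify \<rho> F x))\<^sup>2 = (\<Sum>i\<in>UNIV. (conv (\<lambda>y. F y $ i) \<rho> x)\<^sup>2)"
    by (simp add: norm_sq_3 sum_3)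
  also have "\<dots> \<le> (\<Sum>i\<in>UNIV. conv (\<lambda>y. (F y $ i)\<^sup>2) \<rho> x)"
    by (intro sum_mono conv_power2_le[OF Cc_nth[OF F] m])
  also have "\<dots> = conv (\<lambda>y. (norm (F y))\<^sup>2) \<rho> x"
    using i by (simp add: conv_def norm_sq_3 sum_3 distrib_right)
  finally show ?thesis .
qed

lemma mollifier_grad_zero:
  assumes "mollifier h \<rho>" "cgrad \<rho> \<rho>'" "h < norm z" shows "\<rho>' z = 0"
proof (rule cgrad_zero_open[OF assms(2)])
  show "open {x::'a. h < norm x}" by (intro open_Collect_less continuous_intros)
qed (use assms in \<open>auto simp: mollifier_def\<close>)

lemma dvg_mollify:
  assumes F: "Cc F" and k: "Cc \<rho>" "cgrad \<rho> \<rho>'"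
  shows "dvg (\<lambda>i. conv (\<lambda>y. F y $ i) \<rho>') x = (\<integral>y. F y \<bullet> \<rho>' (x - y) \<partial>lborel)"
proof -
  have "integrable lborel (\<lambda>y. F y $ i * \<rho>' (x - y) $ j)" for i j
    by (intro Cc_integrable Cc_mult_left Cc_nth F Cc_continuous[OF Cc_nth] Cc_reflect Cc_cgrad[OF k])
  then show ?thesis
    by (simp add: dvg_def conv_nth Cc_nth F Cc_cgrad[OF k] inner_3 sum_3)
qed

text \<open>The first term is a weighted pairing with a gradient, hence small for nearly divergence-free
  \<open>F\<close>; the second one is a commutator, controlled by the modulus of continuity of \<open>V'\<close>.\<close>

lemma weighted_dvg_mollify:
  assumes F: "Cc F" and k: "Cc \<rho>" "cgrad \<rho> \<rho>'" and V: "cgrad V V'"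
  shows "dvg (\<lambda>i. conv (\<lambda>y. F y $ i) \<rho>') x - V' x \<bullet> mollify \<rho> F x
    = - (\<integral>y. F y \<bullet> (\<rho> (x - y) *\<^sub>R V' y - \<rho>' (x - y)) \<partial>lborel)
      + (\<integral>y. (F y \<bullet> (V' y - V' x)) * \<rho> (x - y) \<partial>lborel)"
proof -
  have k': "Cc \<rho>'" using Cc_cgrad[OF k] .
  have V': "continuous_on UNIV V'" using cgrad_cont_grad[OF V] .
  have kc: "continuous_on UNIV (\<lambda>y. \<rho> (x - y))" using Cc_continuous[OF Cc_reflect[OF k(1)]] .
  have i1: "integrable lborel (\<lambda>y. F y \<bullet> \<rho>' (x - y))"
    by (intro Cc_integrable Cc_inner_left F Cc_continuous[OF Cc_reflect[OF k']])
  have i2: "integrable lborel (\<lambda>y. (F y \<bullet> V' y) * \<rho> (x - y))"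
    by (intro Cc_integrable Cc_mult_left Cc_inner_left F V' kc)
  have i3: "integrable lborel (\<lambda>y. (F y \<bullet> v) * \<rho> (x - y))" for v
    by (intro Cc_integrable Cc_mult_left Cc_inner_left F continuous_on_const kc)
  have i4: "integrable lborel (\<lambda>y. F y $ i * \<rho> (x - y))" for i
    by (intro Cc_integrable Cc_mult_left Cc_nth F kc)
  have "(\<integral>y. (F y \<bullet> V' x) * \<rho> (x - y) \<partial>lborel)
      = (\<integral>y. (\<Sum>i\<in>UNIV. V' x $ i * (F y $ i * \<rho> (x - y))) \<partial>lborel)"
    by (intro Bochner_Integration.integral_cong) (simp_all add: inner_3 sum_3 algebra_simps)
  also have "\<dots> = V' x \<bullet> mollify \<rho> F x"
    using i4 by (simp add: inner_3 sum_3 conv_def)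
  finally have "V' x \<bullet> mollify \<rho> F x = (\<integral>y. (F y \<bullet> V' x) * \<rho> (x - y) \<partial>lborel)" ..
  moreover have "(\<integral>y. F y \<bullet> (\<rho> (x - y) *\<^sub>R V' y - \<rho>' (x - y)) \<partial>lborel)
      = (\<integral>y. (F y \<bullet> V' y) * \<rho> (x - y) \<partial>lborel) - (\<integral>y. F y \<bullet> \<rho>' (x - y) \<partial>lborel)"
    using i1 i2 by (subst Bochner_Integration.integral_diff[symmetric])
      (auto simp: inner_diff_right mult.commute)
  moreover have "(\<integral>y. (F y \<bullet> (V' y - V' x)) * \<rho> (x - y) \<partial>lborel)
      = (\<integral>y. (F y \<bullet> V' y) * \<rho> (x - y) \<partial>lborel) - (\<integral>y. (F y \<bullet> V' x) * \<rho> (x - y) \<partial>lborel)"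
    using i2 i3 by (subst Bochner_Integration.integral_diff[symmetric])
      (auto simp: inner_diff_right left_diff_distrib)
  ultimately show ?thesis
    by (simp add: dvg_mollify[OF F k])
qed

section \<open>The estimate on the whole space with a convex weight\<close>

lemma norm_le_sum_nth_3:
  fixes x :: "real^3"
  assumes "\<And>i. \<bar>x $ i\<bar> \<le> e" shows "norm x \<le> 3 * e"
  using norm_le_l1_cart[of x] assms[of 1] assms[of 2] assms[of 3] by (simp add: sum_3)

lemma uniform_modulus_cball:
  fixes f :: "'a::euclidean_space \<Rightarrow> 'b::real_normed_vector"
  assumes "continuous_on UNIV f" "0 < e"
  obtains d where "0 < d"
    "\<And>x y. norm x \<le> R \<Longrightarrow> norm y \<le> R \<Longrightarrow> norm (x - y) < d \<Longrightarrow> norm (f y - f x) \<le> e"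
proof -
  have "uniformly_continuous_on (cball 0 R) f"
    by (intro compact_uniformly_continuous continuous_on_subset[OF assms(1)]) auto
  then obtain d where "0 < d" "\<And>x y. x \<in> cball 0 R \<Longrightarrow> y \<in> cball 0 R \<Longrightarrow> dist y x < d \<Longrightarrow> dist (f y) (f x) < e"
    unfolding uniformly_continuous_on_def using assms(2) by blast
  then show thesis
    by (intro that[of d]) (force simp: dist_norm norm_minus_commute)+
qed

lemma Cc_uniform_modulus:
  assumes "Cc f" "0 < e"
  obtains d where "0 < d" "\<And>x y. norm (x - y) < d \<Longrightarrow> norm (f y - f x) \<le> e"
proof -
  obtain d where "0 < d" "\<And>x y. dist y x < d \<Longrightarrow> dist (f y) (f x) < e"
    using Cc_uniformly_continuous[OF assms(1)] assms(2) unfolding uniformly_continuous_on_def by blast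
  then show thesis
    by (intro that[of d]) (force simp: dist_norm norm_minus_commute)+
qed

lemma continuous_bound_cball:
  fixes f :: "'a::euclidean_space \<Rightarrow> 'b::real_normed_vector"
  assumes "continuous_on UNIV f"
  obtains B where "0 \<le> B" "\<And>x. norm x \<le> R \<Longrightarrow> norm (f x) \<le> B"
proof -
  have "compact (f ` cball 0 R)"
    by (intro compact_continuous_image continuous_on_subset[OF assms]) auto
  then obtain B where "B > 0" "\<And>x. x \<in> cball 0 R \<Longrightarrow> norm (f x) \<le> B"
    using compact_imp_bounded bounded_pos by (metis imageI)
  then show thesis by (intro that[of B]) auto
qed

text \<open>Subtracting a gradient from \<open>A\<close> does not change its pairing with
  \<open>J\<close>. The remainder \<open>\<Psi>\<close> is smoothed to \<open>\<Psi>h\<close> and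
  cut off to \<open>\<Phi>\<close>, a field to which \<open>weighted_Gaffney\<close> and
  \<open>poincare_mean_free\<close> apply. The order of choices is cutoff radius \<open>R\<close>,
  mollification radius \<open>h\<close>, accuracy \<open>\<delta>\<close>: the moduli of
  \<open>V\<close> and \<open>V'\<close> are uniform only on bounded sets, and the bound
  \<open>M\<close> that \<open>\<delta>\<close> must beat depends on the kernel.\<close>

lemma weighted_estimate_approx:
  assumes D: "open D" "bounded D" and P: "poincare D c" "0 \<le> c"
    and V: "cgrad V V'" "vgrad V' H" "\<And>x. x \<in> D \<Longrightarrow> V x = 0"
    and convex: "\<And>x \<xi>. 0 \<le> (\<Sum>i\<in>UNIV. \<Sum>j\<in>UNIV. H i x $ j * (\<xi> $ i * \<xi> $ j))"
    and A: "Cc A" "vgrad A HA"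
    and J: "Cc J" "compact S" "S \<subseteq> D" "\<And>x. x \<notin> S \<Longrightarrow> J x = 0" "\<And>i. (\<integral>x. J x $ i \<partial>lborel) = 0"
      "\<And>u u'. Cc u \<Longrightarrow> cgrad u u' \<Longrightarrow> (\<integral>x. J x \<bullet> u' x \<partial>lborel) = 0"
    and r: "\<And>x. x \<in> D \<Longrightarrow> norm x \<le> r" "0 < r"
    and \<beta>: "\<beta> = sqrt (\<integral>x. exp (- V x) * (norm (curl HA x))\<^sup>2 \<partial>lborel)"
    and K: "K = sqrt ((\<integral>x. exp (- V x) * (norm (A x))\<^sup>2 \<partial>lborel) + 1)"
    and \<tau>: "0 < \<tau>"
  shows "\<bar>\<integral>x. J x \<bullet> A x \<partial>lborel\<bar> \<le> l2norm lborel J * (c * sqrt ((\<beta> + \<tau>)\<^sup>2 + \<tau>\<^sup>2))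
     + \<tau> * (l2norm lborel J * (sqrt 2 * K) + 3 * sqrt (measure lborel (cball (0::real^3) r)) * K)"
proof -
  define w where "w x = exp (- V x / 2)" for x
  \<comment> \<open>\<open>K\<close> bounds the weighted norm of the remainder: its summand 1
    absorbs \<open>\<delta>\<^sup>2\<close> and keeps it positive. The factor \<open>sqrt 2\<close>
    pays for comparing the weights at two points at distance less than \<open>h\<close>.\<close>
  define \<kappa> where "\<kappa> = sqrt 2 * K"
  have wpos: "0 < w x" for x by (simp add: w_def)
  have ww: "(w x)\<^sup>2 = exp (- V x)" for x
    by (simp add: w_def power2_eq_square exp_add[symmetric])
  have Vc: "continuous_on UNIV V" using cgrad_continuous[OF V(1)] .
  have V'c: "continuous_on UNIV V'" using cgrad_cont_grad[OF V(1)] .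
  have wc: "continuous_on UNIV w" unfolding w_def by (intro continuous_intros Vc) auto
  define B where "B = curl HA"
  have B: "Cc B" unfolding B_def by (intro Cc_curl Cc_vgrad[OF A])
  have \<beta>': "\<beta> = l2norm lborel (\<lambda>x. w x *\<^sub>R B x)"
    by (simp add: \<beta> l2norm_def B_def power_mult_distrib ww)
  have wA: "Cc (\<lambda>x. w x *\<^sub>R A x)" by (intro Cc_scaleR_right A wc)
  have K2: "K\<^sup>2 = (l2norm lborel (\<lambda>x. w x *\<^sub>R A x))\<^sup>2 + 1"
    by (simp add: K l2norm_sq power_mult_distrib ww)
  have "1 \<le> K" unfolding K using ww by (simp add: ww[symmetric])
  then have Kpos: "0 < K" "0 < \<kappa>" by (auto simp: \<kappa>_def)

  \<comment> \<open>One summand per demand: \<open>1\<close> and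
    \<open>2 * r\<^sup>2 / \<tau>\<close> make \<open>1 - \<zeta>\<close> at most
    \<open>\<tau>\<close> on \<open>D\<close>, \<open>r\<close> puts \<open>D\<close> inside the
    ball of radius \<open>R\<close>, and \<open>8 * \<kappa> / \<tau>\<close> makes the gradient of
    the cutoff cost at most \<open>\<tau> / 2\<close>.\<close>
  define R where "R = 1 + r + 8 * \<kappa> / \<tau> + 2 * r\<^sup>2 / \<tau>"
  have Rge: "r \<le> R" "1 \<le> R" "8 * \<kappa> / \<tau> \<le> R" "2 * r\<^sup>2 / \<tau> \<le> R"
    unfolding R_def using r(2) \<tau> Kpos by simp_all
  then have R: "0 < R" by simp
  have Rk: "4 / R * \<kappa> \<le> \<tau> / 2"
    using Rge(3) R \<tau> by (simp add: field_simps)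
  obtain \<zeta> :: "real^3 \<Rightarrow> real" and \<zeta>' where \<zeta>: "cgrad \<zeta> \<zeta>'" "Cc \<zeta>"
    "\<And>x. 0 \<le> \<zeta> x" "\<And>x. \<zeta> x \<le> 1" "\<And>x. norm (\<zeta>' x) \<le> 4 / R"
    "\<And>x. R < norm x \<Longrightarrow> \<zeta> x = 0" "\<And>x. R < norm x \<Longrightarrow> \<zeta>' x = 0"
    "\<And>x. 1 - \<zeta> x \<le> 2 * (norm x)\<^sup>2 / R\<^sup>2"
    by (rule cutoff_exists[OF R, where 'a = "real^3"]) blast
  have \<zeta>D: "1 - \<zeta> x \<le> \<tau>" if "x \<in> D" for x
  proof -
    have "1 - \<zeta> x \<le> 2 * (norm x)\<^sup>2 / R\<^sup>2" by (rule \<zeta>)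
    also have "\<dots> \<le> 2 * r\<^sup>2 / (R * 1)"
    proof (rule frac_le)
      show "2 * (norm x)\<^sup>2 \<le> 2 * r\<^sup>2" using r(1)[OF that] by (simp add: power_mono)
      show "R * 1 \<le> R\<^sup>2" using Rge(2) by (simp add: power2_eq_square)
    qed (use R in auto)
    also have "\<dots> \<le> \<tau>" using Rge(4) \<tau> R by (simp add: field_simps)
    finally show ?thesis .
  qed
  have \<zeta>w: "Cc (\<lambda>x. \<zeta> x * w x)" by (intro Cc_mult_left \<zeta> wc)
  define W where "W = l2norm lborel (\<lambda>x. \<zeta> x * w x)"
  have W: "0 \<le> W" by (simp add: W_def)

  \<comment> \<open>\<open>\<tau>1\<close> is the modulus for \<open>V'\<close>, with
    \<open>\<tau>1 * \<kappa> = \<tau> / 4\<close> in the divergence; \<open>\<tau>2\<close> is the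
    modulus for the rotation \<open>B\<close>, with \<open>3 * \<tau>2 * W\<close> at most
    \<open>\<tau> / 2\<close>. The \<open>+ 1\<close> covers \<open>W = 0\<close>.\<close>
  define \<tau>1 where "\<tau>1 = \<tau> / (4 * \<kappa>)"
  define \<tau>2 where "\<tau>2 = \<tau> / (6 * (W + 1))"
  have \<tau>12: "0 < \<tau>1" "0 < \<tau>2" using \<tau> Kpos W by (auto simp: \<tau>1_def \<tau>2_def)
  obtain d1 where d1: "0 < d1" "\<And>x y. norm x \<le> R + 1 \<Longrightarrow> norm y \<le> R + 1 \<Longrightarrow> norm (x - y) < d1 \<Longrightarrow> norm (V y - V x) \<le> 1/2"
    using uniform_modulus_cball[OF Vc, of "1/2" "R + 1"] by auto
  obtain d2 where d2: "0 < d2" "\<And>x y. norm x \<le> R + 1 \<Longrightarrow> norm y \<le> R + 1 \<Longrightarrow> norm (x - y) < d2 \<Longrightarrow> norm (V' y - V' x) \<le> \<tau>1"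
    using uniform_modulus_cball[OF V'c \<tau>12(1), of "R + 1"] by auto
  obtain d3 where d3: "0 < d3" "\<And>x y. norm (x - y) < d3 \<Longrightarrow> norm (B y - B x) \<le> \<tau>2"
    using Cc_uniform_modulus[OF B \<tau>12(2)] by auto
  obtain d4 where d4: "0 < d4" "\<And>x y. norm (x - y) < d4 \<Longrightarrow> norm (J y - J x) \<le> \<tau>"
    using Cc_uniform_modulus[OF J(1) \<tau>] by auto
  obtain d5 where d5: "0 < d5" "(\<Union>x\<in>S. cball x d5) \<subseteq> D"
    using compact_subset_open_imp_cball_epsilon_subset[OF J(2) D(1) J(3)] by auto
  \<comment> \<open>The moduli serve, in this order, the comparison of weights, the commutator with
    \<open>V'\<close>, the rotation, the approximation of \<open>J\<close>, and keeping mollified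
    \<open>J\<close> supported in \<open>D\<close>. The bound 1 keeps all kernels centred in the
    ball of radius \<open>R\<close> inside that of radius \<open>R + 1\<close>, where the moduli are
    valid.\<close>
  define h where "h = min 1 (min d1 (min d2 (min d3 (min d4 d5))))"
  have h: "0 < h" "h \<le> 1" "h \<le> d1" "h \<le> d2" "h \<le> d3" "h \<le> d4" "h \<le> d5"
    using d1(1) d2(1) d3(1) d4(1) d5(1) by (auto simp: h_def)
  obtain \<rho> :: "real^3 \<Rightarrow> real" and \<rho>' where \<rho>: "mollifier h \<rho>" "cgrad \<rho> \<rho>'"
    using mollifier_exists[OF h(1), where 'a = "real^3"] by blast
  have k: "Cc \<rho>" using \<rho>(1) by (simp add: mollifier_def)
  have k': "Cc \<rho>'" using Cc_cgrad[OF k \<rho>(2)] .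

  \<comment> \<open>The factor \<open>exp (V y)\<close> undoes the weight: since
    \<open>(w y)\<^sup>2 * exp (V y) = 1\<close>, pairing \<open>\<Psi>\<close> with the gradient of
    \<open>\<eta> x\<close> in the weighted space produces the first term of
    \<open>weighted_dvg_mollify\<close>, which near-orthogonality then controls.\<close>
  define \<eta> where "\<eta> x y = exp (V y) * \<rho> (x - y)" for x y
  define \<eta>' where "\<eta>' x y = exp (V y) *\<^sub>R (- \<rho>' (x - y)) + \<rho> (x - y) *\<^sub>R (exp (V y) *\<^sub>R V' y)" for x y
  have eV: "cgrad (\<lambda>y. exp (V y)) (\<lambda>y. exp (V y) *\<^sub>R V' y)"
    by (intro cgrad_compose_real[OF V(1) DERIV_exp] continuous_intros)
  have \<eta>: "cgrad (\<eta> x) (\<eta>' x)" "Cc (\<eta> x)" for x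
    unfolding \<eta>_def \<eta>'_def
    by (intro cgrad_mult eV cgrad_reflect[OF \<rho>(2)] Cc_mult_right Cc_reflect[OF k] cgrad_continuous[OF eV])+
  obtain M where M: "0 \<le> M" "\<And>x. norm x \<le> R \<Longrightarrow> l2norm lborel (\<lambda>y. w y *\<^sub>R \<eta>' x y) \<le> M"
  proof -
    have "continuous_on UNIV (\<lambda>y. exp (V y / 2))" by (intro continuous_intros Vc) auto
    from continuous_bound_cball[OF this, of "R + 1"] obtain M1 where
      M1: "0 \<le> M1" "\<And>y. norm y \<le> R + 1 \<Longrightarrow> norm (exp (V y / 2)) \<le> M1" by blast
    obtain M2 where M2: "0 \<le> M2" "\<And>y. norm y \<le> R + 1 \<Longrightarrow> norm (V' y) \<le> M2"
      using continuous_bound_cball[OF V'c, of "R + 1"] by blast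
    obtain M3 where M3: "0 < M3" "\<And>y. norm (\<rho> y) \<le> M3" using Cc_bound[OF k] by blast
    obtain M4 where M4: "0 < M4" "\<And>y. norm (\<rho>' y) \<le> M4" using Cc_bound[OF k'] by blast
    define M0 where "M0 = M1 * (M3 * M2 + M4)"
    have M0: "0 \<le> M0" unfolding M0_def using M1 M2 M3 M4 by (intro mult_nonneg_nonneg add_nonneg_nonneg) auto
    have "l2norm lborel (\<lambda>y. w y *\<^sub>R \<eta>' x y) \<le> M0 * sqrt (measure lborel (cball (0::real^3) (R + 1)))"
      if x: "norm x \<le> R" for x
    proof (rule l2norm_le_ball)
      show "Cc (\<lambda>y. w y *\<^sub>R \<eta>' x y)"
        by (intro Cc_scaleR_right Cc_cgrad[OF \<eta>(2,1)] wc)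
      have z: "\<eta>' x y = 0" if "R + 1 < norm y" for y
      proof -
        have "h < norm (x - y)" using that x h(2) norm_triangle_ineq2[of y x] by (simp add: norm_minus_commute)
        then have "\<rho> (x - y) = 0" "\<rho>' (x - y) = 0"
          using \<rho>(1) mollifier_grad_zero[OF \<rho>] by (auto simp: mollifier_def)
        then show ?thesis by (simp add: \<eta>'_def)
      qed
      then show "w y *\<^sub>R \<eta>' x y = 0" if "R + 1 < norm y" for y using that by simp
      show "norm (w y *\<^sub>R \<eta>' x y) \<le> M0" for y
      proof (cases "R + 1 < norm y")
        case False
        have "w y *\<^sub>R \<eta>' x y = exp (V y / 2) *\<^sub>R (\<rho> (x - y) *\<^sub>R V' y - \<rho>' (x - y))"
        proof -
          have "w y * exp (V y) = exp (V y / 2)" by (simp add: w_def exp_add[symmetric])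
          then show ?thesis
            by (simp add: \<eta>'_def scaleR_add_right scaleR_diff_right)
        qed
        also have "norm \<dots> = exp (V y / 2) * norm (\<rho> (x - y) *\<^sub>R V' y - \<rho>' (x - y))" by simp
        also have "\<dots> \<le> M1 * (M3 * M2 + M4)"
        proof (rule mult_mono)
          show "exp (V y / 2) \<le> M1" using M1(2)[of y] False by simp
          have "norm (\<rho> (x - y) *\<^sub>R V' y - \<rho>' (x - y)) \<le> norm (\<rho> (x - y)) * norm (V' y) + norm (\<rho>' (x - y))"
            using norm_triangle_ineq4[of "\<rho> (x - y) *\<^sub>R V' y" "\<rho>' (x - y)"] by simp
          also have "\<dots> \<le> M3 * M2 + M4"
            using M3 M4 M2(2)[of y] False by (intro add_mono mult_mono) auto
          finally show "norm (\<rho> (x - y) *\<^sub>R V' y - \<rho>' (x - y)) \<le> M3 * M2 + M4" .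
        qed (use M1 in auto)
        finally show ?thesis by (simp add: M0_def)
      qed (use z M0 in simp)
    qed
    then show thesis using M0 by (intro that[of "M0 * sqrt (measure lborel (cball (0::real^3) (R + 1)))"]) auto
  qed

  \<comment> \<open>\<open>\<delta> * M\<close> bounds the orthogonality defect pointwise in the
    ball of radius \<open>R\<close>, and the norm \<open>W\<close> of the cut-off weight turns this
    into an L2 bound of at most \<open>\<tau> / 4\<close>.\<close>
  define \<delta> where "\<delta> = min 1 (\<tau> / (4 * (M * W + 1)))"
  have \<delta>: "0 < \<delta>" "\<delta> \<le> 1" "\<delta> * M * W \<le> \<tau> / 4"
  proof -
    have MW: "0 \<le> M * W" using M W by simp
    then show "0 < \<delta>" "\<delta> \<le> 1" using \<tau> by (auto simp: \<delta>_def)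
    have "\<delta> * (M * W) \<le> \<tau> / (4 * (M * W + 1)) * (M * W + 1)"
      using MW \<tau> by (intro mult_mono) (auto simp: \<delta>_def)
    also have "\<dots> = \<tau> / 4" using MW by (simp add: field_simps)
    finally show "\<delta> * M * W \<le> \<tau> / 4" by (simp add: mult.assoc)
  qed
  \<comment> \<open>Multiplication by \<open>w\<close> maps the L2 space with density
    \<open>exp (- V)\<close> isometrically into the unweighted one, so this is near-orthogonality to
    all gradients in the weighted space.\<close>
  obtain g where g: "g \<in> {\<lambda>y. w y *\<^sub>R u' y |u u'. Cc u \<and> cgrad u u'}"
    "\<And>l. l \<in> {\<lambda>y. w y *\<^sub>R u' y |u u'. Cc u \<and> cgrad u u'} \<Longrightarrow>
       \<bar>\<integral>x. (w x *\<^sub>R A x - g x) \<bullet> l x \<partial>lborel\<bar> \<le> \<delta> * l2norm lborel l"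
    "(l2norm lborel (\<lambda>x. w x *\<^sub>R A x - g x))\<^sup>2 \<le> (l2norm lborel (\<lambda>x. w x *\<^sub>R A x))\<^sup>2 + \<delta>\<^sup>2"
  proof (rule near_orthogonal_remainder[OF Cc_square_integrable[OF wA] _ _ _ \<delta>(1),
        where G = "{\<lambda>y. w y *\<^sub>R u' y |u u'. Cc u \<and> cgrad u u'}"])
    show "square_integrable lborel l" if "l \<in> {\<lambda>y. w y *\<^sub>R u' y |u u'. Cc u \<and> cgrad u u'}" for l
      using that by (auto intro!: Cc_square_integrable Cc_scaleR_right wc intro: Cc_cgrad)
    show "(\<lambda>x. 0) \<in> {\<lambda>y. w y *\<^sub>R u' y |u u'. Cc u \<and> cgrad u u'}"
      using Cc_0 cgrad_const[of 0] by (intro CollectI exI[of _ "\<lambda>x. 0"]) auto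
    show "(\<lambda>x. a x + t *\<^sub>R b x) \<in> {\<lambda>y. w y *\<^sub>R u' y |u u'. Cc u \<and> cgrad u u'}"
      if "a \<in> {\<lambda>y. w y *\<^sub>R u' y |u u'. Cc u \<and> cgrad u u'}" "b \<in> {\<lambda>y. w y *\<^sub>R u' y |u u'. Cc u \<and> cgrad u u'}"
      for a b t
    proof -
      from that obtain u u' v v' where "a = (\<lambda>y. w y *\<^sub>R u' y)" "b = (\<lambda>y. w y *\<^sub>R v' y)"
        "Cc u" "cgrad u u'" "Cc v" "cgrad v v'" by blast
      then show ?thesis
        by (intro CollectI exI[of _ "\<lambda>x. u x + t * v x"] exI[of _ "\<lambda>x. u' x + t *\<^sub>R v' x"] conjI
            Cc_add Cc_mult_right cgrad_add cgrad_cmult) (auto simp: algebra_simps)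
    qed
  qed blast
  then obtain u u' where u: "Cc u" "cgrad u u'" "g = (\<lambda>y. w y *\<^sub>R u' y)" by blast
  define \<Psi> where "\<Psi> x = A x - u' x" for x
  have \<Psi>: "Cc \<Psi>" unfolding \<Psi>_def by (intro Cc_diff A Cc_cgrad[OF u(1,2)])
  have w\<Psi>: "Cc (\<lambda>x. w x *\<^sub>R \<Psi> x)" by (intro Cc_scaleR_right \<Psi> wc)
  have w\<Psi>e: "w x *\<^sub>R A x - g x = w x *\<^sub>R \<Psi> x" for x by (simp add: u \<Psi>_def algebra_simps)
  have \<Psi>K: "l2norm lborel (\<lambda>x. w x *\<^sub>R \<Psi> x) \<le> K"
  proof (rule power2_le_imp_le)
    have "\<delta>\<^sup>2 \<le> 1" using \<delta> by (simp add: power_le_one)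
    then show "(l2norm lborel (\<lambda>x. w x *\<^sub>R \<Psi> x))\<^sup>2 \<le> K\<^sup>2"
      using g(3) unfolding w\<Psi>e K2 by simp
  qed (use Kpos in simp)

  define \<Psi>h where "\<Psi>h = mollify \<rho> \<Psi>"
  define Gh where "Gh i = conv (\<lambda>y. \<Psi> y $ i) \<rho>'" for i
  have \<Psi>h: "Cc \<Psi>h" "vgrad \<Psi>h Gh"
    unfolding \<Psi>h_def Gh_def by (intro Cc_mollify \<Psi> k vgrad_mollify \<rho>(2))+
  \<comment> \<open>\<open>s = sqrt q\<close> dominates, in the ball of radius \<open>R\<close>,
    both \<open>w\<close> times the norm of \<open>\<Psi>h\<close> and \<open>w\<close> times the
    mollified norm of \<open>\<Psi>\<close>. Mollification preserves integrals, so the norm of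
    \<open>s\<close> is that of \<open>w *\<^sub>R \<Psi>\<close> up to the factor
    \<open>sqrt 2\<close>, which compensates the variation of \<open>w\<close> within distance
    \<open>h\<close>.\<close>
  define q where "q = conv (\<lambda>y. 2 * (norm (w y *\<^sub>R \<Psi> y))\<^sup>2) \<rho>"
  have qi: "Cc (\<lambda>y. 2 * (norm (w y *\<^sub>R \<Psi> y))\<^sup>2)"
    by (intro Cc_mult_right Cc_power2 Cc_norm w\<Psi>) auto
  have q: "Cc q" unfolding q_def by (rule Cc_conv[OF qi k])
  have qpos: "0 \<le> q x" for x
    unfolding q_def conv_def using \<rho>(1)
    by (intro Bochner_Integration.integral_nonneg) (auto simp: mollifier_def)
  define s where "s x = sqrt (q x)" for x
  have s: "Cc s" unfolding s_def
    by (rule Cc_subset[OF q]) (auto intro!: continuous_intros Cc_continuous[OF q])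
  have spos: "0 \<le> s x" for x using qpos by (simp add: s_def)
  have sn: "l2norm lborel s \<le> \<kappa>"
  proof -
    have "(l2norm lborel s)\<^sup>2 = integral\<^sup>L lborel q" using qpos by (simp add: l2norm_sq s_def)
    also have "\<dots> = 2 * (l2norm lborel (\<lambda>x. w x *\<^sub>R \<Psi> x))\<^sup>2"
      unfolding q_def integral_conv[OF qi \<rho>(1)] by (simp add: l2norm_sq)
    finally have "(l2norm lborel s)\<^sup>2 = 2 * (l2norm lborel (\<lambda>x. w x *\<^sub>R \<Psi> x))\<^sup>2" .
    moreover have "(l2norm lborel (\<lambda>x. w x *\<^sub>R \<Psi> x))\<^sup>2 \<le> K\<^sup>2"
      by (rule power_mono[OF \<Psi>K]) simp
    moreover have "2 * K\<^sup>2 = \<kappa>\<^sup>2" by (simp add: \<kappa>_def power_mult_distrib)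
    ultimately have "(l2norm lborel s)\<^sup>2 \<le> \<kappa>\<^sup>2" by linarith
    then show ?thesis by (rule power2_le_imp_le) (use Kpos in simp)
  qed
  have q_ge: "(w x)\<^sup>2 * conv (\<lambda>y. (norm (\<Psi> y))\<^sup>2) \<rho> x \<le> q x" if x: "norm x \<le> R" for x
  proof -
    have "(w x)\<^sup>2 * conv (\<lambda>y. (norm (\<Psi> y))\<^sup>2) \<rho> x = conv (\<lambda>y. (w x)\<^sup>2 * (norm (\<Psi> y))\<^sup>2) \<rho> x"
      by (simp add: conv_cmult)
    also have "\<dots> \<le> q x"
      unfolding q_def
    proof (rule conv_local_mono[OF _ qi \<rho>(1)])
      show "Cc (\<lambda>y. (w x)\<^sup>2 * (norm (\<Psi> y))\<^sup>2)"
        by (intro Cc_mult_right Cc_power2 Cc_norm \<Psi>) auto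
      fix y assume y: "norm (x - y) < h"
      then have "norm y \<le> R + 1" using x h(2) norm_triangle_ineq2[of y x] by (simp add: norm_minus_commute)
      then have "\<bar>V y - V x\<bar> \<le> 1/2" using d1(2)[of x y] x y h(3) by simp
      then have "- V x \<le> 1/2 + - V y" by linarith
      then have "exp (- V x) \<le> exp (1/2) * exp (- V y)" by (simp only: exp_add[symmetric] exp_le_cancel_iff)
      also have "\<dots> \<le> 2 * exp (- V y)"
        using exp_half_le2 by (intro mult_right_mono) auto
      finally have "(w x)\<^sup>2 \<le> 2 * (w y)\<^sup>2" by (simp add: ww)
      then show "(w x)\<^sup>2 * (norm (\<Psi> y))\<^sup>2 \<le> 2 * (norm (w y *\<^sub>R \<Psi> y))\<^sup>2"
        using mult_right_mono[of "(w x)\<^sup>2" "2 * (w y)\<^sup>2" "(norm (\<Psi> y))\<^sup>2"]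
        by (simp add: power_mult_distrib)
    qed
    finally show ?thesis .
  qed
  have F1: "w x * norm (\<Psi>h x) \<le> s x" if x: "norm x \<le> R" for x
  proof -
    have "(w x * norm (\<Psi>h x))\<^sup>2 \<le> (w x)\<^sup>2 * conv (\<lambda>y. (norm (\<Psi> y))\<^sup>2) \<rho> x"
      unfolding power_mult_distrib \<Psi>h_def
      by (intro mult_left_mono norm_mollify_le[OF \<Psi> \<rho>(1)]) simp
    then have "(w x * norm (\<Psi>h x))\<^sup>2 \<le> q x" using q_ge[OF x] by simp
    then show ?thesis unfolding s_def by (rule real_le_rsqrt)
  qed
  have F2: "w x * conv (\<lambda>y. norm (\<Psi> y)) \<rho> x \<le> s x" if x: "norm x \<le> R" for x
  proof -
    have "(w x * conv (\<lambda>y. norm (\<Psi> y)) \<rho> x)\<^sup>2 \<le> (w x)\<^sup>2 * conv (\<lambda>y. (norm (\<Psi> y))\<^sup>2) \<rho> x"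
      unfolding power_mult_distrib
      by (intro mult_left_mono conv_power2_le[OF Cc_norm[OF \<Psi>] \<rho>(1)]) simp
    then have "(w x * conv (\<lambda>y. norm (\<Psi> y)) \<rho> x)\<^sup>2 \<le> q x" using q_ge[OF x] by simp
    then show ?thesis unfolding s_def by (rule real_le_rsqrt)
  qed

  have div: "\<bar>dvg Gh x - V' x \<bullet> \<Psi>h x\<bar> \<le> \<delta> * M + \<tau>1 * conv (\<lambda>y. norm (\<Psi> y)) \<rho> x"
    if x: "norm x \<le> R" for x
  proof -
    have "(\<integral>y. \<Psi> y \<bullet> (\<rho> (x - y) *\<^sub>R V' y - \<rho>' (x - y)) \<partial>lborel)
        = (\<integral>y. (w y *\<^sub>R A y - g y) \<bullet> (w y *\<^sub>R \<eta>' x y) \<partial>lborel)"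
    proof (rule Bochner_Integration.integral_cong)
      fix y
      have one: "w y * w y * exp (V y) = 1"
        using ww[of y] by (simp add: power2_eq_square exp_minus)
      have "(w y * w y) *\<^sub>R \<eta>' x y = \<rho> (x - y) *\<^sub>R V' y - \<rho>' (x - y)"
      proof -
        have "\<eta>' x y = exp (V y) *\<^sub>R (\<rho> (x - y) *\<^sub>R V' y - \<rho>' (x - y))"
          by (simp add: \<eta>'_def scaleR_diff_right mult.commute)
        then have "(w y * w y) *\<^sub>R \<eta>' x y = (w y * w y * exp (V y)) *\<^sub>R (\<rho> (x - y) *\<^sub>R V' y - \<rho>' (x - y))"
          by simp
        with one show ?thesis by simp
      qed
      then show "\<Psi> y \<bullet> (\<rho> (x - y) *\<^sub>R V' y - \<rho>' (x - y)) = (w y *\<^sub>R A y - g y) \<bullet> (w y *\<^sub>R \<eta>' x y)"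
        unfolding w\<Psi>e by (metis inner_scaleR_left inner_scaleR_right scaleR_scaleR)
    qed simp
    also have "\<bar>\<dots>\<bar> \<le> \<delta> * l2norm lborel (\<lambda>y. w y *\<^sub>R \<eta>' x y)"
      using \<eta>[of x] by (intro g(2)) blast
    also have "\<dots> \<le> \<delta> * M" using M(2)[OF x] \<delta>(1) by simp
    finally have 1: "\<bar>\<integral>y. \<Psi> y \<bullet> (\<rho> (x - y) *\<^sub>R V' y - \<rho>' (x - y)) \<partial>lborel\<bar> \<le> \<delta> * M" .
    have c: "Cc (\<lambda>y. norm (\<Psi> y))" by (rule Cc_norm[OF \<Psi>])
    have "norm (\<integral>y. (\<Psi> y \<bullet> (V' y - V' x)) * \<rho> (x - y) \<partial>lborel)
        \<le> (\<integral>y. \<tau>1 * (norm (\<Psi> y) * \<rho> (x - y)) \<partial>lborel)"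
    proof (rule Bochner_Integration.integral_norm_bound_integral)
      show "integrable lborel (\<lambda>y. (\<Psi> y \<bullet> (V' y - V' x)) * \<rho> (x - y))"
        by (intro Cc_integrable Cc_mult_left Cc_inner_left \<Psi> continuous_intros V'c Cc_continuous[OF Cc_reflect[OF k]])
      show "integrable lborel (\<lambda>y. \<tau>1 * (norm (\<Psi> y) * \<rho> (x - y)))"
        using conv_integrable[OF c k, of x] by simp
      fix y
      have r0: "0 \<le> \<rho> (x - y)" using \<rho>(1) by (simp add: mollifier_def)
      show "norm ((\<Psi> y \<bullet> (V' y - V' x)) * \<rho> (x - y)) \<le> \<tau>1 * (norm (\<Psi> y) * \<rho> (x - y))"
      proof (cases "norm (x - y) < h")
        case True
        then have "norm y \<le> R + 1" using x h(2) norm_triangle_ineq2[of y x] by (simp add: norm_minus_commute)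
        then have "norm (V' y - V' x) \<le> \<tau>1" using d2(2)[of x y] x True h(4) by simp
        then have "\<bar>\<Psi> y \<bullet> (V' y - V' x)\<bar> \<le> norm (\<Psi> y) * \<tau>1"
          using Cauchy_Schwarz_ineq2[of "\<Psi> y" "V' y - V' x"] mult_left_mono[of "norm (V' y - V' x)" \<tau>1 "norm (\<Psi> y)"]
          by simp
        from mult_right_mono[OF this r0] show ?thesis using r0 by (simp add: abs_mult mult_ac)
      next
        case False then show ?thesis using \<rho>(1) by (simp add: mollifier_def)
      qed
    qed
    then have 2: "\<bar>\<integral>y. (\<Psi> y \<bullet> (V' y - V' x)) * \<rho> (x - y) \<partial>lborel\<bar> \<le> \<tau>1 * conv (\<lambda>y. norm (\<Psi> y)) \<rho> x"
      by (simp add: conv_def)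
    show ?thesis
      using 1 2 weighted_dvg_mollify[OF \<Psi> k \<rho>(2) V(1), of x] unfolding Gh_def \<Psi>h_def by linarith
  qed

  define \<Phi> where "\<Phi> x = \<zeta> x *\<^sub>R \<Psi>h x" for x
  define G where "G i x = \<zeta> x *\<^sub>R Gh i x + \<Psi>h x $ i *\<^sub>R \<zeta>' x" for i x
  have \<Phi>: "Cc \<Phi>" "vgrad \<Phi> G"
    unfolding \<Phi>_def G_def
    by (intro Cc_scaleR_left \<zeta> Cc_continuous[OF \<Psi>h(1)]) (rule vgrad_scale[OF \<Psi>h(2) \<zeta>(1)])

  \<comment> \<open>Two errors of size \<open>\<tau> / 2\<close>: replacing the mollified rotation
    by \<open>B\<close> costs a uniform \<open>3 * \<tau>2\<close>, made square integrable by the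
    cutoff, and the gradient of the cutoff costs \<open>4 / R\<close> times
    \<open>s\<close>.\<close>
  have curl_le: "l2norm lborel (\<lambda>x. w x *\<^sub>R curl G x) \<le> \<beta> + \<tau>"
  proof -
    have e: "curl G x = \<zeta> x *\<^sub>R curl Gh x + cross3 (\<zeta>' x) (\<Psi>h x)" for x
      by (simp add: vec_eq_iff forall_3 G_def cross3_simps algebra_simps)
    have cB: "norm (curl Gh x - B x) \<le> 3 * \<tau>2" for x
    proof (rule norm_le_sum_nth_3)
      fix i
      have "curl Gh x $ i = conv (\<lambda>y. B y $ i) \<rho> x"
        unfolding Gh_def \<Psi>_def B_def by (rule curl_mollify[OF A u(1,2) k \<rho>(2)])
      moreover have "\<bar>conv (\<lambda>y. B y $ i) \<rho> x - B x $ i\<bar> \<le> \<tau>2"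
      proof (rule conv_close[OF Cc_nth[OF B] \<rho>(1)])
        show "\<bar>B y $ i - B x $ i\<bar> \<le> \<tau>2" if "norm (x - y) < h" for y
          using component_le_norm_cart[of "B y - B x" i] d3(2)[of x y] that h(5) by simp
      qed
      ultimately show "\<bar>(curl Gh x - B x) $ i\<bar> \<le> \<tau>2" by simp
    qed
    have "norm (w x *\<^sub>R curl G x) \<le> norm (w x *\<^sub>R B x) + ((3 * \<tau>2) *\<^sub>R (\<zeta> x * w x) + (4 / R) *\<^sub>R s x)" for x
    proof (cases "R < norm x")
      case True
      have "0 \<le> (3 * \<tau>2) * (\<zeta> x * w x)" "0 \<le> (4 / R) * s x"
        using \<tau>12 \<zeta>(3)[of x] wpos[of x] R spos[of x] by simp_all
      then show ?thesis using True by (simp add: e \<zeta>)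
    next
      case False
      have "(norm (cross3 (\<zeta>' x) (\<Psi>h x)))\<^sup>2 \<le> (norm (\<zeta>' x) * norm (\<Psi>h x))\<^sup>2"
        by (simp add: norm_cross power_mult_distrib)
      then have "norm (cross3 (\<zeta>' x) (\<Psi>h x)) \<le> norm (\<zeta>' x) * norm (\<Psi>h x)"
        by (rule power2_le_imp_le) simp
      also have "\<dots> \<le> 4 / R * norm (\<Psi>h x)" by (intro mult_right_mono \<zeta>) simp
      finally have "w x * norm (cross3 (\<zeta>' x) (\<Psi>h x)) \<le> w x * (4 / R * norm (\<Psi>h x))"
        using less_imp_le[OF wpos] by (rule mult_left_mono)
      also have "\<dots> = 4 / R * (w x * norm (\<Psi>h x))" by simp
      also have "\<dots> \<le> 4 / R * s x" using F1[of x] False R by (intro mult_left_mono) auto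
      finally have 1: "w x * norm (cross3 (\<zeta>' x) (\<Psi>h x)) \<le> 4 / R * s x" .
      have "norm (curl Gh x) \<le> norm (B x) + 3 * \<tau>2"
        using norm_triangle_ineq2[of "curl Gh x" "B x"] cB[of x] by linarith
      then have "\<zeta> x * norm (curl Gh x) \<le> \<zeta> x * norm (B x) + \<zeta> x * (3 * \<tau>2)"
        unfolding distrib_left[symmetric] by (rule mult_left_mono[OF _ \<zeta>(3)])
      also have "\<zeta> x * norm (B x) \<le> 1 * norm (B x)" by (intro mult_right_mono \<zeta>) simp
      finally have "\<zeta> x * norm (curl Gh x) \<le> norm (B x) + \<zeta> x * (3 * \<tau>2)" by simp
      then have 2: "w x * (\<zeta> x * norm (curl Gh x)) \<le> w x * (norm (B x) + \<zeta> x * (3 * \<tau>2))"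
        using less_imp_le[OF wpos] by (rule mult_left_mono)
      have "norm (w x *\<^sub>R curl G x) = w x * norm (\<zeta> x *\<^sub>R curl Gh x + cross3 (\<zeta>' x) (\<Psi>h x))"
        using wpos[of x] by (simp add: e)
      also have "\<dots> \<le> w x * (\<zeta> x * norm (curl Gh x) + norm (cross3 (\<zeta>' x) (\<Psi>h x)))"
        using norm_triangle_ineq[of "\<zeta> x *\<^sub>R curl Gh x" "cross3 (\<zeta>' x) (\<Psi>h x)"] wpos[of x] \<zeta>(3)[of x] by simp
      finally show ?thesis using 1 2 wpos[of x] by (simp add: algebra_simps)
    qed
    moreover have c1: "Cc (\<lambda>x. norm (w x *\<^sub>R B x))" "Cc (\<lambda>x. (3 * \<tau>2) *\<^sub>R (\<zeta> x * w x))" "Cc (\<lambda>x. (4 / R) *\<^sub>R s x)"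
      by (intro Cc_norm Cc_scaleR_right B wc \<zeta>w s continuous_intros)+
    moreover have "Cc (\<lambda>x. w x *\<^sub>R curl G x)"
      by (intro Cc_scaleR_right Cc_curl Cc_vgrad[OF \<Phi>] wc)
    ultimately have "l2norm lborel (\<lambda>x. w x *\<^sub>R curl G x)
      \<le> l2norm lborel (\<lambda>x. norm (w x *\<^sub>R B x) + ((3 * \<tau>2) *\<^sub>R (\<zeta> x * w x) + (4 / R) *\<^sub>R s x))"
      by (intro l2norm_mono Cc_square_integrable Cc_add) (auto intro: order_trans[OF _ abs_ge_self])
    also have "\<dots> \<le> l2norm lborel (\<lambda>x. norm (w x *\<^sub>R B x)) + l2norm lborel (\<lambda>x. (3 * \<tau>2) *\<^sub>R (\<zeta> x * w x) + (4 / R) *\<^sub>R s x)"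
      by (intro l2norm_triangle Cc_square_integrable Cc_add c1)
    also have "l2norm lborel (\<lambda>x. (3 * \<tau>2) *\<^sub>R (\<zeta> x * w x) + (4 / R) *\<^sub>R s x)
      \<le> l2norm lborel (\<lambda>x. (3 * \<tau>2) *\<^sub>R (\<zeta> x * w x)) + l2norm lborel (\<lambda>x. (4 / R) *\<^sub>R s x)"
      by (intro l2norm_triangle Cc_square_integrable c1)
    also have "l2norm lborel (\<lambda>x. (3 * \<tau>2) *\<^sub>R (\<zeta> x * w x)) = 3 * \<tau>2 * W"
      using \<tau>12 by (simp add: l2norm_scaleR W_def del: real_scaleR_def)
    also have "l2norm lborel (\<lambda>x. (4 / R) *\<^sub>R s x) = 4 / R * l2norm lborel s"
      using R by (simp add: l2norm_scaleR del: real_scaleR_def)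
    also have "4 / R * l2norm lborel s \<le> \<tau> / 2"
      using order_trans[OF mult_left_mono[OF sn] Rk] R by simp
    also have "3 * \<tau>2 * W \<le> \<tau> / 2"
      using W \<tau> by (simp add: \<tau>2_def field_simps)
    also have "l2norm lborel (\<lambda>x. norm (w x *\<^sub>R B x)) = \<beta>" by (simp add: \<beta>' l2norm_def)
    finally show ?thesis by simp
  qed

  \<comment> \<open>The budget is \<open>\<tau> / 4\<close> for the orthogonality defect,
    \<open>\<tau> / 4\<close> for the commutator with \<open>V'\<close> and
    \<open>\<tau> / 2\<close> for the gradient of the cutoff.\<close>
  have div_le: "l2norm lborel (\<lambda>x. w x *\<^sub>R (dvg G x - V' x \<bullet> \<Phi> x)) \<le> \<tau>"
  proof -
    have e: "dvg G x - V' x \<bullet> \<Phi> x = \<zeta> x * (dvg Gh x - V' x \<bullet> \<Psi>h x) + \<zeta>' x \<bullet> \<Psi>h x" for x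
      by (simp add: dvg_def G_def \<Phi>_def sum_3 inner_3 algebra_simps)
    have "norm (w x *\<^sub>R (dvg G x - V' x \<bullet> \<Phi> x)) \<le> (\<delta> * M) *\<^sub>R (\<zeta> x * w x) + (\<tau>1 + 4 / R) *\<^sub>R s x" for x
    proof (cases "R < norm x")
      case True
      have "0 \<le> (\<delta> * M) * (\<zeta> x * w x)" "0 \<le> (\<tau>1 + 4 / R) * s x"
        using \<tau>12 \<zeta>(3)[of x] wpos[of x] R spos[of x] M(1) \<delta>(1) by simp_all
      then show ?thesis using True by (simp add: e \<zeta>)
    next
      case False
      have "\<bar>\<zeta>' x \<bullet> \<Psi>h x\<bar> \<le> norm (\<zeta>' x) * norm (\<Psi>h x)" by (rule Cauchy_Schwarz_ineq2)
      also have "\<dots> \<le> 4 / R * norm (\<Psi>h x)" by (intro mult_right_mono \<zeta>) simp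
      finally have "w x * \<bar>\<zeta>' x \<bullet> \<Psi>h x\<bar> \<le> w x * (4 / R * norm (\<Psi>h x))"
        using less_imp_le[OF wpos] by (rule mult_left_mono)
      also have "\<dots> = 4 / R * (w x * norm (\<Psi>h x))" by simp
      also have "\<dots> \<le> 4 / R * s x" using F1[of x] False R by (intro mult_left_mono) auto
      finally have 1: "w x * \<bar>\<zeta>' x \<bullet> \<Psi>h x\<bar> \<le> 4 / R * s x" .
      have "w x * (\<zeta> x * \<bar>dvg Gh x - V' x \<bullet> \<Psi>h x\<bar>)
          \<le> w x * (\<zeta> x * (\<delta> * M + \<tau>1 * conv (\<lambda>y. norm (\<Psi> y)) \<rho> x))"
        using div[of x] False wpos[of x] \<zeta>(3)[of x] by (intro mult_left_mono) auto
      also have "\<dots> = (\<delta> * M) * (\<zeta> x * w x) + \<tau>1 * (\<zeta> x * (w x * conv (\<lambda>y. norm (\<Psi> y)) \<rho> x))"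
        by (simp add: algebra_simps)
      also have "\<zeta> x * (w x * conv (\<lambda>y. norm (\<Psi> y)) \<rho> x) \<le> 1 * s x"
        using F2[of x] False \<zeta>(3,4)[of x] spos[of x]
        by (meson mult_left_mono mult_right_mono order_trans not_le)
      finally have 2: "w x * (\<zeta> x * \<bar>dvg Gh x - V' x \<bullet> \<Psi>h x\<bar>) \<le> (\<delta> * M) * (\<zeta> x * w x) + \<tau>1 * s x"
        using \<tau>12 by simp
      have "norm (w x *\<^sub>R (dvg G x - V' x \<bullet> \<Phi> x)) = w x * \<bar>\<zeta> x * (dvg Gh x - V' x \<bullet> \<Psi>h x) + \<zeta>' x \<bullet> \<Psi>h x\<bar>"
        using wpos[of x] by (simp add: e abs_mult)
      also have "\<dots> \<le> w x * (\<zeta> x * \<bar>dvg Gh x - V' x \<bullet> \<Psi>h x\<bar> + \<bar>\<zeta>' x \<bullet> \<Psi>h x\<bar>)"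
        using abs_triangle_ineq[of "\<zeta> x * (dvg Gh x - V' x \<bullet> \<Psi>h x)" "\<zeta>' x \<bullet> \<Psi>h x"] wpos[of x] \<zeta>(3)[of x]
        by (simp add: abs_mult)
      finally show ?thesis using 1 2 by (simp add: algebra_simps)
    qed
    moreover have c1: "Cc (\<lambda>x. (\<delta> * M) *\<^sub>R (\<zeta> x * w x))" "Cc (\<lambda>x. (\<tau>1 + 4 / R) *\<^sub>R s x)"
      by (intro Cc_scaleR_right \<zeta>w s continuous_intros)+
    moreover have "Cc (\<lambda>x. w x *\<^sub>R (dvg G x - V' x \<bullet> \<Phi> x))"
      unfolding dvg_def by (intro Cc_scaleR_right Cc_diff Cc_sum Cc_nth Cc_vgrad[OF \<Phi>] Cc_inner_right \<Phi> wc V'c)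
    ultimately have "l2norm lborel (\<lambda>x. w x *\<^sub>R (dvg G x - V' x \<bullet> \<Phi> x))
      \<le> l2norm lborel (\<lambda>x. (\<delta> * M) *\<^sub>R (\<zeta> x * w x) + (\<tau>1 + 4 / R) *\<^sub>R s x)"
      by (intro l2norm_mono Cc_square_integrable Cc_add) (auto intro: order_trans[OF _ abs_ge_self])
    also have "\<dots> \<le> l2norm lborel (\<lambda>x. (\<delta> * M) *\<^sub>R (\<zeta> x * w x)) + l2norm lborel (\<lambda>x. (\<tau>1 + 4 / R) *\<^sub>R s x)"
      by (intro l2norm_triangle Cc_square_integrable c1)
    also have "l2norm lborel (\<lambda>x. (\<delta> * M) *\<^sub>R (\<zeta> x * w x)) = \<delta> * M * W"
      using \<delta> M by (simp add: l2norm_scaleR W_def del: real_scaleR_def)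
    also have "l2norm lborel (\<lambda>x. (\<tau>1 + 4 / R) *\<^sub>R s x) = (\<tau>1 + 4 / R) * l2norm lborel s"
      using R \<tau>12 by (simp add: l2norm_scaleR del: real_scaleR_def)
    also have "(\<tau>1 + 4 / R) * l2norm lborel s \<le> (\<tau>1 + 4 / R) * \<kappa>"
      using R \<tau>12 sn by (intro mult_left_mono) auto
    also have "(\<tau>1 + 4 / R) * \<kappa> \<le> \<tau> / 4 + \<tau> / 2"
      using Rk Kpos by (simp add: \<tau>1_def distrib_right)
    finally show ?thesis using \<delta>(3) by simp
  qed

  \<comment> \<open>\<open>V\<close> vanishes on \<open>D\<close>, so the weight is 1 there and the
    unweighted energy on \<open>D\<close> is part of the weighted energy of the whole space.\<close>
  have energy: "(\<integral>x. indicator D x * (\<Sum>i\<in>UNIV. (norm (G i x))\<^sup>2) \<partial>lborel) \<le> (\<beta> + \<tau>)\<^sup>2 + \<tau>\<^sup>2"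
  proof -
    have gc: "continuous_on UNIV (\<lambda>x. \<Sum>i\<in>UNIV. (norm (G i x))\<^sup>2)"
      by (intro continuous_intros cgrad_cont_grad[OF vgradD[OF \<Phi>(2)]])
    have "(\<integral>x. indicator D x * (\<Sum>i\<in>UNIV. (norm (G i x))\<^sup>2) \<partial>lborel)
      \<le> (\<integral>x. exp (- V x) * (\<Sum>i\<in>UNIV. (norm (G i x))\<^sup>2) \<partial>lborel)"
    proof (rule integral_mono)
      show "integrable lborel (\<lambda>x. indicator D x * (\<Sum>i\<in>UNIV. (norm (G i x))\<^sup>2))"
        using integrable_indicator_continuous[OF borel_open[OF D(1)] D(2) gc] by simp
      show "integrable lborel (\<lambda>x. exp (- V x) * (\<Sum>i\<in>UNIV. (norm (G i x))\<^sup>2))"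
        by (intro Cc_integrable Cc_mult_right Cc_sum Cc_power2 Cc_norm Cc_vgrad[OF \<Phi>] continuous_intros Vc)
      show "indicator D x * (\<Sum>i\<in>UNIV. (norm (G i x))\<^sup>2) \<le> exp (- V x) * (\<Sum>i\<in>UNIV. (norm (G i x))\<^sup>2)" for x
        by (intro mult_right_mono sum_nonneg) (auto simp: indicator_def V(3))
    qed
    also have "\<dots> \<le> (l2norm lborel (\<lambda>x. w x *\<^sub>R curl G x))\<^sup>2 + (l2norm lborel (\<lambda>x. w x *\<^sub>R (dvg G x - V' x \<bullet> \<Phi> x)))\<^sup>2"
      using weighted_Gaffney[OF V(1,2) convex \<Phi>]
      by (simp add: l2norm_sq power_mult_distrib ww)
    also have "\<dots> \<le> (\<beta> + \<tau>)\<^sup>2 + \<tau>\<^sup>2"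
      by (intro add_mono power_mono curl_le div_le) auto
    finally show ?thesis .
  qed
  have main: "\<bar>\<integral>x. J x \<bullet> \<Phi> x \<partial>lborel\<bar> \<le> l2norm lborel J * (c * sqrt ((\<beta> + \<tau>)\<^sup>2 + \<tau>\<^sup>2))"
  proof -
    have "J x = 0" if "x \<notin> D" for x using J(3,4) that by blast
    from poincare_mean_free[OF borel_open[OF D(1)] D(2) P J(1) this J(5) \<Phi>]
    have "\<bar>\<integral>x. J x \<bullet> \<Phi> x \<partial>lborel\<bar> \<le> l2norm lborel J * (c * sqrt (\<integral>x. indicator D x * (\<Sum>i\<in>UNIV. (norm (G i x))\<^sup>2) \<partial>lborel))"
      by simp
    also have "\<dots> \<le> l2norm lborel J * (c * sqrt ((\<beta> + \<tau>)\<^sup>2 + \<tau>\<^sup>2))"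
      using energy P(2) by (intro mult_left_mono) auto
    finally show ?thesis .
  qed

  have w1: "w x = 1" if "x \<in> D" for x using V(3)[OF that] by (simp add: w_def)
  have cut: "\<bar>\<integral>x. J x \<bullet> (\<Psi>h x - \<Phi> x) \<partial>lborel\<bar> \<le> \<tau> * (l2norm lborel J * \<kappa>)"
  proof -
    have JN: "Cc (\<lambda>x. norm (J x))" by (rule Cc_norm[OF J(1)])
    have "norm (\<integral>x. J x \<bullet> (\<Psi>h x - \<Phi> x) \<partial>lborel) \<le> (\<integral>x. \<tau> * (norm (J x) \<bullet> s x) \<partial>lborel)"
    proof (rule Bochner_Integration.integral_norm_bound_integral)
      show "integrable lborel (\<lambda>x. J x \<bullet> (\<Psi>h x - \<Phi> x))"
        by (intro Cc_integrable Cc_inner_left J continuous_intros Cc_continuous[OF \<Psi>h(1)] Cc_continuous[OF \<Phi>(1)])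
      show "integrable lborel (\<lambda>x. \<tau> * (norm (J x) \<bullet> s x))"
        using Cc_integrable[OF Cc_inner_left[OF JN Cc_continuous[OF s]]] by simp
      show "norm (J x \<bullet> (\<Psi>h x - \<Phi> x)) \<le> \<tau> * (norm (J x) \<bullet> s x)" for x
      proof (cases "x \<in> D")
        case True
        then have "norm (\<Psi>h x) \<le> s x" using F1[of x] w1[OF True] r(1)[OF True] Rge(1) by simp
        moreover have "\<Psi>h x - \<Phi> x = (1 - \<zeta> x) *\<^sub>R \<Psi>h x" by (simp add: \<Phi>_def algebra_simps)
        ultimately have "norm (\<Psi>h x - \<Phi> x) \<le> \<tau> * s x"
          using \<zeta>D[OF True] \<zeta>(4)[of x] \<tau> spos[of x] by (auto intro!: mult_mono)
        then have "norm (J x) * norm (\<Psi>h x - \<Phi> x) \<le> norm (J x) * (\<tau> * s x)"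
          by (rule mult_left_mono) simp
        from order_trans[OF Cauchy_Schwarz_ineq2 this] show ?thesis by (simp add: mult.left_commute)
      next
        case False then have "J x = 0" using J(3,4) by blast
        then show ?thesis by simp
      qed
    qed
    also have "\<dots> = \<tau> * (\<integral>x. norm (J x) \<bullet> s x \<partial>lborel)" by simp
    also have "\<dots> \<le> \<tau> * (l2norm lborel (\<lambda>x. norm (J x)) * l2norm lborel s)"
      using l2_Cauchy_Schwarz[OF Cc_square_integrable[OF JN] Cc_square_integrable[OF s]] \<tau>
      by (intro mult_left_mono) auto
    also have "\<dots> \<le> \<tau> * (l2norm lborel J * \<kappa>)"
      using \<tau> sn by (simp add: l2norm_def[of _ "\<lambda>x. norm (J x)"] l2norm_def[of _ J] mult_left_mono)
    finally show ?thesis by simp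
  qed
  \<comment> \<open>The continuity of \<open>\<Psi>\<close> is not controlled, since
    \<open>u\<close> depends on \<open>\<delta>\<close> and thus on \<open>h\<close>. The mollifier
    is therefore moved to the fixed field \<open>J\<close>. The difference of \<open>J\<close> and
    its mollification is uniformly small and supported in \<open>D\<close>, where
    \<open>w = 1\<close>, so the weighted bound \<open>K\<close> on \<open>\<Psi>\<close>
    suffices.\<close>
  have moll: "\<bar>\<integral>x. J x \<bullet> (\<Psi> x - \<Psi>h x) \<partial>lborel\<bar> \<le> \<tau> * (3 * sqrt (measure lborel (cball (0::real^3) r)) * K)"
  proof -
    let ?m = "sqrt (measure lborel (cball (0::real^3) r))"
    define E where "E i y = J y $ i - conv (\<lambda>x. J x $ i) \<rho> y" for i y
    have E: "Cc (E i)" for i unfolding E_def by (intro Cc_diff Cc_nth J Cc_conv k)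
    have E0: "E i y = 0" if "y \<notin> D" for i y
    proof -
      have "\<bar>conv (\<lambda>x. J x $ i) \<rho> y - 0\<bar> \<le> 0"
      proof (rule conv_close[OF Cc_nth[OF J(1)] \<rho>(1)])
        fix x assume "norm (y - x) < h"
        then have "x \<notin> S" using d5(2) that h(7) by (force simp: dist_norm norm_minus_commute)
        then show "\<bar>J x $ i - 0\<bar> \<le> 0" using J(4) by simp
      qed
      moreover have "J y = 0" using J(3,4) that by blast
      ultimately show ?thesis by (simp add: E_def)
    qed
    have El: "\<bar>E i y\<bar> \<le> \<tau>" for i y
    proof -
      have "\<bar>conv (\<lambda>x. J x $ i) \<rho> y - J y $ i\<bar> \<le> \<tau>"
      proof (rule conv_close[OF Cc_nth[OF J(1)] \<rho>(1)])
        show "\<bar>J x $ i - J y $ i\<bar> \<le> \<tau>" if "norm (y - x) < h" for x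
          using component_le_norm_cart[of "J x - J y" i] d4(2)[of y x] that h(6) by simp
      qed
      then show ?thesis by (simp add: E_def abs_minus_commute)
    qed
    have En: "l2norm lborel (E i) \<le> \<tau> * ?m" for i
      by (rule l2norm_le_ball[OF E]) (use El E0 r(1) in \<open>force\<close>)+
    have comp: "\<bar>\<integral>x. J x $ i * (\<Psi> x $ i - \<Psi>h x $ i) \<partial>lborel\<bar> \<le> \<tau> * ?m * K" for i
    proof -
      have i1: "integrable lborel (\<lambda>x. J x $ i * \<Psi> x $ i)" "integrable lborel (\<lambda>x. J x $ i * \<Psi>h x $ i)"
        "integrable lborel (\<lambda>x. conv (\<lambda>x. J x $ i) \<rho> x * \<Psi> x $ i)"
        by (intro Cc_integrable Cc_mult_left Cc_nth J Cc_conv k Cc_continuous[OF Cc_nth] \<Psi> \<Psi>h)+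
      have "(\<integral>x. J x $ i * (\<Psi> x $ i - \<Psi>h x $ i) \<partial>lborel) = (\<integral>y. E i y * \<Psi> y $ i \<partial>lborel)"
        using i1 conv_swap[OF Cc_nth[OF \<Psi>] Cc_nth[OF J(1)] \<rho>(1), of i i]
        by (simp add: E_def right_diff_distrib left_diff_distrib \<Psi>h_def)
      also have "\<dots> = (\<integral>y. E i y \<bullet> (w y * \<Psi> y $ i) \<partial>lborel)"
        using w1 E0 by (intro Bochner_Integration.integral_cong) auto
      also have "\<bar>\<dots>\<bar> \<le> l2norm lborel (E i) * l2norm lborel (\<lambda>y. w y * \<Psi> y $ i)"
        by (intro l2_Cauchy_Schwarz Cc_square_integrable E Cc_mult_right Cc_nth \<Psi> wc)
      also have "l2norm lborel (\<lambda>y. w y * \<Psi> y $ i) \<le> l2norm lborel (\<lambda>x. w x *\<^sub>R \<Psi> x)"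
      proof (rule l2norm_mono)
        show "norm (w x * \<Psi> x $ i) \<le> norm (w x *\<^sub>R \<Psi> x)" for x
          using component_le_norm_cart[of "\<Psi> x" i] wpos[of x] by (simp add: abs_mult)
      qed (intro Cc_square_integrable Cc_mult_right Cc_nth \<Psi> wc w\<Psi>)+
      also have "\<dots> \<le> K" by (rule \<Psi>K)
      finally have b: "\<bar>\<integral>x. J x $ i * (\<Psi> x $ i - \<Psi>h x $ i) \<partial>lborel\<bar> \<le> l2norm lborel (E i) * K"
        by (simp add: mult_left_mono)
      show ?thesis
        by (rule order_trans[OF b mult_right_mono[OF En less_imp_le[OF Kpos(1)]]])
    qed
    have i2: "integrable lborel (\<lambda>x. J x $ i * (\<Psi> x $ i - \<Psi>h x $ i))" for i
      by (intro Cc_integrable Cc_mult_left Cc_nth J continuous_intros Cc_continuous[OF \<Psi>] Cc_continuous[OF \<Psi>h(1)])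
    have "(\<integral>x. J x \<bullet> (\<Psi> x - \<Psi>h x) \<partial>lborel) = (\<Sum>i\<in>UNIV. \<integral>x. J x $ i * (\<Psi> x $ i - \<Psi>h x $ i) \<partial>lborel)"
      using i2 by (simp add: inner_3 sum_3)
    then show ?thesis using comp[of 1] comp[of 2] comp[of 3] by (simp add: sum_3)
  qed
  have "(\<integral>x. J x \<bullet> A x \<partial>lborel) = (\<integral>x. J x \<bullet> \<Phi> x \<partial>lborel) + (\<integral>x. J x \<bullet> (\<Psi>h x - \<Phi> x) \<partial>lborel) + (\<integral>x. J x \<bullet> (\<Psi> x - \<Psi>h x) \<partial>lborel)"
  proof -
    have i: "integrable lborel (\<lambda>x. J x \<bullet> F x)" if "Cc F" for F
      by (intro Cc_integrable Cc_inner_left J Cc_continuous[OF that])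
    note ii = i[OF A(1)] i[OF Cc_cgrad[OF u(1,2)]] i[OF \<Psi>] i[OF \<Psi>h(1)] i[OF \<Phi>(1)]
    have "(\<integral>x. J x \<bullet> \<Psi> x \<partial>lborel) = (\<integral>x. J x \<bullet> A x \<partial>lborel)"
      using ii J(6)[OF u(1,2)] by (simp add: \<Psi>_def inner_diff_right)
    then show ?thesis using ii by (simp add: inner_diff_right)
  qed
  then show ?thesis using main cut moll by (simp add: \<kappa>_def algebra_simps)
qed

text \<open>\<open>\<beta>\<close>, \<open>K\<close> and \<open>r\<close> are independent of
  \<open>\<tau>\<close>, so all errors disappear as \<open>\<tau>\<close> tends to 0.\<close>

lemma weighted_estimate:
  assumes D: "open D" "bounded D" and P: "poincare D c" "0 \<le> c"
    and V: "cgrad V V'" "vgrad V' H" "\<And>x. x \<in> D \<Longrightarrow> V x = 0"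
    and convex: "\<And>x \<xi>. 0 \<le> (\<Sum>i\<in>UNIV. \<Sum>j\<in>UNIV. H i x $ j * (\<xi> $ i * \<xi> $ j))"
    and A: "Cc A" "vgrad A HA"
    and J: "Cc J" "compact S" "S \<subseteq> D" "\<And>x. x \<notin> S \<Longrightarrow> J x = 0" "\<And>i. (\<integral>x. J x $ i \<partial>lborel) = 0"
      "\<And>u u'. Cc u \<Longrightarrow> cgrad u u' \<Longrightarrow> (\<integral>x. J x \<bullet> u' x \<partial>lborel) = 0"
  shows "\<bar>\<integral>x. J x \<bullet> A x \<partial>lborel\<bar>
    \<le> l2norm lborel J * (c * sqrt (\<integral>x. exp (- V x) * (norm (curl HA x))\<^sup>2 \<partial>lborel))"
proof -
  obtain r where r: "0 < r" "\<And>x. x \<in> D \<Longrightarrow> norm x \<le> r"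
    using D(2) bounded_pos by metis
  define \<beta> where "\<beta> = sqrt (\<integral>x. exp (- V x) * (norm (curl HA x))\<^sup>2 \<partial>lborel)"
  define K where "K = sqrt ((\<integral>x. exp (- V x) * (norm (A x))\<^sup>2 \<partial>lborel) + 1)"
  define C where "C = l2norm lborel J * (sqrt 2 * K) + 3 * sqrt (measure lborel (cball (0::real^3) r)) * K"
  let ?f = "\<lambda>\<tau>. l2norm lborel J * (c * sqrt ((\<beta> + \<tau>)\<^sup>2 + \<tau>\<^sup>2)) + \<tau> * C"
  have "(?f \<longlongrightarrow> l2norm lborel J * (c * sqrt ((\<beta> + 0)\<^sup>2 + 0\<^sup>2)) + 0 * C) (at_right 0)"
    by (intro tendsto_intros)
  then have lim: "(?f \<longlongrightarrow> l2norm lborel J * (c * sqrt (\<beta>\<^sup>2))) (at_right 0)" by simp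
  have "\<forall>\<^sub>F \<tau> in at_right 0. \<bar>\<integral>x. J x \<bullet> A x \<partial>lborel\<bar> \<le> ?f \<tau>"
    unfolding eventually_at_right_field
    using weighted_estimate_approx[OF D P V convex A J r(2,1) \<beta>_def K_def]
    by (intro exI[of _ 1]) (auto simp: C_def)
  from tendsto_lowerbound[OF lim this] show ?thesis by (simp add: \<beta>_def)
qed

section \<open>From convex weights to convex domains\<close>

lemma convex_halfspaces:
  fixes D :: "'a::euclidean_space set"
  assumes "convex D"
  obtains a :: "nat \<Rightarrow> 'a" and b :: "nat \<Rightarrow> real"
  where "\<And>i x. x \<in> closure D \<Longrightarrow> x \<bullet> a i \<le> b i"
    "\<And>x. x \<notin> closure D \<Longrightarrow> \<exists>i. b i < x \<bullet> a i"
proof -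
  \<comment> \<open>By separation these open half-spaces cover the complement of the closure, and
    the Lindelof property extracts a sequence; finite sums over it then give potentials that see
    every exterior point eventually.\<close>
  define F where "F = {{x::'a. b < x \<bullet> a} |a b. \<forall>y\<in>closure D. y \<bullet> a \<le> b}"
  have "open U" if "U \<in> F" for U
    using that unfolding F_def by (auto intro!: open_Collect_less continuous_intros)
  then obtain F' where F': "F' \<subseteq> F" "countable F'" "\<Union>F' = \<Union>F"
    by (rule Lindelof)
  \<comment> \<open>The empty set, a degenerate half-space with normal 0, keeps the family nonempty
    as \<open>from_nat_into\<close> requires.\<close>
  define F'' where "F'' = insert {} F'"
  have "{} \<in> F" unfolding F_def by (intro CollectI exI[of _ 0]) auto
  then have F'': "F'' \<subseteq> F" "countable F''" "F'' \<noteq> {}" "\<Union>F'' = \<Union>F"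
    using F' by (auto simp: F''_def)
  have "\<forall>i. \<exists>a b. from_nat_into F'' i = {x. b < x \<bullet> a} \<and> (\<forall>y\<in>closure D. y \<bullet> a \<le> b)"
  proof
    fix i
    have "from_nat_into F'' i \<in> F" using from_nat_into[OF F''(3)] F''(1) by blast
    then show "\<exists>a b. from_nat_into F'' i = {x. b < x \<bullet> a} \<and> (\<forall>y\<in>closure D. y \<bullet> a \<le> b)"
      unfolding F_def by blast
  qed
  then obtain a b where ab: "\<And>i. from_nat_into F'' i = {x. b i < x \<bullet> a i}"
      "\<And>i. \<forall>y\<in>closure D. y \<bullet> a i \<le> b i" by metis
  show thesis
  proof
    show "x \<bullet> a i \<le> b i" if "x \<in> closure D" for i x using ab(2) that by blast
    fix x assume "x \<notin> closure D"
    then obtain p q where pq: "p \<bullet> x < q" "\<And>y. y \<in> closure D \<Longrightarrow> q < p \<bullet> y"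
      using separating_hyperplane_closed_point[of "closure D" x] assms by (auto simp: convex_closure)
    have "{z. - q < z \<bullet> (- p)} \<in> F"
      unfolding F_def using pq(2) by (intro CollectI exI[of _ "- p"] exI[of _ "- q"]) (force simp: inner_commute)
    moreover have "x \<in> {z. - q < z \<bullet> (- p)}" using pq(1) by (simp add: inner_commute)
    ultimately have "x \<in> \<Union>F''" using F''(4) by blast
    then have "x \<in> \<Union> (range (from_nat_into F''))" using F'' by simp
    then show "\<exists>i. b i < x \<bullet> a i" using ab(1) by auto
  qed
qed

lemma AE_not_frontier_convex:
  fixes D :: "'a::euclidean_space set"
  assumes "convex D" shows "AE x in lborel. x \<notin> frontier D"
proof -
  have "frontier D \<in> null_sets lborel"
    using negligible_convex_frontier[OF assms]
    by (auto simp: null_sets_completion_iff negligible_iff_null_sets)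
  then show ?thesis by (rule AE_not_in)
qed

text \<open>The convex set is approximated by penalisation: the potentials below vanish on \<open>D\<close> and
  tend to infinity outside its closure.\<close>

lemma convex_estimate:
  assumes D: "open D" "bounded D" "convex D" and P: "poincare D c" "0 \<le> c"
    and A: "Cc A" "vgrad A HA"
    and J: "Cc J" "compact S" "S \<subseteq> D" "\<And>x. x \<notin> S \<Longrightarrow> J x = 0" "\<And>i. (\<integral>x. J x $ i \<partial>lborel) = 0"
      "\<And>u u'. Cc u \<Longrightarrow> cgrad u u' \<Longrightarrow> (\<integral>x. J x \<bullet> u' x \<partial>lborel) = 0"
  shows "\<bar>\<integral>x. J x \<bullet> A x \<partial>lborel\<bar>
    \<le> l2norm lborel J * (c * l2norm lborel (\<lambda>x. indicator D x *\<^sub>R curl HA x))"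
proof -
  obtain a :: "nat \<Rightarrow> real^3" and b where ab: "\<And>i x. x \<in> closure D \<Longrightarrow> x \<bullet> a i \<le> b i"
    "\<And>x. x \<notin> closure D \<Longrightarrow> \<exists>i. b i < x \<bullet> a i"
    using convex_halfspaces[OF D(3)] by blast
  define p where "p i x = max 0 (x \<bullet> a i - b i)" for i x
  \<comment> \<open>Cubes of positive parts are C2 and convex, with Hessian a nonnegative
    combination of the squares of the linear forms given by \<open>a i\<close>. The index
    \<open>n\<close> counts the half-spaces and is also the penalty factor, so a single limit
    removes the whole exterior up to the null set \<open>frontier D\<close>.\<close>
  define V where "V n x = real n * (\<Sum>i<n. p i x ^ 3)" for n x
  define V' where "V' n x = real n *\<^sub>R (\<Sum>i<n. (3 * p i x ^ 2) *\<^sub>R a i)" for n x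
  define H where "H n j x = real n *\<^sub>R (\<Sum>i<n. (3 * a i $ j) *\<^sub>R ((2 * p i x) *\<^sub>R a i))" for n j x
  have q: "cgrad (\<lambda>x. x \<bullet> a i - b i) (\<lambda>x. a i)" for i
    using cgrad_diff[OF cgrad_inner cgrad_const] by fastforce
  have p3: "cgrad (\<lambda>x. p i x ^ 3) (\<lambda>x. (3 * p i x ^ 2) *\<^sub>R a i)" for i
    using cgrad_max_power[OF q[of i], of 1] by (simp add: p_def numeral_eq_Suc)
  have p2: "cgrad (\<lambda>x. p i x ^ 2) (\<lambda>x. (2 * p i x) *\<^sub>R a i)" for i
    using cgrad_max_power[OF q[of i], of 0] by (simp add: p_def numeral_eq_Suc)
  have V: "cgrad (V n) (V' n)" for n
    unfolding V_def V'_def by (intro cgrad_cmult cgrad_sum p3)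
  have H: "vgrad (V' n) (H n)" for n
  proof -
    have "cgrad (\<lambda>x. real n * (\<Sum>i<n. (3 * a i $ j) * p i x ^ 2)) (H n j)" for j
      unfolding H_def by (intro cgrad_cmult cgrad_sum p2)
    then show ?thesis unfolding vgrad_def V'_def by (simp add: mult_ac)
  qed
  have convex: "0 \<le> (\<Sum>j\<in>UNIV. \<Sum>k\<in>UNIV. H n j x $ k * (\<xi> $ j * \<xi> $ k))" for n x \<xi>
  proof -
    have "(\<Sum>j\<in>UNIV. \<Sum>k\<in>UNIV. H n j x $ k * (\<xi> $ j * \<xi> $ k))
        = real n * (\<Sum>i<n. 6 * p i x * (a i \<bullet> \<xi>)\<^sup>2)"
      by (simp add: H_def sum_3 inner_3 power2_eq_square sum_distrib_left sum_distrib_right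
          sum.distrib[symmetric] algebra_simps)
    also have "\<dots> \<ge> 0" by (intro mult_nonneg_nonneg sum_nonneg) (auto simp: p_def)
    finally show ?thesis .
  qed
  have p0: "p i x = 0" if "x \<in> closure D" for i x using ab(1)[OF that] by (simp add: p_def)
  have V0: "V n x = 0" if "x \<in> closure D" for n x
    using p0[OF that] by (simp add: V_def)
  have Vpos: "0 \<le> V n x" for n x unfolding V_def p_def by (intro mult_nonneg_nonneg sum_nonneg) auto
  define B where "B = curl HA"
  have B: "Cc B" unfolding B_def by (intro Cc_curl Cc_vgrad[OF A])
  have DB: "D \<in> sets borel" using D(1) by simp
  have lim: "(\<lambda>n. \<integral>x. exp (- V n x) * (norm (B x))\<^sup>2 \<partial>lborel)
      \<longlonglongrightarrow> (\<integral>x. indicator D x * (norm (B x))\<^sup>2 \<partial>lborel)"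
  proof (rule integral_dominated_convergence[where w = "\<lambda>x. (norm (B x))\<^sup>2"])
    show "integrable lborel (\<lambda>x. (norm (B x))\<^sup>2)" by (rule Cc_integrable[OF Cc_power2[OF Cc_norm[OF B]]])
    show "(\<lambda>x. indicator D x * (norm (B x))\<^sup>2) \<in> borel_measurable lborel"
      using DB Cc_borel[OF B] by simp
    show "(\<lambda>x. exp (- V n x) * (norm (B x))\<^sup>2) \<in> borel_measurable lborel" for n
    proof -
      have "V n \<in> borel_measurable borel"
        by (intro borel_measurable_continuous_onI cgrad_continuous[OF V])
      then show ?thesis using Cc_borel[OF B] by simp
    qed
    have "exp (- V n x) * (norm (B x))\<^sup>2 \<le> 1 * (norm (B x))\<^sup>2" for n x
      using Vpos[of n x] by (intro mult_right_mono) auto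
    then show "AE x in lborel. norm (exp (- V n x) * (norm (B x))\<^sup>2) \<le> (norm (B x))\<^sup>2" for n
      by simp
    show "AE x in lborel. (\<lambda>n. exp (- V n x) * (norm (B x))\<^sup>2) \<longlonglongrightarrow> indicator D x * (norm (B x))\<^sup>2"
      using AE_not_frontier_convex[OF D(3)]
    proof eventually_elim
      fix x assume x: "x \<notin> frontier D"
      have "(\<lambda>n. exp (- V n x)) \<longlonglongrightarrow> indicator D x"
      proof (cases "x \<in> D")
        case True
        then have "x \<in> closure D" using closure_subset by blast
        then show ?thesis using True by (simp add: V0)
      next
        case False
        then have "x \<notin> closure D" using x D(1) by (simp add: frontier_def interior_open)
        then obtain i where i: "b i < x \<bullet> a i" using ab(2) by blast
        then have pi: "0 < p i x ^ 3" by (simp add: p_def)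
        have "filterlim (\<lambda>n. p i x ^ 3 * real n) at_top sequentially"
          by (intro filterlim_tendsto_pos_mult_at_top[OF tendsto_const pi] filterlim_real_sequentially)
        moreover have "\<forall>\<^sub>F n in sequentially. p i x ^ 3 * real n \<le> V n x"
          using eventually_gt_at_top[of i]
        proof eventually_elim
          case (elim n)
          have "p i x ^ 3 \<le> (\<Sum>i<n. p i x ^ 3)"
            using elim by (intro member_le_sum) (auto simp: p_def)
          then show ?case unfolding V_def by (simp add: mult.commute mult_left_mono)
        qed
        ultimately have "filterlim (\<lambda>n. V n x) at_top sequentially" by (rule filterlim_at_top_mono)
        then have "(\<lambda>n. exp (- V n x)) \<longlonglongrightarrow> 0"
          by (intro filterlim_compose[OF exp_at_bot] filterlim_compose[OF filterlim_uminus_at_bot_at_top])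
        then show ?thesis using False by simp
      qed
      then show "(\<lambda>n. exp (- V n x) * (norm (B x))\<^sup>2) \<longlonglongrightarrow> indicator D x * (norm (B x))\<^sup>2"
        by (intro tendsto_mult tendsto_const)
    qed
  qed
  have lim2: "(\<lambda>n. l2norm lborel J * (c * sqrt (\<integral>x. exp (- V n x) * (norm (B x))\<^sup>2 \<partial>lborel)))
    \<longlonglongrightarrow> l2norm lborel J * (c * sqrt (\<integral>x. indicator D x * (norm (B x))\<^sup>2 \<partial>lborel))"
    by (intro tendsto_intros lim)
  have le: "\<bar>\<integral>x. J x \<bullet> A x \<partial>lborel\<bar> \<le> l2norm lborel J * (c * sqrt (\<integral>x. exp (- V n x) * (norm (B x))\<^sup>2 \<partial>lborel))" for n
    unfolding B_def
    by (rule weighted_estimate[OF D(1,2) P V H V0 convex A J]) (use closure_subset in blast)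
  have "\<bar>\<integral>x. J x \<bullet> A x \<partial>lborel\<bar> \<le> l2norm lborel J * (c * sqrt (\<integral>x. indicator D x * (norm (B x))\<^sup>2 \<partial>lborel))"
    by (rule LIMSEQ_le_const[OF lim2]) (use le in auto)
  also have "(\<lambda>x. indicator D x * (norm (B x))\<^sup>2) = (\<lambda>x. (norm (indicator D x *\<^sub>R curl HA x))\<^sup>2)"
    by (auto simp: B_def fun_eq_iff split: split_indicator)
  finally show ?thesis by (simp add: l2norm_def)
qed

section \<open>Vector potentials\<close>

text \<open>Unlike in \<open>cutoff_exists\<close>, the value 1 has to be attained on a whole ball,
  so that multiplying a field by the cutoff leaves its rotation on a bounded open set
  unchanged.\<close>

lemma plateau_exists:
  fixes r :: real
  obtains \<zeta> :: "'a::euclidean_space \<Rightarrow> real" and \<zeta>' where "cgrad \<zeta> \<zeta>'" "Cc \<zeta>" "\<And>x. norm x \<le> r \<Longrightarrow> \<zeta> x = 1"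
proof -
  let ?q = "\<lambda>x::'a. x \<bullet> x - r\<^sup>2"
  let ?p = "\<lambda>x. 1 - (max 0 (?q x)) ^ (0 + 2)"
  note q = cgrad_diff[OF cgrad_norm_sq[where 'a = 'a] cgrad_const[of "r\<^sup>2"]]
  note p = cgrad_diff[OF cgrad_const[of 1] cgrad_max_power[OF q, of 0]]
  obtain \<zeta>' where \<zeta>': "cgrad (\<lambda>x. (max 0 (?p x)) ^ (0 + 2)) \<zeta>'"
    using cgrad_max_power[OF p, of 0] by blast
  show thesis
  proof
    show "cgrad (\<lambda>x. (max 0 (?p x)) ^ (0 + 2)) \<zeta>'" by fact
    show "(max 0 (?p x)) ^ (0 + 2) = 1" if "norm x \<le> r" for x
    proof -
      have "?q x \<le> 0" using power_mono[OF that, of 2] by (simp add: power2_norm_eq_inner)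
      then show ?thesis by simp
    qed
    show "Cc (\<lambda>x. (max 0 (?p x)) ^ (0 + 2))"
    proof (rule CcI_radius[OF cgrad_continuous[OF \<zeta>'], where r = "\<bar>r\<bar> + 1"])
      fix x :: 'a assume x: "\<bar>r\<bar> + 1 < norm x"
      then have "(\<bar>r\<bar> + 1)\<^sup>2 \<le> (norm x)\<^sup>2" by (intro power_mono) auto
      then have "r\<^sup>2 + 1 \<le> x \<bullet> x" by (simp add: power2_norm_eq_inner power2_sum)
      then have "1 \<le> (max 0 (?q x)) ^ (0 + 2)" by (intro one_le_power) simp
      then have z: "max 0 (?p x) = 0" by (intro max_absorb1) linarith
      show "(max 0 (?p x)) ^ (0 + 2) = 0" by (subst z) simp
    qed
  qed
qed

text \<open>Differentiation under the integral sign; the chain rule along the ray contributes the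
  second factor \<open>s\<close>.\<close>

lemma cgrad_ray_average:
  fixes f :: "'a::euclidean_space \<Rightarrow> real"
  assumes f: "cgrad f g"
  shows "cgrad (\<lambda>x. integral {0..1} (\<lambda>s. s * f (x0 + s *\<^sub>R (x - x0))))
    (\<lambda>x. integral {0..1} (\<lambda>s. s\<^sup>2 *\<^sub>R g (x0 + s *\<^sub>R (x - x0))))"
proof (rule cgradI)
  let ?g = "\<lambda>x s. s\<^sup>2 *\<^sub>R g (x0 + s *\<^sub>R (x - x0))"
  have gc: "continuous_on UNIV (\<lambda>(x, s::real). ?g x s)"
    unfolding case_prod_beta
    by (intro continuous_intros continuous_on_compose2[OF cgrad_cont_grad[OF f, of UNIV]]) auto
  have gs: "continuous_on {0..1} (?g x)" for x
    by (intro continuous_intros continuous_on_compose2[OF cgrad_cont_grad[OF f, of UNIV]]) auto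
  show "continuous_on UNIV (\<lambda>x. integral {0..1} (?g x))"
    using integral_continuous_on_param[of UNIV 0 "1::real" ?g] continuous_on_subset[OF gc] by simp
  fix x
  have "((\<lambda>x. integral (cbox 0 1) (\<lambda>s. s * f (x0 + s *\<^sub>R (x - x0)))) has_derivative
     integral (cbox 0 1) (\<lambda>s. blinfun_inner_right (?g x s))) (at x within UNIV)"
  proof (rule leibniz_rule)
    show "((\<lambda>x. s * f (x0 + s *\<^sub>R (x - x0))) has_derivative blinfun_inner_right (?g x s)) (at x within UNIV)" for x s
    proof -
      have "((\<lambda>x. x0 + s *\<^sub>R (x - x0)) has_derivative (\<lambda>v. s *\<^sub>R v)) (at x)"
        by (auto intro!: derivative_eq_intros)
      from has_derivative_mult_right[OF has_derivative_compose[OF this cgradD[OF f]], of s]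
      show ?thesis by (rule has_derivative_eq_rhs) (simp add: fun_eq_iff power2_eq_square)
    qed
    show "(\<lambda>s. s * f (x0 + s *\<^sub>R (x - x0))) integrable_on cbox 0 1" for x
      by (intro integrable_continuous continuous_intros continuous_on_compose2[OF cgrad_continuous[OF f, of UNIV]]) auto
    show "continuous_on (UNIV \<times> cbox 0 1) (\<lambda>(x, s). blinfun_inner_right (?g x s))"
      using bounded_linear.continuous_on[OF bounded_linear_blinfun_inner_right gc]
      by (auto simp: case_prod_beta intro: continuous_on_subset)
  qed auto
  moreover have "integral (cbox 0 1) (\<lambda>s. blinfun_inner_right (?g x s)) = blinfun_inner_right (integral {0..1} (?g x))"
    using integral_linear[OF integrable_continuous_interval[OF gs] bounded_linear_blinfun_inner_right, of x]
    by (simp add: o_def)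
  ultimately show "((\<lambda>x. integral {0..1} (\<lambda>s. s * f (x0 + s *\<^sub>R (x - x0)))) has_derivative
     (\<lambda>v. integral {0..1} (?g x) \<bullet> v)) (at x)"
    by simp
qed

text \<open>The fundamental theorem of calculus for
  \<open>s\<^sup>2 * f (x0 + s *\<^sub>R z)\<close> on the unit interval; the factor
  \<open>s\<^sup>2\<close> removes the contribution at \<open>x0\<close>.\<close>

lemma ray_average_identity:
  fixes f :: "'a::euclidean_space \<Rightarrow> real"
  assumes f: "cgrad f g"
  shows "2 * integral {0..1} (\<lambda>s. s * f (x0 + s *\<^sub>R z)) + z \<bullet> integral {0..1} (\<lambda>s. s\<^sup>2 *\<^sub>R g (x0 + s *\<^sub>R z))
    = f (x0 + z)"
proof -
  let ?y = "\<lambda>s::real. x0 + s *\<^sub>R z"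
  have i1: "(\<lambda>s. s * f (?y s)) integrable_on {0..1}"
    by (intro integrable_continuous_interval continuous_intros continuous_on_compose2[OF cgrad_continuous[OF f, of UNIV]]) auto
  have i2: "(\<lambda>s. s\<^sup>2 *\<^sub>R g (?y s)) integrable_on {0..1}"
    by (intro integrable_continuous_interval continuous_intros continuous_on_compose2[OF cgrad_cont_grad[OF f, of UNIV]]) auto
  have "((\<lambda>s. s\<^sup>2 * f (?y s)) has_vector_derivative (2 * (s * f (?y s)) + z \<bullet> (s\<^sup>2 *\<^sub>R g (?y s)))) (at s within {0..1})" for s
  proof -
    have "(?y has_derivative (\<lambda>t. t *\<^sub>R z)) (at s within {0..1})"
      by (auto intro!: derivative_eq_intros)
    from has_derivative_compose[OF this cgradD[OF f]]
    have "((\<lambda>s. f (?y s)) has_derivative (\<lambda>t. t * (g (?y s) \<bullet> z))) (at s within {0..1})" by simp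
    then have d: "((\<lambda>s. f (?y s)) has_real_derivative g (?y s) \<bullet> z) (at s within {0..1})"
      by (simp add: has_field_derivative_def mult_commute_abs)
    have "((\<lambda>s. s\<^sup>2) has_real_derivative 2 * s) (at s within {0..1})"
      by (auto intro!: derivative_eq_intros)
    from DERIV_mult[OF this d] show ?thesis
      by (simp add: has_real_derivative_iff_has_vector_derivative inner_commute algebra_simps)
  qed
  then have "((\<lambda>s. 2 * (s * f (?y s)) + z \<bullet> (s\<^sup>2 *\<^sub>R g (?y s))) has_integral 1\<^sup>2 * f (?y 1) - 0\<^sup>2 * f (?y 0)) {0..1}"
    by (intro fundamental_theorem_of_calculus) auto
  then have e: "integral {0..1} (\<lambda>s. 2 * (s * f (?y s)) + z \<bullet> (s\<^sup>2 *\<^sub>R g (?y s))) = f (x0 + z)"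
    by (simp add: integral_unique)
  have i3: "(\<lambda>s. z \<bullet> (s\<^sup>2 *\<^sub>R g (?y s))) integrable_on {0..1}"
    and e3: "integral {0..1} (\<lambda>s. z \<bullet> (s\<^sup>2 *\<^sub>R g (?y s))) = z \<bullet> integral {0..1} (\<lambda>s. s\<^sup>2 *\<^sub>R g (?y s))"
    using integrable_linear[OF i2 bounded_linear_inner_right[of z]] integral_linear[OF i2 bounded_linear_inner_right[of z]]
    by (simp_all add: o_def)
  have i4: "(\<lambda>s. 2 * (s * f (?y s))) integrable_on {0..1}"
    using integrable_cmul[OF i1, of 2] by simp
  show ?thesis
    using e Henstock_Kurzweil_Integration.integral_add[OF i4 i3] by (simp only: e3) simp
qed

text \<open>The Poincare homotopy: for \<open>A x = (\<integral>\<^sub>0\<^sup>1 s F (x\<^sub>0 + s z) ds) \<times> z\<close> with \<open>z = x - x\<^sub>0\<close> one has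
  \<open>rot A = F - z \<integral>\<^sub>0\<^sup>1 s\<^sup>2 div F (x\<^sub>0 + s z) ds\<close>.\<close>

lemma vector_potential:
  assumes D: "open D" "convex D" "x0 \<in> D" "bounded D"
    and F: "vgrad F G" and div: "\<And>x. x \<in> D \<Longrightarrow> \<bar>dvg G x\<bar> \<le> e"
    and d: "\<And>x. x \<in> D \<Longrightarrow> norm (x - x0) \<le> d"
  obtains A HA where "Cc A" "vgrad A HA" "\<And>x. x \<in> D \<Longrightarrow> norm (curl HA x - F x) \<le> e * d"
proof -
  define Q where "Q x = (\<chi> i. integral {0..1} (\<lambda>s. s * F (x0 + s *\<^sub>R (x - x0)) $ i))" for x
  define L where "L i x = integral {0..1} (\<lambda>s. s\<^sup>2 *\<^sub>R G i (x0 + s *\<^sub>R (x - x0)))" for i x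
  have Q: "cgrad (\<lambda>x. Q x $ i) (L i)" for i
    using cgrad_ray_average[OF vgradD[OF F, of i], of x0] by (simp add: Q_def L_def[abs_def])
  have z: "cgrad (\<lambda>x. (x - x0) $ i) (\<lambda>x. axis i 1)" for i
  proof -
    have "(\<lambda>x. (x - x0) $ i) = (\<lambda>x. x \<bullet> axis i 1 - x0 $ i)" by (simp add: fun_eq_iff inner_axis_1)
    then show ?thesis
      using cgrad_diff[OF cgrad_inner[of "axis i (1::real)"] cgrad_const[of "x0 $ i"]] by simp
  qed
  define A where "A x = cross3 (Q x) (x - x0)" for x
  define M where "M i j x = Q x $ i *\<^sub>R axis j 1 + (x - x0) $ j *\<^sub>R L i x" for i j x
  have M: "cgrad (\<lambda>x. Q x $ i * (x - x0) $ j) (M i j)" for i j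
    unfolding M_def by (rule cgrad_mult[OF Q z])
  define N where "N i = (if i = 1 then (\<lambda>x. M 2 3 x - M 3 2 x) else if i = 2 then (\<lambda>x. M 3 1 x - M 1 3 x)
     else (\<lambda>x. M 1 2 x - M 2 1 x))" for i :: 3
  have A: "vgrad A N"
    unfolding vgrad_def
  proof
    fix i :: 3
    have "cgrad (\<lambda>x. Q x $ 2 * (x - x0) $ 3 - Q x $ 3 * (x - x0) $ 2) (\<lambda>x. M 2 3 x - M 3 2 x)"
      "cgrad (\<lambda>x. Q x $ 3 * (x - x0) $ 1 - Q x $ 1 * (x - x0) $ 3) (\<lambda>x. M 3 1 x - M 1 3 x)"
      "cgrad (\<lambda>x. Q x $ 1 * (x - x0) $ 2 - Q x $ 2 * (x - x0) $ 1) (\<lambda>x. M 1 2 x - M 2 1 x)"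
      by (intro cgrad_diff M)+
    then show "cgrad (\<lambda>x. A x $ i) (N i)"
      using exhaust_3[of i] by (elim disjE) (simp_all add: A_def N_def cross3_def)
  qed
  have ax: "axis i (1::real) $ j = (if i = j then 1 else 0)" for i j :: 3
    by (simp add: axis_def eq_commute)
  have curlN: "curl N x = F x - dvg L x *\<^sub>R (x - x0)" for x
  proof -
    have "2 * Q x $ i + (x - x0) \<bullet> L i x = F x $ i" for i
      using ray_average_identity[OF vgradD[OF F, of i], of x0 "x - x0"] by (simp add: Q_def L_def)
    from this[of 1] this[of 2] this[of 3] show ?thesis
      by (simp add: vec_eq_iff forall_3 N_def M_def ax dvg_def sum_3 inner_3 algebra_simps)
  qed
  have dvgL: "\<bar>dvg L x\<bar> \<le> e" if x: "x \<in> D" for x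
  proof -
    have i: "(\<lambda>s. s\<^sup>2 *\<^sub>R G i (x0 + s *\<^sub>R (x - x0))) integrable_on {0..1}" for i
      by (intro integrable_continuous_interval continuous_intros
          continuous_on_compose2[OF cgrad_cont_grad[OF vgradD[OF F], of UNIV]]) auto
    have c: "integral {0..1} (\<lambda>s. s\<^sup>2 *\<^sub>R G i (x0 + s *\<^sub>R (x - x0))) $ i = integral {0..1} (\<lambda>s. s\<^sup>2 * G i (x0 + s *\<^sub>R (x - x0)) $ i)"
      and ic: "(\<lambda>s. s\<^sup>2 * G i (x0 + s *\<^sub>R (x - x0)) $ i) integrable_on {0..1}" for i
      using integral_linear[OF i bounded_linear_vec_nth[of i], of i] integrable_linear[OF i bounded_linear_vec_nth[of i], of i]
      by (simp_all add: o_def)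
    have "dvg L x = integral {0..1} (\<lambda>s. s\<^sup>2 * dvg G (x0 + s *\<^sub>R (x - x0)))"
      using ic unfolding dvg_def L_def c sum_distrib_left
      by (subst Henstock_Kurzweil_Integration.integral_sum) auto
    also have "norm \<dots> \<le> e * (1 - 0)"
    proof (rule integral_bound)
      show "continuous_on {0..1} (\<lambda>s. s\<^sup>2 * dvg G (x0 + s *\<^sub>R (x - x0)))"
        unfolding dvg_def
        by (intro continuous_intros continuous_on_compose2[OF cgrad_cont_grad[OF vgradD[OF F], of UNIV]]) auto
      fix s :: real assume s: "s \<in> {0..1}"
      \<comment> \<open>Convexity keeps the segment from \<open>x0\<close> to \<open>x\<close>
        inside \<open>D\<close>, the only place where the divergence is controlled.\<close>
      have "(1 - s) *\<^sub>R x0 + s *\<^sub>R x \<in> D" using D(2,3) x s by (intro convexD) auto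
      then have "x0 + s *\<^sub>R (x - x0) \<in> D" by (simp add: algebra_simps)
      then have "\<bar>dvg G (x0 + s *\<^sub>R (x - x0))\<bar> \<le> e" by (rule div)
      moreover have "s\<^sup>2 \<le> 1" using s by (simp add: power_le_one)
      ultimately have "s\<^sup>2 * \<bar>dvg G (x0 + s *\<^sub>R (x - x0))\<bar> \<le> 1 * e" by (intro mult_mono) auto
      then show "norm (s\<^sup>2 * dvg G (x0 + s *\<^sub>R (x - x0))) \<le> e" by (simp add: abs_mult)
    qed simp
    finally show ?thesis by simp
  qed
  obtain r where r: "\<And>x. x \<in> D \<Longrightarrow> norm x \<le> r" using D(4) bounded_iff by metis
  obtain \<zeta> :: "real^3 \<Rightarrow> real" and \<zeta>' where \<zeta>: "cgrad \<zeta> \<zeta>'" "Cc \<zeta>" "\<And>x. norm x \<le> r \<Longrightarrow> \<zeta> x = 1"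
    using plateau_exists[where 'a = "real^3"] by blast
  \<comment> \<open>\<open>A\<close> is defined and C1 on the whole space but need not have bounded
    support. The cutoff is 1 on \<open>D\<close>, and \<open>D\<close> is open, so the derivatives
    there are unaffected.\<close>
  define HA where "HA i x = \<zeta> x *\<^sub>R N i x + A x $ i *\<^sub>R \<zeta>' x" for i x
  have "continuous_on UNIV A"
    using cgrad_continuous[OF vgradD[OF A]] by (subst continuous_on_componentwise) (auto simp: Basis_vec_def inner_axis)
  then have "Cc (\<lambda>x. \<zeta> x *\<^sub>R A x)" by (rule Cc_scaleR_left[OF \<zeta>(2)])
  moreover have \<zeta>A: "vgrad (\<lambda>x. \<zeta> x *\<^sub>R A x) HA" unfolding HA_def by (rule vgrad_scale[OF A \<zeta>(1)])
  moreover have "norm (curl HA x - F x) \<le> e * d" if x: "x \<in> D" for x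
  proof -
    have "HA i x = N i x" for i
      by (rule cgrad_cong_open[OF vgradD[OF \<zeta>A] vgradD[OF A] D(1) x]) (simp add: \<zeta> r)
    then have "curl HA x = curl N x" by (simp add: curl_def)
    then have "norm (curl HA x - F x) = \<bar>dvg L x\<bar> * norm (x - x0)" by (simp add: curlN)
    also have "\<dots> \<le> e * d" using dvgL[OF x] d[OF x] by (intro mult_mono) auto
    finally show ?thesis .
  qed
  ultimately show thesis by (rule that)
qed

section \<open>Test functions\<close>

lemma Ck_has_derivative: "Ck (Suc k) f \<Longrightarrow> (f has_derivative frechet_derivative f (at x)) (at x)"
  by (simp add: differentiable_on_def frechet_derivative_works)

lemma Ck_add_scaleR: "Ck k f \<Longrightarrow> Ck k g \<Longrightarrow> Ck k (\<lambda>x. f x + c *\<^sub>R g x)"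
proof (induction k arbitrary: f g)
  case 0
  then show ?case by (auto intro!: continuous_intros)
next
  case (Suc k)
  have d: "((\<lambda>x. f x + c *\<^sub>R g x) has_derivative
      (\<lambda>v. frechet_derivative f (at x) v + c *\<^sub>R frechet_derivative g (at x) v)) (at x)" for x
    by (intro has_derivative_add has_derivative_scaleR_right Ck_has_derivative[OF Suc.prems(1)]
        Ck_has_derivative[OF Suc.prems(2)])
  have "frechet_derivative (\<lambda>x. f x + c *\<^sub>R g x) (at x)
      = (\<lambda>v. frechet_derivative f (at x) v + c *\<^sub>R frechet_derivative g (at x) v)" for x
    using frechet_derivative_at[OF d] by metis
  moreover have "(\<lambda>x. f x + c *\<^sub>R g x) differentiable_on UNIV"
    using d by (auto simp: differentiable_on_def differentiable_def intro: has_derivative_at_withinI)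
  ultimately show ?case using Suc by simp
qed

lemma Ck_nth: "Ck k f \<Longrightarrow> Ck k (\<lambda>x. f x $ i :: real)"
  for f :: "'a::real_normed_vector \<Rightarrow> real^3"
proof (induction k arbitrary: f)
  case 0
  then show ?case by (auto intro!: continuous_intros)
next
  case (Suc k)
  have d: "((\<lambda>x. f x $ i) has_derivative (\<lambda>v. frechet_derivative f (at x) v $ i)) (at x)" for x
    by (rule bounded_linear.has_derivative[OF bounded_linear_vec_nth Ck_has_derivative[OF Suc.prems]])
  have "frechet_derivative (\<lambda>x. f x $ i) (at x) = (\<lambda>v. frechet_derivative f (at x) v $ i)" for x
    using frechet_derivative_at[OF d] by metis
  moreover have "(\<lambda>x. f x $ i) differentiable_on UNIV"
    using d by (auto simp: differentiable_on_def differentiable_def intro: has_derivative_at_withinI)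
  ultimately show ?case using Suc by simp
qed

lemma Ck_0: "Ck k (\<lambda>x. 0)"
proof (induction k)
  case (Suc k)
  have "frechet_derivative (\<lambda>x. 0) (at x) = (\<lambda>v. 0)" for x
    by (metis frechet_derivative_at has_derivative_const)
  then show ?case using Suc by simp
qed simp

lemma smooth_cgrad:
  fixes f :: "real^3 \<Rightarrow> real"
  assumes "smooth f" shows "cgrad f (grad f)"
proof (rule cgradI)
  have C: "Ck (Suc 0) f" using assms by (simp add: smooth_def)
  have d: "(f has_derivative frechet_derivative f (at x)) (at x)" for x
    by (rule Ck_has_derivative[OF C])
  show "(f has_derivative (\<lambda>v. grad f x \<bullet> v)) (at x)" for x
  proof -
    have l: "linear (frechet_derivative f (at x))" by (rule has_derivative_linear[OF d])
    have "frechet_derivative f (at x) v = grad f x \<bullet> v" for v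
    proof -
      have "v = (\<Sum>i\<in>UNIV. v $ i *\<^sub>R axis i 1)"
        by (simp add: vec_eq_iff axis_def if_distrib[of "\<lambda>t. _ * t"] cong: if_cong)
      from arg_cong[OF this, of "frechet_derivative f (at x)"]
      have "frechet_derivative f (at x) v = (\<Sum>i\<in>UNIV. v $ i *\<^sub>R frechet_derivative f (at x) (axis i 1))"
        by (simp only: linear_sum[OF l] linear_scale[OF l])
      then show ?thesis by (simp add: grad_def pd_def inner_vec_def mult.commute)
    qed
    then show ?thesis using d[of x] by (metis ext)
  qed
  show "continuous_on UNIV (grad f)"
    using C unfolding grad_def pd_def by (intro continuous_on_vec_lambda) simp
qed

lemma test_fun_Cc:
  assumes "test_fun \<Omega> f" shows "Cc (f :: real^3 \<Rightarrow> 'b::euclidean_space)"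
proof -
  have "Ck 0 f" "compact (closure {x. f x \<noteq> 0})" using assms by (auto simp: test_fun_def smooth_def simp del: Ck.simps)
  then show ?thesis
    unfolding Cc_def using bounded_subset[OF compact_imp_bounded closure_subset] by auto
qed

lemma test_fun_outside: "test_fun \<Omega> f \<Longrightarrow> x \<notin> \<Omega> \<Longrightarrow> f x = 0"
  unfolding test_fun_def using closure_subset[of "{x. f x \<noteq> 0}"] by blast

lemma test_fun_cgrad: "test_fun \<Omega> u \<Longrightarrow> cgrad u (grad u)"
  by (simp add: test_fun_def smooth_cgrad)

lemma test_fun_Cc_grad: "test_fun \<Omega> u \<Longrightarrow> Cc (grad u)"
  by (rule Cc_cgrad[OF test_fun_Cc test_fun_cgrad])

lemma test_fun_vgrad: "test_fun \<Omega> \<phi> \<Longrightarrow> vgrad \<phi> (\<lambda>i. grad (\<lambda>x. \<phi> x $ i))"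
  unfolding vgrad_def test_fun_def smooth_def by (auto intro!: smooth_cgrad Ck_nth simp: smooth_def)

lemma rot_eq_curl: "rot \<phi> = curl (\<lambda>i. grad (\<lambda>x. \<phi> x $ i))"
  by (simp add: fun_eq_iff rot_def curl_def grad_def)

lemma test_fun_Cc_rot: "test_fun \<Omega> \<phi> \<Longrightarrow> Cc (rot \<phi>)"
  unfolding rot_eq_curl by (intro Cc_curl Cc_vgrad[OF test_fun_Cc test_fun_vgrad])

lemma cgrad_zero_off_support:
  assumes "cgrad f g" "x \<notin> closure {x. f x \<noteq> 0}"
  shows "g x = 0"
proof (rule cgrad_zero_open[OF assms(1)])
  show "open (- closure {x. f x \<noteq> 0})" by (simp add: open_Compl)
  show "f y = 0" if "y \<in> - closure {x. f x \<noteq> 0}" for y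
    using that closure_subset[of "{x. f x \<noteq> 0}"] by auto
qed (use assms in auto)

lemma test_fun_grad_outside:
  assumes "test_fun \<Omega> u" "x \<notin> \<Omega>" shows "grad u x = 0"
  using cgrad_zero_off_support[OF test_fun_cgrad[OF assms(1)], of x] assms
  unfolding test_fun_def by blast

lemma rot_zero_off_support:
  assumes "test_fun \<Omega> \<phi>" "x \<notin> closure {x. \<phi> x \<noteq> 0}" shows "rot \<phi> x = 0"
proof -
  have "grad (\<lambda>x. \<phi> x $ i) x = 0" for i
  proof (rule cgrad_zero_off_support[OF vgradD[OF test_fun_vgrad[OF assms(1)]]])
    have "closure {x. \<phi> x $ i \<noteq> 0} \<subseteq> closure {x. \<phi> x \<noteq> 0}" by (intro closure_mono) auto
    then show "x \<notin> closure {x. \<phi> x $ i \<noteq> 0}" using assms(2) by blast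
  qed
  then show ?thesis unfolding rot_eq_curl by (simp add: vec_eq_iff forall_3)
qed

lemma test_fun_rot_outside:
  assumes "test_fun \<Omega> \<phi>" "x \<notin> \<Omega>" shows "rot \<phi> x = 0"
  using rot_zero_off_support[OF assms(1), of x] assms unfolding test_fun_def by blast

lemma test_fun_0: "test_fun \<Omega> (\<lambda>x. 0)"
  by (simp add: test_fun_def smooth_def Ck_0)

lemma test_fun_add_scaleR:
  assumes "test_fun \<Omega> f" "test_fun \<Omega> g" shows "test_fun \<Omega> (\<lambda>x. f x + c *\<^sub>R g x)"
proof -
  have "closure {x. f x + c *\<^sub>R g x \<noteq> 0} \<subseteq> closure ({x. f x \<noteq> 0} \<union> {x. g x \<noteq> 0})"
    by (rule closure_mono) auto
  also have "\<dots> = closure {x. f x \<noteq> 0} \<union> closure {x. g x \<noteq> 0}" by (rule closure_Un)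
  finally have s: "closure {x. f x + c *\<^sub>R g x \<noteq> 0} \<subseteq> closure {x. f x \<noteq> 0} \<union> closure {x. g x \<noteq> 0}" .
  have "compact (closure {x. f x \<noteq> 0} \<union> closure {x. g x \<noteq> 0})"
    using assms by (auto simp: test_fun_def)
  then have "compact (closure {x. f x + c *\<^sub>R g x \<noteq> 0})"
    using s by (meson closed_closure compact_imp_bounded bounded_subset compact_eq_bounded_closed)
  then show ?thesis
    using s assms by (auto simp: test_fun_def smooth_def intro!: Ck_add_scaleR)
qed

lemma grad_add_scaleR:
  assumes "test_fun \<Omega> f" "test_fun \<Omega> g"
  shows "grad (\<lambda>x. f x + c *\<^sub>R g x) = (\<lambda>x. grad f x + c *\<^sub>R grad g x)"
proof (rule cgrad_unique[OF test_fun_cgrad[OF test_fun_add_scaleR[OF assms]]])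
  show "cgrad (\<lambda>x. f x + c *\<^sub>R g x) (\<lambda>x. grad f x + c *\<^sub>R grad g x)"
    using cgrad_add[OF test_fun_cgrad[OF assms(1)] cgrad_cmult[OF test_fun_cgrad[OF assms(2)]]] by simp
qed

lemma grad_0: "grad (\<lambda>x. 0) = (\<lambda>x. 0)"
  by (rule cgrad_unique[OF test_fun_cgrad[OF test_fun_0] cgrad_const])

text \<open>The shifted kernel may be used as a test function only if its ball fits into the domain,
  which confines information on the mollified divergence to points at some distance from the
  boundary.\<close>

lemma test_fun_mollifier:
  assumes m: "mollifier h \<rho>" and s: "smooth (\<lambda>y. \<rho> (x - y))" and c: "cball x h \<subseteq> \<Omega>"
  shows "test_fun \<Omega> (\<lambda>y. \<rho> (x - y))"
proof -
  have "\<rho> (x - y) = 0" if "h < norm (x - y)" for y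
    using m that by (simp add: mollifier_def)
  then have "{y. \<rho> (x - y) \<noteq> 0} \<subseteq> cball x h"
    by (force simp: dist_norm not_le[symmetric])
  then have "closure {y. \<rho> (x - y) \<noteq> 0} \<subseteq> cball x h"
    by (intro closure_minimal) auto
  then show ?thesis
    using c s unfolding test_fun_def
    by (meson bounded_cball bounded_subset closed_closure compact_eq_bounded_closed subset_trans)
qed

section \<open>The Poincare inequality on scaled domains\<close>

lemma lebesgue_on_integral_eq:
  fixes f :: "'a::euclidean_space \<Rightarrow> 'b::euclidean_space"
  assumes "open \<Omega>" "f \<in> borel_measurable borel"
  shows "integral\<^sup>L (lebesgue_on \<Omega>) f = (\<integral>x. indicator \<Omega> x *\<^sub>R f x \<partial>lborel)"
proof -
  have "\<Omega> \<in> sets borel" using assms(1) by simp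
  then have "(\<lambda>x. indicator \<Omega> x *\<^sub>R f x) \<in> borel_measurable borel" using assms(2) by simp
  then show ?thesis
    using assms(1) by (simp add: integral_restrict_space integral_completion)
qed

lemma lebesgue_on_integrable_continuous:
  fixes f :: "'a::euclidean_space \<Rightarrow> 'b::euclidean_space"
  assumes "open \<Omega>" "bounded \<Omega>" "continuous_on UNIV f"
  shows "integrable (lebesgue_on \<Omega>) f"
proof -
  have "integrable lborel (\<lambda>x. indicator \<Omega> x *\<^sub>R f x)"
    using assms by (intro integrable_indicator_continuous) auto
  then show ?thesis
    using assms(1) by (simp add: integrable_restrict_space integrable_completion)
qed

lemma L2_eq: "L2 \<Omega> f = square_integrable (lebesgue_on \<Omega>) f"
  by (simp add: L2_def square_integrable_def)

lemma L2norm_eq: "L2norm \<Omega> f = l2norm (lebesgue_on \<Omega>) f"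
  by (simp add: L2norm_def l2norm_def)

lemma L2_continuous:
  fixes f :: "real^3 \<Rightarrow> 'b::euclidean_space"
  assumes "open \<Omega>" "bounded \<Omega>" "continuous_on UNIV f"
  shows "L2 \<Omega> f"
  unfolding L2_def
  by (intro conjI borel_measurable_integrable lebesgue_on_integrable_continuous assms continuous_intros)

lemma integral_lebesgue_on_Cc:
  fixes f :: "'a::euclidean_space \<Rightarrow> 'b::euclidean_space"
  assumes "open \<Omega>" "Cc f" "\<And>x. x \<notin> \<Omega> \<Longrightarrow> f x = 0"
  shows "integral\<^sup>L (lebesgue_on \<Omega>) f = integral\<^sup>L lborel f"
proof -
  have "(\<lambda>x. indicator \<Omega> x *\<^sub>R f x) = f" using assms(3) by (auto simp: fun_eq_iff split: split_indicator)
  then show ?thesis using lebesgue_on_integral_eq[OF assms(1) Cc_borel[OF assms(2)]] by simp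
qed

lemma L2norm_Cc:
  fixes f :: "real^3 \<Rightarrow> 'b::euclidean_space"
  assumes "open \<Omega>" "Cc f" "\<And>x. x \<notin> \<Omega> \<Longrightarrow> f x = 0"
  shows "L2norm \<Omega> f = l2norm lborel f"
  unfolding L2norm_def l2norm_def
  using integral_lebesgue_on_Cc[OF assms(1) Cc_power2[OF Cc_norm[OF assms(2)]]] assms(3) by simp

lemma weak_grad_continuous:
  assumes \<Omega>: "open \<Omega>" "bounded \<Omega>" and f: "cgrad f f'"
  shows "weak_grad \<Omega> f f'"
  unfolding weak_grad_def
proof (intro conjI allI impI)
  show "L2 \<Omega> f" "L2 \<Omega> f'"
    by (intro L2_continuous \<Omega> cgrad_continuous[OF f] cgrad_cont_grad[OF f])+
  fix \<psi> :: "real^3 \<Rightarrow> real^3" assume \<psi>: "test_fun \<Omega> \<psi>"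
  let ?g = "\<lambda>i. grad (\<lambda>y. \<psi> y $ i)"
  note C = test_fun_Cc[OF \<psi>] and G = test_fun_vgrad[OF \<psi>]
  have fc: "continuous_on UNIV f" "continuous_on UNIV (\<lambda>x. f' x $ i)" for i
    using cgrad_continuous[OF f] by (auto intro!: continuous_intros cgrad_cont_grad[OF f])
  have gz: "?g i x = 0" if "x \<notin> \<Omega>" for x i
  proof (rule cgrad_zero_off_support[OF vgradD[OF G]])
    have "closure {x. \<psi> x $ i \<noteq> 0} \<subseteq> closure {x. \<psi> x \<noteq> 0}" by (intro closure_mono) auto
    then show "x \<notin> closure {x. \<psi> x $ i \<noteq> 0}" using that \<psi> unfolding test_fun_def by blast
  qed
  have p: "pd (\<lambda>y. \<psi> y $ i) i x = ?g i x $ i" for i x by (simp add: grad_def)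
  have i1: "Cc (\<lambda>x. f x * ?g i x $ i)" for i
    by (intro Cc_mult_right Cc_nth Cc_vgrad[OF C G] fc)
  have i2: "Cc (\<lambda>x. f' x $ i * \<psi> x $ i)" for i
    by (intro Cc_mult_right Cc_nth C fc)
  have "integral\<^sup>L (lebesgue_on \<Omega>) (\<lambda>x. f x * (\<Sum>i\<in>UNIV. pd (\<lambda>y. \<psi> y $ i) i x))
      = (\<integral>x. (\<Sum>i\<in>UNIV. f x * ?g i x $ i) \<partial>lborel)"
    unfolding p sum_distrib_left
    by (intro integral_lebesgue_on_Cc \<Omega> Cc_sum i1) (simp add: gz)
  also have "\<dots> = (\<Sum>i\<in>UNIV. \<integral>x. f x * ?g i x $ i \<partial>lborel)"
    by (intro Bochner_Integration.integral_sum Cc_integrable i1)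
  also have "\<dots> = (\<Sum>i\<in>UNIV. - (\<integral>x. f' x $ i * \<psi> x $ i \<partial>lborel))"
  proof (rule sum.cong[OF refl])
    fix i :: 3
    show "(\<integral>x. f x * ?g i x $ i \<partial>lborel) = - (\<integral>x. f' x $ i * \<psi> x $ i \<partial>lborel)"
      using integral_by_parts[OF Cc_nth[OF C] vgradD[OF G] f, of i "axis i 1"]
      by (simp add: inner_axis_1 mult.commute)
  qed
  also have "\<dots> = - (\<integral>x. (\<Sum>i\<in>UNIV. f' x $ i * \<psi> x $ i) \<partial>lborel)"
    by (simp add: sum_negf Cc_integrable i2)
  also have "(\<integral>x. (\<Sum>i\<in>UNIV. f' x $ i * \<psi> x $ i) \<partial>lborel) = integral\<^sup>L (lebesgue_on \<Omega>) (\<lambda>x. f' x \<bullet> \<psi> x)"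
    unfolding inner_vec_def inner_real_def
    by (rule integral_lebesgue_on_Cc[symmetric]) (use \<Omega> Cc_sum[OF i2] test_fun_outside[OF \<psi>] in auto)
  finally show "integral\<^sup>L (lebesgue_on \<Omega>) (\<lambda>x. f x * (\<Sum>i\<in>UNIV. pd (\<lambda>y. \<psi> y $ i) i x))
        = - integral\<^sup>L (lebesgue_on \<Omega>) (\<lambda>x. f' x \<bullet> \<psi> x)" .
qed

text \<open>The mean value of \<open>f\<close> serves as the constant; it makes sense because a
  nonempty open set has positive measure. C1 functions have their gradient as weak gradient, so the
  weak inequality applies to \<open>f - a\<close>.\<close>

lemma poincare_of_weak:
  assumes \<Omega>: "open \<Omega>" "bounded \<Omega>" "\<Omega> \<noteq> {}"
    and P: "\<And>u g. weak_grad \<Omega> u g \<Longrightarrow> integral\<^sup>L (lebesgue_on \<Omega>) u = 0 \<Longrightarrow> L2norm \<Omega> u \<le> c * L2norm \<Omega> g"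
    and c: "0 \<le> c"
  shows "poincare \<Omega> c"
  unfolding poincare_def
proof (intro allI impI)
  fix f :: "real^3 \<Rightarrow> real" and f' assume f: "Cc f" "cgrad f f'"
  let ?m = "measure lborel \<Omega>"
  define a where "a = (\<integral>x. indicator \<Omega> x * f x \<partial>lborel) / ?m"
  have fin: "emeasure lborel \<Omega> < \<infinity>" by (rule emeasure_bounded_finite[OF \<Omega>(2)])
  have "?m \<noteq> 0"
  proof
    assume "?m = 0"
    then have "emeasure lborel \<Omega> = 0" using fin by (auto simp: measure_def enn2real_eq_0_iff)
    then have "\<Omega> \<in> null_sets lborel" using \<Omega>(1) by auto
    then have "negligible \<Omega>" by (simp add: negligible_iff_null_sets null_sets_completionI)
    then show False using open_not_negligible \<Omega> by blast
  qed
  have g: "cgrad (\<lambda>x. f x - a) f'" using cgrad_diff[OF f(2) cgrad_const] by simp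
  have fc: "continuous_on UNIV f" using cgrad_continuous[OF f(2)] .
  have bm: "f \<in> borel_measurable borel" "f' \<in> borel_measurable borel"
    using fc cgrad_cont_grad[OF f(2)] by (auto intro: borel_measurable_continuous_onI)
  have "integral\<^sup>L (lebesgue_on \<Omega>) (\<lambda>x. f x - a) = (\<integral>x. indicator \<Omega> x * f x - a * indicator \<Omega> x \<partial>lborel)"
    using lebesgue_on_integral_eq[OF \<Omega>(1), of "\<lambda>x. f x - a"] bm by (simp add: algebra_simps)
  also have "\<dots> = (\<integral>x. indicator \<Omega> x * f x \<partial>lborel) - a * ?m"
    using integrable_indicator_continuous[OF borel_open[OF \<Omega>(1)] \<Omega>(2) fc] fin \<Omega>(1) by simp
  also have "\<dots> = 0" using \<open>?m \<noteq> 0\<close> by (simp add: a_def)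
  finally have "L2norm \<Omega> (\<lambda>x. f x - a) \<le> c * L2norm \<Omega> f'"
    by (intro P weak_grad_continuous \<Omega> g)
  then have "(L2norm \<Omega> (\<lambda>x. f x - a))\<^sup>2 \<le> (c * L2norm \<Omega> f')\<^sup>2"
    by (rule power_mono) (simp add: L2norm_eq)
  then have "(\<integral>x. indicator \<Omega> x * (f x - a)\<^sup>2 \<partial>lborel) \<le> c\<^sup>2 * (\<integral>x. indicator \<Omega> x * (norm (f' x))\<^sup>2 \<partial>lborel)"
    using bm lebesgue_on_integral_eq[OF \<Omega>(1), of "\<lambda>x. (f x - a)\<^sup>2"]
      lebesgue_on_integral_eq[OF \<Omega>(1), of "\<lambda>x. (norm (f' x))\<^sup>2"]
    by (simp add: power_mult_distrib L2norm_eq l2norm_sq)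
  then show "\<exists>a. (\<integral>x. indicator \<Omega> x * (f x - a)\<^sup>2 \<partial>lborel) \<le> c\<^sup>2 * (\<integral>x. indicator \<Omega> x * (norm (f' x))\<^sup>2 \<partial>lborel)" ..
qed

lemma lborel_integral_affine:
  fixes f :: "'a::euclidean_space \<Rightarrow> real"
  assumes "f \<in> borel_measurable borel" "0 < t"
  shows "integral\<^sup>L lborel f = t ^ DIM('a) * (\<integral>x. f (b + t *\<^sub>R x) \<partial>lborel)"
proof -
  have "integral\<^sup>L lborel f = integral\<^sup>L (density (distr lborel borel (\<lambda>x. b + t *\<^sub>R x)) (\<lambda>_. ennreal (t ^ DIM('a)))) f"
    using lborel_affine[of t b] assms(2) by (simp add: ennreal_power)
  also have "\<dots> = (\<integral>x. t ^ DIM('a) *\<^sub>R f x \<partial>distr lborel borel (\<lambda>x. b + t *\<^sub>R x))"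
    using assms by (intro integral_density) auto
  also have "\<dots> = (\<integral>x. t ^ DIM('a) *\<^sub>R f (b + t *\<^sub>R x) \<partial>lborel)"
    using assms by (intro integral_distr) auto
  finally show ?thesis by simp
qed

lemma Cc_affine:
  assumes "Cc f" "0 < t" shows "Cc (\<lambda>x. f (b + t *\<^sub>R x))"
proof -
  obtain r where r: "\<And>x. r < norm x \<Longrightarrow> f x = 0" using Cc_radius[OF assms(1)] by metis
  show ?thesis
  proof (rule CcI_radius[where r = "(r + norm b) / t"])
    show "continuous_on UNIV (\<lambda>x. f (b + t *\<^sub>R x))"
      by (intro continuous_on_compose2[OF Cc_continuous[OF assms(1), of UNIV]] continuous_intros) auto
    fix x :: 'a assume "(r + norm b) / t < norm x"
    then have "r + norm b < norm (t *\<^sub>R x)" using assms(2) by (simp add: field_simps)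
    also have "\<dots> \<le> norm (b + t *\<^sub>R x) + norm b"
      using norm_triangle_ineq4[of "b + t *\<^sub>R x" b] by simp
    finally show "f (b + t *\<^sub>R x) = 0" by (intro r) simp
  qed
qed

text \<open>The volume factors on both sides agree, while the gradient of the rescaled function
  gains a factor \<open>t\<close>; for \<open>t \<le> 1\<close> the constant does not grow.\<close>

lemma poincare_affine:
  fixes \<Omega> :: "'a::euclidean_space set"
  assumes \<Omega>: "open \<Omega>" and P: "poincare \<Omega> c" and t: "0 < t" "t \<le> 1"
  shows "poincare ((\<lambda>x. b + t *\<^sub>R x) ` \<Omega>) c"
  unfolding poincare_def
proof (intro allI impI)
  fix f :: "'a \<Rightarrow> real" and f' assume f: "Cc f" "cgrad f f'"
  let ?D = "(\<lambda>x. b + t *\<^sub>R x) ` \<Omega>"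
  have D: "?D \<in> sets borel" using open_affinity[OF \<Omega>, of t b] t by simp
  have ind: "indicator ?D (b + t *\<^sub>R x) = (indicator \<Omega> x :: real)" for x
    using t by (auto simp: indicator_def)
  have bm: "f \<in> borel_measurable borel" "f' \<in> borel_measurable borel"
    using cgrad_continuous[OF f(2)] cgrad_cont_grad[OF f(2)] by (auto intro: borel_measurable_continuous_onI)
  obtain a where a: "(\<integral>x. indicator \<Omega> x * (f (b + t *\<^sub>R x) - a)\<^sup>2 \<partial>lborel)
      \<le> c\<^sup>2 * (\<integral>x. indicator \<Omega> x * (norm (t *\<^sub>R f' (b + t *\<^sub>R x)))\<^sup>2 \<partial>lborel)"
    using P Cc_affine[OF f(1) t(1), of b] cgrad_affine[OF f(2), of b t] unfolding poincare_def by blast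
  let ?I = "\<integral>x. indicator \<Omega> x * (norm (f' (b + t *\<^sub>R x)))\<^sup>2 \<partial>lborel"
  have "(\<integral>x. indicator \<Omega> x * (norm (t *\<^sub>R f' (b + t *\<^sub>R x)))\<^sup>2 \<partial>lborel) = t\<^sup>2 * ?I"
    by (subst integral_mult_right_zero[symmetric]) (simp add: power_mult_distrib mult_ac)
  also have "\<dots> \<le> 1 * ?I"
    using t by (intro mult_right_mono Bochner_Integration.integral_nonneg) (auto simp: power_le_one)
  finally have le: "(\<integral>x. indicator \<Omega> x * (f (b + t *\<^sub>R x) - a)\<^sup>2 \<partial>lborel) \<le> c\<^sup>2 * ?I"
    using order_trans[OF a mult_left_mono[of _ _ "c\<^sup>2"]] by simp
  have 1: "(\<integral>x. indicator ?D x * (f x - a)\<^sup>2 \<partial>lborel)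
      = t ^ DIM('a) * (\<integral>x. indicator \<Omega> x * (f (b + t *\<^sub>R x) - a)\<^sup>2 \<partial>lborel)"
    using lborel_integral_affine[of "\<lambda>x. indicator ?D x * (f x - a)\<^sup>2" t b] bm D t by (simp add: ind)
  have 2: "(\<integral>x. indicator ?D x * (norm (f' x))\<^sup>2 \<partial>lborel) = t ^ DIM('a) * ?I"
    using lborel_integral_affine[of "\<lambda>x. indicator ?D x * (norm (f' x))\<^sup>2" t b] bm D t by (simp add: ind)
  have "t ^ DIM('a) * (\<integral>x. indicator \<Omega> x * (f (b + t *\<^sub>R x) - a)\<^sup>2 \<partial>lborel) \<le> t ^ DIM('a) * (c\<^sup>2 * ?I)"
    using le t by (intro mult_left_mono) auto
  then show "\<exists>a. (\<integral>x. indicator ?D x * (f x - a)\<^sup>2 \<partial>lborel)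
      \<le> c\<^sup>2 * (\<integral>x. indicator ?D x * (norm (f' x))\<^sup>2 \<partial>lborel)"
    unfolding 1[symmetric] 2 by (intro exI[of _ a]) (simp add: mult.left_commute)
qed

section \<open>Approximation of test fields by gradients\<close>

lemma quadratic_bound:
  fixes N p e :: real
  assumes "N\<^sup>2 \<le> p * N + e" "0 \<le> p" "0 \<le> e" "0 \<le> N"
  shows "N \<le> p + sqrt e"
proof (rule ccontr)
  assume "\<not> N \<le> p + sqrt e"
  then have "sqrt e < N - p" by simp
  moreover have "sqrt e < N" using calculation assms(2) by simp
  ultimately have "sqrt e * sqrt e < N * (N - p)"
    using real_sqrt_ge_zero[OF assms(3)] by (intro mult_strict_mono) linarith+
  then show False using assms by (simp add: power2_eq_square algebra_simps)
qed

lemma l2norm_mollify_le: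
  assumes F: "Cc F" and m: "mollifier h \<rho>"
  shows "l2norm lborel (mollify \<rho> F) \<le> l2norm lborel F"
proof -
  have k: "Cc \<rho>" using m by (simp add: mollifier_def)
  have "(\<integral>x. (norm (mollify \<rho> F x))\<^sup>2 \<partial>lborel) \<le> (\<integral>x. conv (\<lambda>y. (norm (F y))\<^sup>2) \<rho> x \<partial>lborel)"
    by (intro integral_mono Cc_integrable Cc_power2 Cc_norm Cc_mollify F k Cc_conv norm_mollify_le[OF F m])
  also have "\<dots> = (\<integral>x. (norm (F x))\<^sup>2 \<partial>lborel)"
    by (rule integral_conv[OF Cc_power2[OF Cc_norm[OF F]] m])
  finally show ?thesis unfolding l2norm_def by (rule real_sqrt_le_mono)
qed

lemma mollify_swap:
  assumes F: "Cc F" and E: "Cc E" and m: "mollifier h \<rho>"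
  shows "(\<integral>x. F x \<bullet> mollify \<rho> E x \<partial>lborel) = (\<integral>x. mollify \<rho> F x \<bullet> E x \<partial>lborel)"
proof -
  have k: "Cc \<rho>" using m by (simp add: mollifier_def)
  have i: "integrable lborel (\<lambda>x. F x $ i * conv (\<lambda>y. E y $ i) \<rho> x)"
    "integrable lborel (\<lambda>x. conv (\<lambda>y. F y $ i) \<rho> x * E x $ i)" for i
    by (intro Cc_integrable Cc_mult_left Cc_nth F E Cc_conv k Cc_continuous[OF Cc_conv] Cc_continuous[OF Cc_nth])+
  show ?thesis
    using i conv_swap[OF Cc_nth[OF E] Cc_nth[OF F] m] by (simp add: inner_3)
qed

text \<open>The remainder \<open>E\<close> is divergence-free only approximately and only weakly, so
  the potential is taken for its mollification \<open>Eh\<close>, on a contracted copy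
  \<open>D\<close> of the domain where the kernels are admissible. All errors are collected into
  \<open>N\<^sup>2 \<le> p * N + d\<^sup>2\<close>, which preserves the leading constant
  \<open>p\<close> and costs only an additive \<open>d\<close>.\<close>

lemma near_gradient:
  assumes \<Omega>: "open \<Omega>" "convex \<Omega>" "bounded \<Omega>" and P: "poincare \<Omega> c" "0 \<le> c"
    and \<phi>: "test_fun \<Omega> \<phi>" and d: "0 < d"
  obtains u where "test_fun \<Omega> u"
    "l2norm lborel (\<lambda>x. \<phi> x - grad u x) \<le> c * l2norm lborel (rot \<phi>) + d"
proof (cases "\<Omega> = {}")
  case True
  then have "(\<lambda>x. \<phi> x - grad (\<lambda>x. 0) x) = (\<lambda>x. 0)"
    using test_fun_outside[OF \<phi>] by (simp add: grad_0)
  then have "l2norm lborel (\<lambda>x. \<phi> x - grad (\<lambda>x. 0) x) = 0" by (simp add: l2norm_def)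
  then show thesis using that[OF test_fun_0] P(2) d by simp
next
  case False
  define S where "S = closure {x. \<phi> x \<noteq> 0}"
  have S: "compact S" "S \<subseteq> \<Omega>" "\<And>x. x \<notin> S \<Longrightarrow> \<phi> x = 0"
    using \<phi> closure_subset[of "{x. \<phi> x \<noteq> 0}"] by (auto simp: test_fun_def S_def)
  note \<phi>c = test_fun_Cc[OF \<phi>] and \<phi>g = test_fun_vgrad[OF \<phi>]
  define J where "J = rot \<phi>"
  have J: "Cc J" unfolding J_def by (rule test_fun_Cc_rot[OF \<phi>])
  have JS: "J x = 0" if "x \<notin> S" for x
    using rot_zero_off_support[OF \<phi>] that by (simp add: J_def S_def)
  from False obtain x0 where x0: "x0 \<in> \<Omega>" by blast
  obtain r0 where r0: "0 < r0" "ball x0 r0 \<subseteq> \<Omega>" using \<Omega>(1) x0 open_contains_ball by blast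
  obtain e0 where e0: "0 < e0" "(\<Union>x\<in>S. cball x e0) \<subseteq> \<Omega>"
    using compact_subset_open_imp_cball_epsilon_subset[OF S(1) \<Omega>(1) S(2)] by blast
  obtain r where r: "0 < r" "\<And>x. x \<in> \<Omega> \<Longrightarrow> norm x \<le> r" using \<Omega>(3) bounded_pos by metis
  have diam: "norm (x - x0) \<le> 2 * r" if "x \<in> \<Omega>" for x
    using r(2)[OF that] r(2)[OF x0] norm_triangle_ineq4[of x x0] by simp
  \<comment> \<open>Expanding by \<open>1 / t\<close> about \<open>x0\<close> moves a point of the
    domain by at most \<open>2 * r * (1 / t - 1) = e0\<close>. Points of \<open>S\<close> therefore
    stay in the domain, which means that \<open>S\<close> lies in the contracted copy.\<close>
  define t where "t = 2 * r / (2 * r + e0)"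
  have t: "0 < t" "t < 1" "2 * r * (1 / t - 1) = e0"
    using r(1) e0(1) by (auto simp: t_def field_simps)
  define T where "T x = (x0 - t *\<^sub>R x0) + t *\<^sub>R x" for x
  define D where "D = T ` \<Omega>"
  have TD: "D = (\<lambda>x. (x0 - t *\<^sub>R x0) + t *\<^sub>R x) ` \<Omega>" by (simp add: D_def T_def[abs_def])
  \<comment> \<open>\<open>y\<close> is the combination, with weights \<open>t\<close> and
    \<open>1 - t\<close>, of the preimage \<open>z\<close> of \<open>x\<close> and a point
    \<open>v\<close> of the ball about \<open>x0\<close>. Convexity thus keeps \<open>D\<close> at
    distance at least \<open>(1 - t) * r0\<close> from the complement of the domain.\<close>
  have inner_ball: "y \<in> \<Omega>" if xD: "x \<in> D" and yx: "norm (y - x) < (1 - t) * r0" for x y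
  proof -
    obtain z where z: "z \<in> \<Omega>" "x = (x0 - t *\<^sub>R x0) + t *\<^sub>R z" using xD by (auto simp: TD)
    define v where "v = x0 + (1 / (1 - t)) *\<^sub>R (y - x)"
    have "norm (v - x0) = norm (y - x) / (1 - t)" using t by (simp add: v_def)
    also have "\<dots> < r0" using yx t by (simp add: field_simps)
    finally have "v \<in> \<Omega>" using r0(2) by (auto simp: dist_norm norm_minus_commute)
    then have "t *\<^sub>R z + (1 - t) *\<^sub>R v \<in> \<Omega>" using \<Omega>(2) z(1) t by (intro convexD) auto
    moreover have "t *\<^sub>R z + (1 - t) *\<^sub>R v = y"
      using t by (simp add: v_def z(2) scaleR_add_right) (simp add: algebra_simps)
    ultimately show ?thesis by simp
  qed
  have D\<Omega>: "D \<subseteq> \<Omega>"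
    using inner_ball[of x x for x] t r0 by auto
  have SD: "S \<subseteq> D"
  proof
    fix s assume s: "s \<in> S"
    define z where "z = x0 + (1 / t) *\<^sub>R (s - x0)"
    have "z - s = (1 / t - 1) *\<^sub>R (s - x0)" by (simp add: z_def algebra_simps)
    then have "norm (z - s) = (1 / t - 1) * norm (s - x0)" using t by simp
    also have "\<dots> \<le> (1 / t - 1) * (2 * r)" using diam s S(2) t by (intro mult_left_mono) auto
    finally have "z \<in> cball s e0" using t(3) by (simp add: dist_norm norm_minus_commute mult.commute)
    then have "z \<in> \<Omega>" using e0(2) s by blast
    moreover have "s = T z" using t by (simp add: T_def z_def algebra_simps)
    ultimately show "s \<in> D" by (simp add: D_def)
  qed
  have D: "open D" "bounded D" "convex D"
  proof -
    show "open D" unfolding TD using open_affinity[OF \<Omega>(1), of t] t by simp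
    show "bounded D" using \<Omega>(3) D\<Omega> by (rule bounded_subset)
    show "convex D" unfolding TD by (rule convex_affinity[OF \<Omega>(2)])
  qed
  have PD: "poincare D c" unfolding TD by (rule poincare_affine[OF \<Omega>(1) P(1)]) (use t in auto)
  have x0D: "x0 \<in> D" unfolding TD by (rule image_eqI[OF _ x0]) simp
  have diamD: "norm (x - x0) \<le> 2 * r" if "x \<in> D" for x using diam D\<Omega> that by blast

  define p where "p = c * l2norm lborel J"
  have p: "0 \<le> p" using P(2) by (simp add: p_def)
  define K where "K = l2norm lborel \<phi> + 1"
  have K: "0 < K" by (simp add: K_def add_nonneg_pos)
  define vol where "vol R = sqrt (measure lborel (cball (0::real^3) R))" for R
  have vol: "0 \<le> vol R" for R by (simp add: vol_def)
  define a4 where "a4 = 3 * vol (r + 1) * K"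
  have a4: "0 \<le> a4" using vol K by (simp add: a4_def)
  \<comment> \<open>The total error allowed is \<open>d\<^sup>2\<close>: the part
    \<open>\<tau> * a4\<close> is spent on mollifying \<open>\<phi>\<close>, the part
    \<open>\<tau>\<close> on all terms proportional to \<open>\<delta>\<close>.\<close>
  define \<tau> where "\<tau> = d\<^sup>2 / (1 + a4)"
  have \<tau>: "0 < \<tau>" "\<tau> * (1 + a4) = d\<^sup>2" using d a4 by (auto simp: \<tau>_def)
  obtain d4 where d4: "0 < d4" "\<And>x y. norm (x - y) < d4 \<Longrightarrow> norm (\<phi> y - \<phi> x) \<le> \<tau>"
    using Cc_uniform_modulus[OF \<phi>c \<tau>(1)] by auto
  \<comment> \<open>Half of \<open>(1 - t) * r0\<close> makes the inequality strict, so that even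
    closed balls of radius \<open>h\<close> about points of \<open>D\<close> lie in the
    domain.\<close>
  define h where "h = min 1 (min d4 ((1 - t) * r0 / 2))"
  have h: "0 < h" "h \<le> 1" "h \<le> d4" "h < (1 - t) * r0"
    using d4(1) t r0(1) by (auto simp: h_def min_less_iff_disj)
  obtain \<rho> :: "real^3 \<Rightarrow> real" and \<rho>' where \<rho>: "mollifier h \<rho>" "cgrad \<rho> \<rho>'" "\<And>x. smooth (\<lambda>y. \<rho> (x - y))"
    using mollifier_exists[OF h(1), where 'a = "real^3"] by blast
  have k: "Cc \<rho>" using \<rho>(1) by (simp add: mollifier_def)
  have k': "Cc \<rho>'" using Cc_cgrad[OF k \<rho>(2)] .
  obtain M where M: "0 < M" "\<And>y. norm (\<rho>' y) \<le> M" using Cc_bound[OF k'] by blast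
  define m where "m = M * vol (r + 1)"
  have m: "0 \<le> m" using M vol by (simp add: m_def)
  \<comment> \<open>\<open>m\<close> bounds the gradient norms of the kernels centred in
    \<open>D\<close>, so \<open>\<delta> * m\<close> bounds the divergence of \<open>Eh\<close>
    there and \<open>\<delta> * m * (2 * r)\<close> the defect of its potential. \<open>tot\<close>
    gathers the coefficients of \<open>\<delta>\<close>: this defect enters the bound on
    \<open>rot A\<close> through \<open>a1\<close> and the pairing with \<open>\<phi>\<close>
    through \<open>a3\<close>, and \<open>2 * K\<close> comes from pairing \<open>E\<close> with
    \<open>grad u\<close>.\<close>
  define a1 where "a1 = m * (2 * r) * vol r"
  define a3 where "a3 = m * (2 * r) * vol r * l2norm lborel \<phi>"
  define tot where "tot = p * a1 + 2 * K + a3"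
  have a13: "0 \<le> a1" "0 \<le> a3" "0 \<le> tot"
    using m r vol p K by (auto simp: a1_def a3_def tot_def)
  define \<delta> where "\<delta> = min 1 (\<tau> / (1 + tot))"
  have \<delta>: "0 < \<delta>" "\<delta> \<le> 1" "\<delta> * tot \<le> \<tau>"
  proof -
    show "0 < \<delta>" "\<delta> \<le> 1" using \<tau> a13 by (auto simp: \<delta>_def)
    have "\<delta> * tot \<le> \<tau> / (1 + tot) * (1 + tot)"
      using a13 \<tau>(1) by (intro mult_mono) (auto simp: \<delta>_def)
    then show "\<delta> * tot \<le> \<tau>" using a13 by simp
  qed
  obtain g where g: "g \<in> grad ` {u. test_fun \<Omega> u}"
    "\<And>l. l \<in> grad ` {u. test_fun \<Omega> u} \<Longrightarrow> \<bar>\<integral>x. (\<phi> x - g x) \<bullet> l x \<partial>lborel\<bar> \<le> \<delta> * l2norm lborel l"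
    "(l2norm lborel (\<lambda>x. \<phi> x - g x))\<^sup>2 \<le> (l2norm lborel \<phi>)\<^sup>2 + \<delta>\<^sup>2"
  proof (rule near_orthogonal_remainder[OF Cc_square_integrable[OF \<phi>c] _ _ _ \<delta>(1),
        where G = "grad ` {u. test_fun \<Omega> u}"])
    show "square_integrable lborel l" if "l \<in> grad ` {u. test_fun \<Omega> u}" for l
    proof -
      from that obtain v where "test_fun \<Omega> v" "l = grad v" by blast
      then show ?thesis by (simp add: Cc_square_integrable test_fun_Cc_grad)
    qed
    show "(\<lambda>x. 0) \<in> grad ` {u. test_fun \<Omega> u}"
      by (rule image_eqI[where x = "\<lambda>x. 0"]) (simp_all add: grad_0 test_fun_0)
    show "(\<lambda>x. a x + s *\<^sub>R b x) \<in> grad ` {u. test_fun \<Omega> u}"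
      if "a \<in> grad ` {u. test_fun \<Omega> u}" "b \<in> grad ` {u. test_fun \<Omega> u}" for a b s
    proof -
      from that obtain v w where vw: "test_fun \<Omega> v" "test_fun \<Omega> w" "a = grad v" "b = grad w" by blast
      show ?thesis
        unfolding vw(3,4) grad_add_scaleR[OF vw(1,2), symmetric]
        using test_fun_add_scaleR[OF vw(1,2)] by blast
    qed
  qed blast
  then obtain u where u: "test_fun \<Omega> u" "g = grad u" by blast
  define E where "E x = \<phi> x - grad u x" for x
  define N where "N = l2norm lborel E"
  have N: "0 \<le> N" by (simp add: N_def)
  have gc: "Cc (grad u)" by (rule test_fun_Cc_grad[OF u(1)])
  have E: "Cc E" unfolding E_def by (intro Cc_diff \<phi>c gc)
  have orth: "\<bar>\<integral>x. E x \<bullet> grad v x \<partial>lborel\<bar> \<le> \<delta> * l2norm lborel (grad v)" if "test_fun \<Omega> v" for v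
    using g(2)[of "grad v"] that by (simp add: E_def u(2))
  have NK: "N \<le> K"
  proof (rule power2_le_imp_le)
    have "N\<^sup>2 \<le> (l2norm lborel \<phi>)\<^sup>2 + \<delta>\<^sup>2" using g(3) by (simp add: N_def E_def[abs_def] u(2))
    also have "\<delta>\<^sup>2 \<le> 1" using \<delta> by (simp add: power_le_one)
    finally show "N\<^sup>2 \<le> K\<^sup>2"
      using l2norm_nonneg[of lborel \<phi>] unfolding K_def power2_sum one_power2 by linarith
  qed (use K in simp)

  define Eh where "Eh = mollify \<rho> E"
  define Gh where "Gh i = conv (\<lambda>y. E y $ i) \<rho>'" for i
  have Eh: "Cc Eh" "vgrad Eh Gh"
    unfolding Eh_def Gh_def by (intro Cc_mollify E k vgrad_mollify \<rho>(2))+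
  \<comment> \<open>The divergence of a mollified field is, up to sign, its pairing with the
    gradient of the shifted kernel, which is a test function for \<open>x\<close> in
    \<open>D\<close>; near-orthogonality applies to it directly.\<close>
  have div: "\<bar>dvg Gh x\<bar> \<le> \<delta> * m" if x: "x \<in> D" for x
  proof -
    have cb: "cball x h \<subseteq> \<Omega>"
      using inner_ball[OF x] h(4) by (auto simp: dist_norm norm_minus_commute)
    have tf: "test_fun \<Omega> (\<lambda>y. \<rho> (x - y))" by (rule test_fun_mollifier[OF \<rho>(1,3) cb])
    have gr: "grad (\<lambda>y. \<rho> (x - y)) = (\<lambda>y. - \<rho>' (x - y))"
      by (rule cgrad_unique[OF test_fun_cgrad[OF tf] cgrad_reflect[OF \<rho>(2)]])
    have "dvg Gh x = - (\<integral>y. E y \<bullet> grad (\<lambda>y. \<rho> (x - y)) y \<partial>lborel)"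
      unfolding Gh_def dvg_mollify[OF E k \<rho>(2)] gr by simp
    then have "\<bar>dvg Gh x\<bar> \<le> \<delta> * l2norm lborel (\<lambda>y. - \<rho>' (x - y))"
      using orth[OF tf] by (simp add: gr)
    also have "l2norm lborel (\<lambda>y. - \<rho>' (x - y)) \<le> m"
      unfolding m_def vol_def
    proof (rule l2norm_le_ball)
      show "Cc (\<lambda>y. - \<rho>' (x - y))" by (intro Cc_uminus Cc_reflect k')
      show "norm (- \<rho>' (x - y)) \<le> M" for y using M(2) by simp
      fix y :: "real^3" assume "r + 1 < norm y"
      moreover have "norm x \<le> r" using r(2) D\<Omega> x by blast
      ultimately have "h < norm (x - y)"
        using h(2) norm_triangle_ineq2[of y x] by (simp add: norm_minus_commute)
      then show "- \<rho>' (x - y) = 0" using mollifier_grad_zero[OF \<rho>(1,2)] by simp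
    qed
    finally show ?thesis using \<delta>(1) by simp
  qed
  obtain A HA where A: "Cc A" "vgrad A HA" "\<And>x. x \<in> D \<Longrightarrow> norm (curl HA x - Eh x) \<le> \<delta> * m * (2 * r)"
    using vector_potential[OF D(1,3) x0D D(2) Eh(2) div diamD] by blast
  define \<epsilon> where "\<epsilon> = \<delta> * m * (2 * r)"
  have \<epsilon>: "0 \<le> \<epsilon>" using \<delta> m r by (simp add: \<epsilon>_def)
  have B: "Cc (curl HA)" by (intro Cc_curl Cc_vgrad[OF A(1,2)])
  have DB: "D \<in> sets borel" using D(1) by simp

  have curlD: "l2norm lborel (\<lambda>x. indicator D x *\<^sub>R curl HA x) \<le> N + \<epsilon> * vol r"
  proof -
    have sq: "square_integrable lborel (\<lambda>x. indicator D x *\<^sub>R F x)" if F: "Cc F" for F :: "real^3 \<Rightarrow> real^3"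
      unfolding square_integrable_def
    proof
      show "(\<lambda>x. indicator D x *\<^sub>R F x) \<in> borel_measurable lborel" using DB Cc_borel[OF F] by simp
      have "(\<lambda>x. (norm (indicator D x *\<^sub>R F x))\<^sup>2) = (\<lambda>x. indicator D x *\<^sub>R (norm (F x))\<^sup>2)"
        by (auto simp: fun_eq_iff split: split_indicator)
      then show "integrable lborel (\<lambda>x. (norm (indicator D x *\<^sub>R F x))\<^sup>2)"
        using integrable_indicator_continuous[OF DB D(2) Cc_continuous[OF Cc_power2[OF Cc_norm[OF F]]]] by simp
    qed
    let ?F = "\<lambda>x. indicator D x *\<^sub>R (curl HA x - Eh x)"
    have "(\<lambda>x. indicator D x *\<^sub>R curl HA x) = (\<lambda>x. indicator D x *\<^sub>R Eh x + ?F x)"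
      by (simp add: algebra_simps)
    then have "l2norm lborel (\<lambda>x. indicator D x *\<^sub>R curl HA x)
        \<le> l2norm lborel (\<lambda>x. indicator D x *\<^sub>R Eh x) + l2norm lborel ?F"
      using l2norm_triangle[OF sq[OF Eh(1)] sq[OF Cc_diff[OF B Eh(1)]]] by simp
    also have "l2norm lborel (\<lambda>x. indicator D x *\<^sub>R Eh x) \<le> l2norm lborel Eh"
      by (rule l2norm_mono[OF _ sq[OF Eh(1)] Cc_square_integrable[OF Eh(1)]]) (simp add: indicator_def)
    also have "\<dots> \<le> N" unfolding Eh_def N_def by (rule l2norm_mollify_le[OF E \<rho>(1)])
    also have "l2norm lborel ?F \<le> \<epsilon> * vol r"
    proof -
      have "(\<integral>x. (norm (?F x))\<^sup>2 \<partial>lborel) \<le> (\<integral>x. indicator (cball (0::real^3) r) x *\<^sub>R \<epsilon>\<^sup>2 \<partial>lborel)"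
      proof (rule integral_mono)
        show "integrable lborel (\<lambda>x. (norm (?F x))\<^sup>2)"
          using sq[OF Cc_diff[OF B Eh(1)]] by (simp add: square_integrable_def)
        show "integrable lborel (\<lambda>x. indicator (cball (0::real^3) r) x *\<^sub>R \<epsilon>\<^sup>2)"
          by (rule borel_integrable_compact) auto
        show "(norm (?F x))\<^sup>2 \<le> indicator (cball 0 r) x *\<^sub>R \<epsilon>\<^sup>2" for x
        proof (cases "x \<in> D")
          case True
          then have "norm x \<le> r" using r(2) D\<Omega> by blast
          then show ?thesis using power_mono[OF A(3)[OF True], of 2] True by (simp add: \<epsilon>_def)
        qed simp
      qed
      also have "\<dots> = (\<epsilon> * vol r)\<^sup>2" by (simp add: vol_def power_mult_distrib)
      finally show ?thesis
        unfolding l2norm_def using \<epsilon> vol by (intro real_le_lsqrt) auto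
    qed
    finally show ?thesis by simp
  qed
  have JA: "\<bar>\<integral>x. J x \<bullet> A x \<partial>lborel\<bar> \<le> p * (N + \<epsilon> * vol r)"
  proof -
    have J0: "(\<integral>x. J x $ i \<partial>lborel) = 0" for i
      unfolding J_def rot_eq_curl by (rule integral_curl_eq_0[OF \<phi>c \<phi>g])
    have Ju: "(\<integral>x. J x \<bullet> v' x \<partial>lborel) = 0" if "Cc v" "cgrad v v'" for v v'
      unfolding J_def rot_eq_curl by (rule integral_curl_grad_eq_0[OF \<phi>c \<phi>g that])
    have "\<bar>\<integral>x. J x \<bullet> A x \<partial>lborel\<bar> \<le> l2norm lborel J * (c * l2norm lborel (\<lambda>x. indicator D x *\<^sub>R curl HA x))"
      by (rule convex_estimate[OF D PD P(2) A(1,2) J S(1) SD JS J0 Ju])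
    also have "\<dots> = p * l2norm lborel (\<lambda>x. indicator D x *\<^sub>R curl HA x)" by (simp add: p_def)
    also have "\<dots> \<le> p * (N + \<epsilon> * vol r)" by (rule mult_left_mono[OF curlD p])
    finally show ?thesis .
  qed
  have JA_eq: "(\<integral>x. J x \<bullet> A x \<partial>lborel) = (\<integral>x. \<phi> x \<bullet> curl HA x \<partial>lborel)"
    unfolding J_def rot_eq_curl by (rule integral_curl_by_parts[OF \<phi>c \<phi>g A(2)])
  have err1: "\<bar>\<integral>x. \<phi> x \<bullet> (curl HA x - Eh x) \<partial>lborel\<bar> \<le> \<epsilon> * (vol r * l2norm lborel \<phi>)"
  proof -
    have sqi: "square_integrable lborel (indicator (cball (0::real^3) r) :: real^3 \<Rightarrow> real)"
      unfolding square_integrable_def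
    proof
      have "cball (0::real^3) r \<in> sets lborel" by simp
      then show "indicator (cball (0::real^3) r) \<in> borel_measurable lborel"
        by (rule borel_measurable_indicator)
      have "(\<lambda>x. (norm (indicator (cball (0::real^3) r) x :: real))\<^sup>2) = (\<lambda>x. indicator (cball 0 r) x *\<^sub>R 1)"
        by (simp add: fun_eq_iff indicator_def)
      then show "integrable lborel (\<lambda>x. (norm (indicator (cball (0::real^3) r) x :: real))\<^sup>2)"
        using borel_integrable_compact[OF compact_cball continuous_on_const, of "0::real^3" r "1::real"] by simp
    qed
    have ni: "l2norm lborel (indicator (cball (0::real^3) r) :: real^3 \<Rightarrow> real) = vol r"
    proof -
      have "(\<lambda>x. (norm (indicator (cball (0::real^3) r) x :: real))\<^sup>2) = indicator (cball 0 r)"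
        by (simp add: fun_eq_iff indicator_def)
      then show ?thesis by (simp add: l2norm_def vol_def)
    qed
    have \<phi>N: "Cc (\<lambda>x. norm (\<phi> x))" by (rule Cc_norm[OF \<phi>c])
    have "norm (\<integral>x. \<phi> x \<bullet> (curl HA x - Eh x) \<partial>lborel) \<le> (\<integral>x. \<epsilon> * (indicator (cball 0 r) x \<bullet> norm (\<phi> x)) \<partial>lborel)"
    proof (rule Bochner_Integration.integral_norm_bound_integral)
      show "integrable lborel (\<lambda>x. \<phi> x \<bullet> (curl HA x - Eh x))"
        by (intro Cc_integrable Cc_inner_left \<phi>c Cc_continuous[OF Cc_diff[OF B Eh(1)]])
      show "integrable lborel (\<lambda>x. \<epsilon> * (indicator (cball 0 r) x \<bullet> norm (\<phi> x)))"
        using square_integrable_inner[OF sqi Cc_square_integrable[OF \<phi>N]] by simp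
      show "norm (\<phi> x \<bullet> (curl HA x - Eh x)) \<le> \<epsilon> * (indicator (cball 0 r) x \<bullet> norm (\<phi> x))" for x
      proof (cases "x \<in> D")
        case True
        then have "norm x \<le> r" using r(2) D\<Omega> by blast
        have "norm (\<phi> x) * norm (curl HA x - Eh x) \<le> norm (\<phi> x) * \<epsilon>"
          unfolding \<epsilon>_def by (rule mult_left_mono[OF A(3)[OF True]]) simp
        from order_trans[OF Cauchy_Schwarz_ineq2 this] show ?thesis
          using \<open>norm x \<le> r\<close> by (simp add: mult.commute)
      next
        case False
        then have "\<phi> x = 0" using S(3) SD by blast
        then show ?thesis by simp
      qed
    qed
    also have "\<dots> = \<epsilon> * (\<integral>x. indicator (cball 0 r) x \<bullet> norm (\<phi> x) \<partial>lborel)" by simp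
    also have "\<dots> \<le> \<epsilon> * (vol r * l2norm lborel (\<lambda>x. norm (\<phi> x)))"
      using l2_Cauchy_Schwarz[OF sqi Cc_square_integrable[OF \<phi>N]] \<epsilon> ni
      by (intro mult_left_mono) auto
    also have "l2norm lborel (\<lambda>x. norm (\<phi> x)) = l2norm lborel \<phi>" by (simp add: l2norm_def)
    finally show ?thesis by simp
  qed
  \<comment> \<open>Again only \<open>\<phi>\<close> has a modulus of continuity fixed in advance,
    so \<open>mollify_swap\<close> lets the mollification act on \<open>\<phi>\<close> and leaves
    \<open>E\<close> with its norm bound \<open>K\<close>.\<close>
  have err2: "\<bar>\<integral>x. (\<phi> x - mollify \<rho> \<phi> x) \<bullet> E x \<partial>lborel\<bar> \<le> \<tau> * a4"
  proof -
    let ?X = "\<lambda>x. \<phi> x - mollify \<rho> \<phi> x"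
    have X: "Cc ?X" by (intro Cc_diff \<phi>c Cc_mollify k)
    have "l2norm lborel ?X \<le> (3 * \<tau>) * vol (r + 1)"
      unfolding vol_def
    proof (rule l2norm_le_ball[OF X])
      show "norm (?X x) \<le> 3 * \<tau>" for x
      proof (rule norm_le_sum_nth_3)
        fix i
        have "\<bar>conv (\<lambda>y. \<phi> y $ i) \<rho> x - \<phi> x $ i\<bar> \<le> \<tau>"
        proof (rule conv_close[OF Cc_nth[OF \<phi>c] \<rho>(1)])
          show "\<bar>\<phi> y $ i - \<phi> x $ i\<bar> \<le> \<tau>" if "norm (x - y) < h" for y
            using component_le_norm_cart[of "\<phi> y - \<phi> x" i] d4(2)[of x y] that h(3) by simp
        qed
        then show "\<bar>(?X x) $ i\<bar> \<le> \<tau>" by (simp add: abs_minus_commute)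
      qed
      fix x :: "real^3" assume x: "r + 1 < norm x"
      have z: "\<phi> y = 0" if "norm (x - y) < h" for y
      proof -
        have "r < norm y" using x that h(2) norm_triangle_ineq2[of x y] by linarith
        then show ?thesis using r(2) test_fun_outside[OF \<phi>] by (meson not_le)
      qed
      have "\<bar>conv (\<lambda>y. \<phi> y $ i) \<rho> x - 0\<bar> \<le> 0" for i
        by (rule conv_close[OF Cc_nth[OF \<phi>c] \<rho>(1)]) (simp add: z)
      then have "mollify \<rho> \<phi> x = 0" by (simp add: vec_eq_iff)
      then show "?X x = 0" using z[of x] h(1) by simp
    qed
    moreover have "\<bar>\<integral>x. ?X x \<bullet> E x \<partial>lborel\<bar> \<le> l2norm lborel ?X * N"
      unfolding N_def by (intro l2_Cauchy_Schwarz Cc_square_integrable X E)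
    moreover have "l2norm lborel ?X * N \<le> (3 * \<tau> * vol (r + 1)) * K"
      using calculation(1) NK N \<tau> vol by (intro mult_mono) auto
    ultimately show ?thesis by (simp add: a4_def mult_ac)
  qed
  have err3: "\<bar>\<integral>x. E x \<bullet> grad u x \<partial>lborel\<bar> \<le> \<delta> * (2 * K)"
  proof -
    have "l2norm lborel (grad u) = l2norm lborel (\<lambda>x. \<phi> x - E x)" by (simp add: E_def)
    also have "\<dots> \<le> l2norm lborel \<phi> + l2norm lborel E"
      by (intro l2norm_triangle_diff Cc_square_integrable \<phi>c E)
    also have "\<dots> \<le> 2 * K" using NK by (simp add: N_def K_def)
    finally show ?thesis using orth[OF u(1)] \<delta>(1) by (meson mult_left_mono order_trans less_imp_le)
  qed
  have "N\<^sup>2 = (\<integral>x. E x \<bullet> E x \<partial>lborel)" by (simp add: N_def l2norm_sq power2_norm_eq_inner)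
  also have "\<dots> = (\<integral>x. \<phi> x \<bullet> E x \<partial>lborel) - (\<integral>x. E x \<bullet> grad u x \<partial>lborel)"
  proof -
    have "integrable lborel (\<lambda>x. \<phi> x \<bullet> E x)" "integrable lborel (\<lambda>x. E x \<bullet> grad u x)"
      by (intro Cc_integrable Cc_inner_left \<phi>c E Cc_continuous[OF E] Cc_continuous[OF gc])+
    moreover have "E x \<bullet> E x = \<phi> x \<bullet> E x - E x \<bullet> grad u x" for x
      by (simp add: E_def inner_diff_left inner_diff_right inner_commute)
    ultimately show ?thesis by simp
  qed
  also have "(\<integral>x. \<phi> x \<bullet> E x \<partial>lborel) = (\<integral>x. J x \<bullet> A x \<partial>lborel)
      - (\<integral>x. \<phi> x \<bullet> (curl HA x - Eh x) \<partial>lborel) + (\<integral>x. (\<phi> x - mollify \<rho> \<phi> x) \<bullet> E x \<partial>lborel)"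
  proof -
    have i: "integrable lborel (\<lambda>x. \<phi> x \<bullet> F x)" "integrable lborel (\<lambda>x. mollify \<rho> \<phi> x \<bullet> F x)" if "Cc F" for F
      by (intro Cc_integrable Cc_inner_left \<phi>c Cc_mollify k Cc_continuous[OF that])+
    show ?thesis
      unfolding JA_eq using i[OF B] i[OF Eh(1)] i[OF E] mollify_swap[OF \<phi>c E \<rho>(1)]
      by (simp add: inner_diff_left inner_diff_right Eh_def)
  qed
  finally have "N\<^sup>2 \<le> p * (N + \<epsilon> * vol r) + \<epsilon> * (vol r * l2norm lborel \<phi>) + \<tau> * a4 + \<delta> * (2 * K)"
    using JA err1 err2 err3 by linarith
  also have "\<dots> = p * N + \<delta> * tot + \<tau> * a4"
    by (simp add: \<epsilon>_def tot_def a1_def a3_def algebra_simps)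
  also have "\<dots> \<le> p * N + d\<^sup>2"
    using \<delta>(3) \<tau>(2) by (simp add: algebra_simps)
  finally have "N \<le> p + sqrt (d\<^sup>2)"
    using p N by (intro quadratic_bound) auto
  then have "l2norm lborel (\<lambda>x. \<phi> x - grad u x) \<le> c * l2norm lborel (rot \<phi>) + d"
    using d by (simp add: N_def E_def[abs_def] p_def J_def)
  then show thesis by (rule that[OF u(1)])
qed

section \<open>The Maxwell estimate\<close>

lemma R0_near_gradient:
  assumes \<Omega>: "open \<Omega>" "convex \<Omega>" "bounded \<Omega>" and P: "poincare \<Omega> c" "0 \<le> c"
    and \<phi>: "R0 \<Omega> \<phi> r" and d: "0 < d"
  obtains u where "test_fun \<Omega> u" "L2norm \<Omega> (\<lambda>x. \<phi> x - grad u x) \<le> c * L2norm \<Omega> r + d"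
proof -
  let ?M = "lebesgue_on \<Omega>"
  obtain \<psi> :: "nat \<Rightarrow> real^3 \<Rightarrow> real^3" where \<psi>: "\<And>n. test_fun \<Omega> (\<psi> n)"
    "(\<lambda>n. (L2norm \<Omega> (\<lambda>x. \<psi> n x - \<phi> x))\<^sup>2 + (L2norm \<Omega> (\<lambda>x. rot (\<psi> n) x - r x))\<^sup>2) \<longlonglongrightarrow> 0"
    using \<phi> unfolding R0_def by blast
  have sq: "square_integrable ?M \<phi>" "square_integrable ?M r"
    using \<phi> by (simp_all add: R0_def weak_rot_def L2_eq)
  have sqC: "square_integrable ?M f" if "Cc f" for f :: "real^3 \<Rightarrow> real^3"
    using L2_continuous[OF \<Omega>(1,3) Cc_continuous[OF that]] by (simp add: L2_eq)
  \<comment> \<open>The error \<open>e\<close> occurs in the approximation of \<open>\<phi>\<close>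
    and in \<open>near_gradient\<close>, and once more, multiplied by \<open>c\<close>, in the
    approximation of the rotation.\<close>
  define e where "e = d / (2 + c)"
  have e: "0 < e" "e * (2 + c) = d" using d P(2) by (auto simp: e_def)
  have "\<forall>\<^sub>F n in sequentially. (L2norm \<Omega> (\<lambda>x. \<psi> n x - \<phi> x))\<^sup>2 + (L2norm \<Omega> (\<lambda>x. rot (\<psi> n) x - r x))\<^sup>2 < e\<^sup>2"
    using order_tendstoD(2)[OF \<psi>(2), of "e\<^sup>2"] e by simp
  from eventually_happens'[OF sequentially_bot this]
  obtain n where n: "(L2norm \<Omega> (\<lambda>x. \<psi> n x - \<phi> x))\<^sup>2 + (L2norm \<Omega> (\<lambda>x. rot (\<psi> n) x - r x))\<^sup>2 < e\<^sup>2"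
    by blast
  have n1: "L2norm \<Omega> (\<lambda>x. \<psi> n x - \<phi> x) \<le> e"
    by (rule power2_le_imp_le)
      (use n e zero_le_power2[of "L2norm \<Omega> (\<lambda>x. rot (\<psi> n) x - r x)"] in linarith)+
  have n2: "L2norm \<Omega> (\<lambda>x. rot (\<psi> n) x - r x) \<le> e"
    by (rule power2_le_imp_le)
      (use n e zero_le_power2[of "L2norm \<Omega> (\<lambda>x. \<psi> n x - \<phi> x)"] in linarith)+
  obtain u where u: "test_fun \<Omega> u"
    "l2norm lborel (\<lambda>x. \<psi> n x - grad u x) \<le> c * l2norm lborel (rot (\<psi> n)) + e"
    by (rule near_gradient[OF \<Omega> P \<psi>(1) e(1)])
  have C: "Cc (\<lambda>x. \<psi> n x - grad u x)" "Cc (\<psi> n)" "Cc (rot (\<psi> n))"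
    by (intro Cc_diff test_fun_Cc[OF \<psi>(1)] test_fun_Cc_grad[OF u(1)] test_fun_Cc_rot[OF \<psi>(1)])+
  have u': "l2norm ?M (\<lambda>x. \<psi> n x - grad u x) \<le> c * l2norm ?M (rot (\<psi> n)) + e"
    using u(2) L2norm_Cc[OF \<Omega>(1) C(1)] L2norm_Cc[OF \<Omega>(1) C(3)]
      test_fun_outside[OF \<psi>(1)] test_fun_grad_outside[OF u(1)] test_fun_rot_outside[OF \<psi>(1)]
    by (simp add: L2norm_eq)
  have "l2norm ?M (rot (\<psi> n)) = l2norm ?M (\<lambda>x. (rot (\<psi> n) x - r x) + r x)" by simp
  also have "\<dots> \<le> e + l2norm ?M r"
    using l2norm_triangle[OF square_integrable_diff[OF sqC[OF C(3)] sq(2)] sq(2)] n2 by (simp add: L2norm_eq)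
  finally have "c * l2norm ?M (rot (\<psi> n)) \<le> c * (e + l2norm ?M r)" using P(2) by (rule mult_left_mono)
  moreover have "l2norm ?M (\<lambda>x. \<phi> x - grad u x) \<le> e + l2norm ?M (\<lambda>x. \<psi> n x - grad u x)"
  proof -
    have "(\<lambda>x. \<phi> x - grad u x) = (\<lambda>x. (\<psi> n x - grad u x) - (\<psi> n x - \<phi> x))" by simp
    then show ?thesis
      using l2norm_triangle_diff[OF sqC[OF C(1)] square_integrable_diff[OF sqC[OF C(2)] sq(1)]] n1
      by (simp add: L2norm_eq)
  qed
  ultimately have "l2norm ?M (\<lambda>x. \<phi> x - grad u x) \<le> c * l2norm ?M r + e * (2 + c)"
    using u' by (simp add: algebra_simps)
  then show thesis using that[OF u(1)] e(2) by (simp add: L2norm_eq)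
qed

lemma test_fun_H10:
  assumes "open \<Omega>" "bounded \<Omega>" "test_fun \<Omega> u" shows "H10 \<Omega> u (grad u)"
proof -
  have "(\<lambda>n::nat. (L2norm \<Omega> (\<lambda>x. u x - u x))\<^sup>2 + (L2norm \<Omega> (\<lambda>x. grad u x - grad u x))\<^sup>2) \<longlonglongrightarrow> 0"
    by (simp add: L2norm_def)
  then show ?thesis
    unfolding H10_def using assms weak_grad_continuous[OF assms(1,2) test_fun_cgrad[OF assms(3)]]
    by (intro conjI exI[of _ "\<lambda>n. u"]) auto
qed

lemma bilinear_expand: "(A *v x) \<bullet> y = (\<Sum>i\<in>UNIV. \<Sum>j\<in>UNIV. A $ i $ j * (x $ j * y $ i))"
  for A :: "real^3^3"
  by (simp add: inner_vec_def matrix_vector_mult_def sum_distrib_right mult.assoc)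

text \<open>A factor of one per matrix entry is enough, because the bound serves only to make the
  bilinear form integrable; the sharp constant enters through the quadratic form hypothesis.\<close>

lemma bilinear_bound:
  fixes A :: "real^3^3"
  assumes "norm A \<le> b" shows "\<bar>(A *v x) \<bullet> y\<bar> \<le> 9 * b * (norm x * norm y)"
proof -
  have "\<bar>A $ i $ j * (x $ j * y $ i)\<bar> \<le> b * (norm x * norm y)" for i j
  proof -
    have "\<bar>A $ i $ j\<bar> \<le> b"
      using component_le_norm_cart[of "A $ i" j] Finite_Cartesian_Product.norm_nth_le[of A i] assms by linarith
    then show ?thesis
      unfolding abs_mult
      using component_le_norm_cart[of x j] component_le_norm_cart[of y i]
      by (intro mult_mono) (auto intro: order_trans[OF abs_ge_zero])
  qed
  then have "\<bar>(A *v x) \<bullet> y\<bar> \<le> (\<Sum>i\<in>(UNIV::3 set). \<Sum>j\<in>(UNIV::3 set). b * (norm x * norm y))"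
    unfolding bilinear_expand by (intro order_trans[OF sum_abs] sum_mono)
  then show ?thesis by simp
qed

lemma bilinear_integrable:
  fixes \<epsilon> :: "'a \<Rightarrow> real^3^3"
  assumes m: "\<And>i j. (\<lambda>x. \<epsilon> x $ i $ j) \<in> borel_measurable M"
    and b: "AE x in M. norm (\<epsilon> x) \<le> b"
    and f: "square_integrable M f" and g: "square_integrable M g"
  shows "integrable M (\<lambda>x. (\<epsilon> x *v f x) \<bullet> g x)"
proof (rule Bochner_Integration.integrable_bound)
  show "integrable M (\<lambda>x. 9 * \<bar>b\<bar> * ((norm (f x))\<^sup>2 + (norm (g x))\<^sup>2))"
    using f g by (auto simp: square_integrable_def)
  have nth: "(\<lambda>x. h x $ i) \<in> borel_measurable M" if "square_integrable M h" for h :: "'a \<Rightarrow> real^3" and i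
  proof -
    have "(\<lambda>x. h x \<bullet> axis i 1) \<in> borel_measurable M"
      using that by (intro borel_measurable_inner) (auto simp: square_integrable_def)
    then show ?thesis by (simp add: inner_axis_1)
  qed
  show "(\<lambda>x. (\<epsilon> x *v f x) \<bullet> g x) \<in> borel_measurable M"
    unfolding bilinear_expand
    by (intro borel_measurable_sum borel_measurable_times m nth f g)
  show "AE x in M. norm ((\<epsilon> x *v f x) \<bullet> g x) \<le> norm (9 * \<bar>b\<bar> * ((norm (f x))\<^sup>2 + (norm (g x))\<^sup>2))"
    using b
  proof eventually_elim
    case (elim x)
    then have "\<bar>(\<epsilon> x *v f x) \<bullet> g x\<bar> \<le> 9 * \<bar>b\<bar> * (norm (f x) * norm (g x))"
      by (intro bilinear_bound) auto
    also have "\<dots> \<le> 9 * \<bar>b\<bar> * ((norm (f x))\<^sup>2 + (norm (g x))\<^sup>2)"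
      using sum_squares_bound[of "norm (f x)" "norm (g x)"]
        mult_nonneg_nonneg[OF norm_ge_zero[of "f x"] norm_ge_zero[of "g x"]]
      by (intro mult_left_mono) linarith+
    finally show ?case by simp
  qed
qed

lemma transpose_bilinear: "transpose A = A \<Longrightarrow> (A *v x) \<bullet> y = (A *v y) \<bullet> x"
  for A :: "real^3^3"
  by (metis dot_lmul_matrix inner_commute transpose_matrix_vector)

text \<open>With \<open>t = \<parallel>\<nabla>u\<parallel>\<^sub>\<epsilon>\<close> the cross term is at most \<open>2 c\<^sub>f \<parallel>g\<parallel> t - t\<^sup>2 \<le> c\<^sub>f\<^sup>2 \<parallel>g\<parallel>\<^sup>2\<close>, so no Helmholtz projection
  is needed: any gradient close to \<open>\<phi>\<close> will do.\<close>

lemma maxwell_bound: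
  fixes \<Omega> :: "(real^3) set" and \<epsilon> :: "real^3 \<Rightarrow> real^3^3"
  assumes \<Omega>: "open \<Omega>" "\<Omega> \<noteq> {}" "bounded \<Omega>" "convex \<Omega>"
    and m: "\<And>i j. (\<lambda>x. \<epsilon> x $ i $ j) \<in> borel_measurable (lebesgue_on \<Omega>)"
    and b: "AE x in lebesgue_on \<Omega>. norm (\<epsilon> x) \<le> b"
    and s: "AE x in lebesgue_on \<Omega>. transpose (\<epsilon> x) = \<epsilon> x"
    and e: "0 < e_lo" "0 < e_hi"
    and form: "\<And>\<phi>. L2 \<Omega> \<phi> \<Longrightarrow>
           e_lo * (L2norm \<Omega> \<phi>)\<^sup>2 \<le> integral\<^sup>L (lebesgue_on \<Omega>) (\<lambda>x. (\<epsilon> x *v \<phi> x) \<bullet> \<phi> x)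
         \<and> integral\<^sup>L (lebesgue_on \<Omega>) (\<lambda>x. (\<epsilon> x *v \<phi> x) \<bullet> \<phi> x) \<le> e_hi * (L2norm \<Omega> \<phi>)\<^sup>2"
    and cf: "0 \<le> cf" "\<And>u g. H10 \<Omega> u g \<Longrightarrow> L2norm \<Omega> u \<le> cf * eps_norm \<Omega> \<epsilon> g"
    and cp: "0 \<le> cp" "\<And>u g. weak_grad \<Omega> u g \<Longrightarrow> integral\<^sup>L (lebesgue_on \<Omega>) u = 0 \<Longrightarrow> L2norm \<Omega> u \<le> cp * L2norm \<Omega> g"
    and \<phi>: "R0 \<Omega> \<phi> r" and g: "weak_div \<Omega> (\<lambda>x. \<epsilon> x *v \<phi> x) g"
  shows "eps_norm \<Omega> \<epsilon> \<phi> \<le> max cf (sqrt e_hi * cp) * sqrt ((L2norm \<Omega> g)\<^sup>2 + (L2norm \<Omega> r)\<^sup>2)"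
proof -
  let ?M = "lebesgue_on \<Omega>"
  have P: "poincare \<Omega> cp" by (rule poincare_of_weak[OF \<Omega>(1,3,2) cp(2,1)])
  define B where "B f h = integral\<^sup>L ?M (\<lambda>x. (\<epsilon> x *v f x) \<bullet> h x)" for f h :: "real^3 \<Rightarrow> real^3"
  have Bpos: "0 \<le> B f f" if "square_integrable ?M f" for f
  proof -
    have "0 \<le> e_lo * (L2norm \<Omega> f)\<^sup>2" using e(1) by simp
    also have "\<dots> \<le> B f f" using form[of f] that by (simp add: L2_eq B_def)
    finally show ?thesis .
  qed
  have eps2: "(eps_norm \<Omega> \<epsilon> f)\<^sup>2 = B f f" if "square_integrable ?M f" for f
    using Bpos[OF that] by (simp add: eps_norm_def B_def)
  have sq: "square_integrable ?M \<phi>" "square_integrable ?M g"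
    using \<phi> g by (simp_all add: R0_def weak_rot_def weak_div_def L2_eq)
  have est: "B \<phi> \<phi> \<le> e_hi * (L2norm \<Omega> (\<lambda>x. \<phi> x - grad u x))\<^sup>2 + cf\<^sup>2 * (L2norm \<Omega> g)\<^sup>2"
    if u: "test_fun \<Omega> u" for u
  proof -
    have c: "continuous_on UNIV u" "continuous_on UNIV (grad u)"
      using cgrad_continuous[OF test_fun_cgrad[OF u]] cgrad_cont_grad[OF test_fun_cgrad[OF u]] .
    have squ: "square_integrable ?M u" "square_integrable ?M (grad u)"
      using L2_continuous[OF \<Omega>(1,3) c(1)] L2_continuous[OF \<Omega>(1,3) c(2)] by (simp_all add: L2_eq)
    have sqd: "square_integrable ?M (\<lambda>x. \<phi> x - grad u x)" by (rule square_integrable_diff[OF sq(1) squ(2)])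
    note i = bilinear_integrable[OF m b]
    have sym: "B (grad u) \<phi> = B \<phi> (grad u)"
      unfolding B_def
    proof (rule integral_cong_AE)
      show "AE x in ?M. (\<epsilon> x *v grad u x) \<bullet> \<phi> x = (\<epsilon> x *v \<phi> x) \<bullet> grad u x"
        using s by eventually_elim (rule transpose_bilinear)
    qed (use borel_measurable_integrable[OF i] squ sq in auto)
    \<comment> \<open>Expanding the quadratic form at the remainder isolates the part of
      \<open>\<phi>\<close> that rotation controls; the self-adjointness in \<open>sym\<close>
      merges the two cross terms, which the divergence controls.\<close>
    have "B (\<lambda>x. \<phi> x - grad u x) (\<lambda>x. \<phi> x - grad u x) = B \<phi> \<phi> - B \<phi> (grad u) - (B (grad u) \<phi> - B (grad u) (grad u))"
      unfolding B_def using i[OF sq(1) sq(1)] i[OF sq(1) squ(2)] i[OF squ(2) sq(1)] i[OF squ(2) squ(2)]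
      by (simp add: matrix_vector_mult_diff_distrib inner_diff_left inner_diff_right)
    then have ex: "B \<phi> \<phi> = B (\<lambda>x. \<phi> x - grad u x) (\<lambda>x. \<phi> x - grad u x) + 2 * B \<phi> (grad u) - B (grad u) (grad u)"
      by (simp add: sym)
    define t where "t = eps_norm \<Omega> \<epsilon> (grad u)"
    have t: "t\<^sup>2 = B (grad u) (grad u)" unfolding t_def by (rule eps2[OF squ(2)])
    \<comment> \<open>\<open>u\<close> is itself a test function, so the definition of the weak
      divergence applies without a density argument.\<close>
    have "B \<phi> (grad u) = - integral\<^sup>L ?M (\<lambda>x. g x \<bullet> u x)"
      using g u by (simp add: weak_div_def B_def)
    then have "B \<phi> (grad u) \<le> L2norm \<Omega> g * L2norm \<Omega> u"
      using l2_Cauchy_Schwarz[OF sq(2) squ(1)] by (simp add: L2norm_eq)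
    also have "\<dots> \<le> L2norm \<Omega> g * (cf * t)"
      unfolding t_def by (intro mult_left_mono cf(2) test_fun_H10 \<Omega> u) (simp add: L2norm_eq)
    finally have "B \<phi> (grad u) \<le> (cf * L2norm \<Omega> g) * t" by (simp add: mult_ac)
    moreover have "2 * ((cf * L2norm \<Omega> g) * t) \<le> (cf * L2norm \<Omega> g)\<^sup>2 + t\<^sup>2"
      using sum_squares_bound[of "cf * L2norm \<Omega> g" t] by (simp add: mult.assoc)
    moreover have "B (\<lambda>x. \<phi> x - grad u x) (\<lambda>x. \<phi> x - grad u x) \<le> e_hi * (L2norm \<Omega> (\<lambda>x. \<phi> x - grad u x))\<^sup>2"
      using form[of "\<lambda>x. \<phi> x - grad u x"] sqd by (simp add: L2_eq B_def)
    ultimately show ?thesis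
      unfolding ex t[symmetric] power_mult_distrib[of cf, symmetric] by linarith
  qed
  let ?r = "L2norm \<Omega> r"
  have r0: "0 \<le> ?r" by (simp add: L2norm_eq)
  have le: "B \<phi> \<phi> \<le> e_hi * (cp * ?r + d)\<^sup>2 + cf\<^sup>2 * (L2norm \<Omega> g)\<^sup>2" if d: "0 < d" for d
  proof -
    obtain u where u: "test_fun \<Omega> u" "L2norm \<Omega> (\<lambda>x. \<phi> x - grad u x) \<le> cp * ?r + d"
      by (rule R0_near_gradient[OF \<Omega>(1,4,3) P cp(1) \<phi> d])
    have "e_hi * (L2norm \<Omega> (\<lambda>x. \<phi> x - grad u x))\<^sup>2 \<le> e_hi * (cp * ?r + d)\<^sup>2"
      using u(2) e(2) by (intro mult_left_mono power_mono) (auto simp: L2norm_eq)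
    then show ?thesis using est[OF u(1)] by linarith
  qed
  have lim: "((\<lambda>d. e_hi * (cp * ?r + d)\<^sup>2 + cf\<^sup>2 * (L2norm \<Omega> g)\<^sup>2) \<longlongrightarrow> e_hi * (cp * ?r + 0)\<^sup>2 + cf\<^sup>2 * (L2norm \<Omega> g)\<^sup>2) (at_right 0)"
    by (intro tendsto_intros)
  have "B \<phi> \<phi> \<le> e_hi * (cp * ?r + 0)\<^sup>2 + cf\<^sup>2 * (L2norm \<Omega> g)\<^sup>2"
    by (rule tendsto_lowerbound[OF lim])
      (use le in \<open>auto simp: eventually_at_right_field intro!: exI[of _ 1]\<close>)
  also have "\<dots> = (sqrt e_hi * cp)\<^sup>2 * ?r\<^sup>2 + cf\<^sup>2 * (L2norm \<Omega> g)\<^sup>2"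
    using e(2) by (simp add: power_mult_distrib)
  also have "\<dots> \<le> (max cf (sqrt e_hi * cp))\<^sup>2 * ?r\<^sup>2 + (max cf (sqrt e_hi * cp))\<^sup>2 * (L2norm \<Omega> g)\<^sup>2"
    using cf(1) cp(1) e(2) by (intro add_mono mult_right_mono power_mono) auto
  also have "\<dots> = (max cf (sqrt e_hi * cp))\<^sup>2 * ((L2norm \<Omega> g)\<^sup>2 + ?r\<^sup>2)" by (simp add: algebra_simps)
  finally have "(eps_norm \<Omega> \<epsilon> \<phi>)\<^sup>2 \<le> (max cf (sqrt e_hi * cp) * sqrt ((L2norm \<Omega> g)\<^sup>2 + ?r\<^sup>2))\<^sup>2"
    by (simp add: eps2[OF sq(1)] power_mult_distrib)
  then show ?thesis
    by (rule power2_le_imp_le) (use cf(1) in \<open>auto intro!: mult_nonneg_nonneg simp: le_max_iff_disj\<close>)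
qed

theorem theorem3p5:
  fixes \<Omega> :: "(real^3) set" and \<epsilon> :: "real^3 \<Rightarrow> real^3^3" and e_lo e_hi :: real
  assumes "open \<Omega>" and "connected \<Omega>" and "\<Omega> \<noteq> {}" and "bounded \<Omega>" and "convex \<Omega>"
    and "\<And>i j. (\<lambda>x. \<epsilon> x $ i $ j) \<in> borel_measurable (lebesgue_on \<Omega>)"
    and "\<exists>B. AE x in lebesgue_on \<Omega>. norm (\<epsilon> x) \<le> B"
    and "AE x in lebesgue_on \<Omega>. transpose (\<epsilon> x) = \<epsilon> x"
    and "e_lo > 0" and "e_hi > 0"
    and "\<And>\<phi>. L2 \<Omega> \<phi> \<Longrightarrow>
           e_lo * (L2norm \<Omega> \<phi>)\<^sup>2 \<le> integral\<^sup>L (lebesgue_on \<Omega>) (\<lambda>x. (\<epsilon> x *v \<phi> x) \<bullet> \<phi> x)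
         \<and> integral\<^sup>L (lebesgue_on \<Omega>) (\<lambda>x. (\<epsilon> x *v \<phi> x) \<bullet> \<phi> x) \<le> e_hi * (L2norm \<Omega> \<phi>)\<^sup>2"
  shows "c_m \<Omega> \<epsilon> \<le> max (c_f \<Omega> \<epsilon>) (ereal (sqrt e_hi) * c_p \<Omega>)"
proof (rule ccontr)
  obtain b where b: "AE x in lebesgue_on \<Omega>. norm (\<epsilon> x) \<le> b" using assms(7) by blast
  \<comment> \<open>The constants are infima in the extended reals and may be infinite or not
    attained. Assuming the contrary makes the right-hand side strictly smaller than
    \<open>c_m\<close>, which leaves room for admissible real constants \<open>cf\<close> and
    \<open>cp\<close> in between.\<close>
  assume "\<not> c_m \<Omega> \<epsilon> \<le> max (c_f \<Omega> \<epsilon>) (ereal (sqrt e_hi) * c_p \<Omega>)"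
  then have less: "c_f \<Omega> \<epsilon> < c_m \<Omega> \<epsilon>" "ereal (sqrt e_hi) * c_p \<Omega> < c_m \<Omega> \<epsilon>"
    by (simp_all add: not_le)
  have sp: "0 < ereal (sqrt e_hi)" using assms(10) by simp
  obtain cf where cf: "ereal cf < c_m \<Omega> \<epsilon>" "0 \<le> cf"
    "\<forall>u g. H10 \<Omega> u g \<longrightarrow> L2norm \<Omega> u \<le> cf * eps_norm \<Omega> \<epsilon> g"
    using less(1) unfolding c_f_def least_const_def Inf_less_iff by auto
  \<comment> \<open>The positive finite factor is divided out first, so that the infimum defining
    \<open>c_p\<close> stands alone and a suitable \<open>cp\<close> can be picked from it.\<close>
  have "c_p \<Omega> < c_m \<Omega> \<epsilon> / ereal (sqrt e_hi)"
  proof (rule ccontr)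
    assume "\<not> c_p \<Omega> < c_m \<Omega> \<epsilon> / ereal (sqrt e_hi)"
    then have "c_m \<Omega> \<epsilon> \<le> ereal (sqrt e_hi) * c_p \<Omega>"
      using ereal_divide_le_pos[OF sp, of "c_m \<Omega> \<epsilon>" "c_p \<Omega>"] by (simp add: not_less)
    then show False using less(2) by simp
  qed
  then obtain cp where cp: "ereal cp < c_m \<Omega> \<epsilon> / ereal (sqrt e_hi)" "0 \<le> cp"
    "\<forall>u g. weak_grad \<Omega> u g \<and> integral\<^sup>L (lebesgue_on \<Omega>) u = 0 \<longrightarrow> L2norm \<Omega> u \<le> cp * L2norm \<Omega> g"
    unfolding c_p_def least_const_def Inf_less_iff by auto
  have cp': "ereal (sqrt e_hi * cp) < c_m \<Omega> \<epsilon>"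
    using cp(1) ereal_divide_le_pos[OF sp, of "c_m \<Omega> \<epsilon>" "ereal cp"] by (simp add: not_le[symmetric])
  let ?c = "max cf (sqrt e_hi * cp)"
  have "c_m \<Omega> \<epsilon> \<le> ereal ?c"
    unfolding c_m_def least_const_def
  proof (rule Inf_lower, intro CollectI exI[of _ ?c] conjI allI impI)
    show "0 \<le> ?c" using cf(2) by simp
    fix \<phi> r g assume "R0 \<Omega> \<phi> r \<and> weak_div \<Omega> (\<lambda>x. \<epsilon> x *v \<phi> x) g"
    then show "eps_norm \<Omega> \<epsilon> \<phi> \<le> ?c * sqrt ((L2norm \<Omega> g)\<^sup>2 + (L2norm \<Omega> r)\<^sup>2)"
      using cf(3) cp(3)
      by (intro maxwell_bound[OF assms(1,3,4,5,6) b assms(8,9,10,11) cf(2) _ cp(2)]) auto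
  qed simp
  then show False using cf(1) cp' by (simp add: max_def split: if_splits)
qed

end
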